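(* (a) Every finite sggi $G=\langle g_0,\ldots,g_{n-1}\rangle$ is covered by a finite string C-group $G'$ (of the same rank $n$). (b) Every finite abstract $n$-polytope $\mathcal{Q}$ is covered by a finite regular abstract $n$-polytope $\mathcal{R}$. Moreover, if all $k$-faces of $\mathcal{Q}$ are isomorphic to some regular $k$-polytope $\mathcal{K}$, then $\mathcal{R}$ may be chosen to have its $k$-faces isomorphic to $\mathcal{K}$.
   Context: **Groups.** A string group generated by involutions (sggi) of rank $n$ is a group $G=\langle g_0,\ldots,g_{n-1}\rangle$ together with a specified ordered list of generators $g_0,\ldots,g_{n-1}$, each of which is an involution (has period 2), such that $(g_jg_k)^2=1$ whenever $|j-k|>1$. Coincidences such as $g_{j-1}=g_j$ are allowed. A string C-group is an sggi $\langle g_0,\ldots,g_{n-1}\rangle$ which also satisfies the intersection condition $$\langle g_k : k\in I\rangle\cap\langle g_k: k\in J\rangle=\langle g_k : k\in I\cap J\rangle\quad\text{for all } I,J\subseteq\{0,\ldots,n-1\}.$$ An sggi $H=\langle h_0,\ldots,h_{n-1}\rangle$ covers an sggi $G=\langle g_0,\ldots,g_{n-1}\rangle$ of the same rank if there is a group epimorphism $H\to G$ with $h_j\mapsto g_j$ for all $j$. **Polytopes.** An abstract $n$-polytope is a partially ordered set $\mathcal{P}$, whose elements are called faces, with the following properties. (A) $\mathcal{P}$ has a strictly monotone rank function with range $\{-1,0,\ldots,n\}$, a unique least face $F_{-1}$ (rank $-1$) and a unique greatest face $F_n$ (rank $n$); each maximal chain (called a flag) contains exactly $n+2$ faces, one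 of each rank. (B) Whenever $F<G$ with $\mathrm{rank}(F)=j-1$ and $\mathrm{rank}(G)=j+1$, there are exactly two faces $H$ of rank $j$ with $F<H<G$. (C) For all faces $F\leq G$, the flag graph of the section $G/F:=\{H\in\mathcal{P} : F\leq H\leq G\}$ is connected. Here the vertices of the flag graph of a section are its flags (maximal chains), and two flags are joined by an edge when they are adjacent, i.e. differ in exactly one face. Two flags of $\mathcal{P}$ are $j$-adjacent if they differ exactly in their faces of rank $j$. A $k$-face of $\mathcal{P}$ is a face $G$ of rank $k$; it is viewed as the $k$-polytope $G/F_{-1}$, and "isomorphic" means isomorphic as partially ordered sets. The automorphism group $\Gamma(\mathcal{P})$ is the group of order-preserving bijections of $\mathcal{P}$ (automorphisms of the poset), and $\mathcal{P}$ is regular if $\Gamma(\mathcal{P})$ is transitive on the flags of $\mathcal{P}$. For $n$-polytopes $\mathcal{R}$ and $\mathcal{Q}$, a covering is an order-preserving map $\eta:\mathcal{R}\to\mathcal{Q}$ which preserves rank and adjacency: it induces a map from flags of $\mathcal{R}$ to flags of $\mathcal{Q}$ sending every pair of $j$-adjacent flags to a pair of $j$-adjacent flags, for each $0\leq j\leq n-1$ (such a map is necessarily surjective). One says that $\mathcal{Q}$ is covered by $\mathcal{R}$ if there is a covering $\mathcal{R}\to\mathcal{Q}$. *)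

theory Defs
  imports "HOL-Algebra.Generated_Groups" "HOL-Algebra.Multiplicative_Group"
begin

section \<open>String groups generated by involutions\<close>

text \<open>Only the values of \<open>g\<close> on \<open>{..<n}\<close> matter; they need not be distinct.\<close>

locale sggi = group G for G (structure) +
  fixes n :: nat and g :: "nat \<Rightarrow> 'a"
  assumes gens_closed: "g ` {..<n} \<subseteq> carrier G"
    and gens_generate: "generate G (g ` {..<n}) = carrier G"
    and gens_involution: "\<And>j. j < n \<Longrightarrow> ord (g j) = 2"
    and gens_commute: "\<And>j k. j < n \<Longrightarrow> k < n \<Longrightarrow> \<bar>int j - int k\<bar> > 1 \<Longrightarrow>
      (g j \<otimes> g k) [^] (2::nat) = \<one>"

locale string_C_group = sggi +
  assumes intersection_condition: "\<And>I J. I \<subseteq> {..<n} \<Longrightarrow> J \<subseteq> {..<n} \<Longrightarrow>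
    generate G (g ` I) \<inter> generate G (g ` J) = generate G (g ` (I \<inter> J))"

definition sggi_covers ::
  "nat \<Rightarrow> ('b, 'k) monoid_scheme \<Rightarrow> (nat \<Rightarrow> 'b) \<Rightarrow> ('a, 'm) monoid_scheme \<Rightarrow> (nat \<Rightarrow> 'a) \<Rightarrow> bool"
  where "sggi_covers n H h G g \<longleftrightarrow> (\<exists>\<phi>\<in>epi H G. \<forall>j<n. \<phi> (h j) = g j)"


section \<open>Posets and flags\<close>

text \<open>A poset is given by its reflexive order relation \<open>P\<close>, with \<^prop>\<open>(F, G) \<in> P\<close>
  read as \<open>F \<le> G\<close>; its elements form \<^term>\<open>Field P\<close>.\<close>

definition poset_iso :: "'a rel \<Rightarrow> 'b rel \<Rightarrow> ('a \<Rightarrow> 'b) \<Rightarrow> bool"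
  where "poset_iso P Q f \<longleftrightarrow> bij_betw f (Field P) (Field Q) \<and>
    (\<forall>F\<in>Field P. \<forall>G\<in>Field P. (F, G) \<in> P \<longleftrightarrow> (f F, f G) \<in> Q)"

definition poset_isomorphic :: "'a rel \<Rightarrow> 'b rel \<Rightarrow> bool"
  where "poset_isomorphic P Q \<longleftrightarrow> (\<exists>f. poset_iso P Q f)"

text \<open>Automorphisms are total functions here, so each one is represented by all of its
  extensions outside \<^term>\<open>Field P\<close>; this is immaterial for the action on faces and flags.\<close>

definition automorphisms :: "'a rel \<Rightarrow> ('a \<Rightarrow> 'a) set"
  where "automorphisms P = {f. poset_iso P P f}"

text \<open>Membership in \<^const>\<open>Chains\<close> already forces a set to lie in the field of the relation.\<close>

definition flags :: "'a rel \<Rightarrow> 'a set set"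
  where "flags P = {\<Phi> \<in> Chains P. \<forall>\<Psi>\<in>Chains P. \<Phi> \<subseteq> \<Psi> \<longrightarrow> \<Psi> = \<Phi>}"

definition section_poset :: "'a rel \<Rightarrow> 'a \<Rightarrow> 'a \<Rightarrow> 'a rel"
  where "section_poset P F G = Restr P {H. (F, H) \<in> P \<and> (H, G) \<in> P}"

definition flags_adjacent :: "'a set \<Rightarrow> 'a set \<Rightarrow> bool"
  where "flags_adjacent \<Phi> \<Psi> \<longleftrightarrow> (\<exists>F G. \<Phi> - \<Psi> = {F} \<and> \<Psi> - \<Phi> = {G})"

definition flag_graph :: "'a rel \<Rightarrow> 'a set rel"
  where "flag_graph P = {(\<Phi>, \<Psi>). \<Phi> \<in> flags P \<and> \<Psi> \<in> flags P \<and> flags_adjacent \<Phi> \<Psi>}"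

definition flag_connected :: "'a rel \<Rightarrow> bool"
  where "flag_connected P \<longleftrightarrow> (\<forall>\<Phi>\<in>flags P. \<forall>\<Psi>\<in>flags P. (\<Phi>, \<Psi>) \<in> (flag_graph P)\<^sup>*)"

definition least_face :: "'a rel \<Rightarrow> 'a"
  where "least_face P = (THE F. F \<in> Field P \<and> (\<forall>G\<in>Field P. (F, G) \<in> P))"


section \<open>Abstract polytopes\<close>

text \<open>The rank function is carried as a parameter; on \<^term>\<open>Field P\<close> it is determined by \<open>P\<close>.
  The rank \<open>n\<close> is an integer because the least face of a polytope is regarded as a
  polytope of rank \<open>-1\<close>; the axioms exclude \<open>n < -1\<close>.\<close>

locale abstract_polytope =
  fixes n :: int and P :: "'a rel" and rk :: "'a \<Rightarrow> int"
  assumes partial_order: "Partial_order P"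
    and rank_strict_mono: "\<And>F G. (F, G) \<in> P \<Longrightarrow> F \<noteq> G \<Longrightarrow> rk F < rk G"
    and rank_range: "rk ` Field P = {-1..n}"
    and least: "\<exists>F\<in>Field P. rk F = -1 \<and> (\<forall>G\<in>Field P. (F, G) \<in> P)"
    and greatest: "\<exists>F\<in>Field P. rk F = n \<and> (\<forall>G\<in>Field P. (G, F) \<in> P)"
    and flag_ranks: "\<And>\<Phi>. \<Phi> \<in> flags P \<Longrightarrow> bij_betw rk \<Phi> {-1..n}"
    and diamond: "\<And>F G j. (F, G) \<in> P \<Longrightarrow> F \<noteq> G \<Longrightarrow> rk F = j - 1 \<Longrightarrow> rk G = j + 1 \<Longrightarrow>
      card {H \<in> Field P. rk H = j \<and> (F, H) \<in> P \<and> F \<noteq> H \<and> (H, G) \<in> P \<and> H \<noteq> G} = 2"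
    and sections_flag_connected: "\<And>F G. (F, G) \<in> P \<Longrightarrow> flag_connected (section_poset P F G)"

locale regular_polytope = abstract_polytope +
  assumes flag_transitive:
    "\<And>\<Phi> \<Psi>. \<Phi> \<in> flags P \<Longrightarrow> \<Psi> \<in> flags P \<Longrightarrow> \<exists>\<gamma>\<in>automorphisms P. \<gamma> ` \<Phi> = \<Psi>"

definition k_faces :: "'a rel \<Rightarrow> ('a \<Rightarrow> int) \<Rightarrow> int \<Rightarrow> 'a set"
  where "k_faces P rk k = {F \<in> Field P. rk F = k}"

definition k_faces_isomorphic_to :: "'a rel \<Rightarrow> ('a \<Rightarrow> int) \<Rightarrow> int \<Rightarrow> 'b rel \<Rightarrow> bool"
  where "k_faces_isomorphic_to P rk k K \<longleftrightarrow>
    (\<forall>G\<in>k_faces P rk k. poset_isomorphic (section_poset P (least_face P) G) K)"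


section \<open>Coverings of polytopes\<close>

definition j_adjacent :: "('a \<Rightarrow> int) \<Rightarrow> int \<Rightarrow> 'a set \<Rightarrow> 'a set \<Rightarrow> bool"
  where "j_adjacent rk j \<Phi> \<Psi> \<longleftrightarrow>
    \<Phi> \<noteq> \<Psi> \<and> {F \<in> \<Phi>. rk F \<noteq> j} = {F \<in> \<Psi>. rk F \<noteq> j}"

definition polytope_covering ::
  "int \<Rightarrow> 'a rel \<Rightarrow> ('a \<Rightarrow> int) \<Rightarrow> 'b rel \<Rightarrow> ('b \<Rightarrow> int) \<Rightarrow> ('a \<Rightarrow> 'b) \<Rightarrow> bool"
  where "polytope_covering n R rkR Q rkQ \<eta> \<longleftrightarrow>
    \<eta> ` Field R \<subseteq> Field Q \<and>
    (\<forall>F G. (F, G) \<in> R \<longrightarrow> (\<eta> F, \<eta> G) \<in> Q) \<and>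
    (\<forall>F\<in>Field R. rkQ (\<eta> F) = rkR F) \<and>
    (\<forall>\<Phi>\<in>flags R. \<eta> ` \<Phi> \<in> flags Q) \<and>
    (\<forall>j\<in>{0..n - 1}. \<forall>\<Phi>\<in>flags R. \<forall>\<Psi>\<in>flags R.
      j_adjacent rkR j \<Phi> \<Psi> \<longrightarrow> j_adjacent rkQ j (\<eta> ` \<Phi>) (\<eta> ` \<Psi>))"

definition polytope_covers ::
  "int \<Rightarrow> 'a rel \<Rightarrow> ('a \<Rightarrow> int) \<Rightarrow> 'b rel \<Rightarrow> ('b \<Rightarrow> int) \<Rightarrow> bool"
  where "polytope_covers n R rkR Q rkQ \<longleftrightarrow> (\<exists>\<eta>. polytope_covering n R rkR Q rkQ \<eta>)"

end

theory Submission
  imports Defs "HOL-Algebra.Product_Groups" "HOL-Algebra.Weak_Morphisms" "HOL-Algebra.Bij"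
    "HOL-Library.Nat_Bijection"
begin

text \<open>Given an sggi \<open>G\<close> with generators \<open>g 0, \<dots>, g (n - 1)\<close>, let \<open>G'\<close> be generated in the power
  \<open>G\<^sup>n\<^sup>+\<^sup>1\<close> by the tuples whose \<open>m\<close>-th coordinate is \<open>g j\<close> if \<open>j < m\<close> and \<open>\<one>\<close> otherwise. For each \<open>m\<close>,
  killing the generators with index at least \<open>m\<close> is a retraction of \<open>G'\<close>, and these retractions give
  the intersection condition by induction on \<open>m\<close>. If the first \<open>k\<close> generators of \<open>G\<close> already
  generate a string C-group, only the coordinates \<open>m \<ge> k\<close> are needed, and that subgroup is unchanged.

  For a polytope, \<open>G\<close> is the monodromy group, which acts on the flags by changing single faces. The
  coset geometry of \<open>G'\<close> is a regular polytope, and letting \<open>G'\<close> act on a base flag gives the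
  covering. If the \<open>k\<close>-faces are isomorphic to a regular polytope, then the monodromy of the ranks
  below \<open>k\<close> acts freely, hence is a string C-group, and the covering is injective on \<open>k\<close>-faces.\<close>

section \<open>Groups generated by involutions\<close>

text \<open>The intersection condition fails when a word in some generators equals a word in others
  for no visible reason. An endomorphism that kills generator \<open>m\<close> and fixes the earlier
  ones rules this out: an element spanned by the first \<open>m\<close> generators is fixed by it,
  so generator \<open>m\<close> can be struck from any other expression for that element. A general
  sggi has no such endomorphisms. Tuples have them because capping the index at \<open>m\<close>
  overwrites the later coordinates with coordinate \<open>m\<close>, where the generators from
  \<open>m\<close> on are trivial. Coordinate \<open>n\<close> is \<open>G\<close> itself, which
  gives the covering map and keeps all generators nontrivial.

  With the coordinates starting at \<open>k\<close>, the first \<open>k\<close> generators are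
  constant tuples and span a diagonal copy of the original group, which must therefore satisfy the
  condition already. This is where regularity of the \<open>k\<close>-faces enters: a low monodromy
  element is known from its effect on one flag, and axiom (C) turns the set of ranks at which two
  flags differ into a bound on the generators needed to join them.

  The results live on \<open>nat\<close>, so finite groups and cosets are finally encoded as
  numbers.\<close>

lemma (in group) ord_eq_2_iff:
  assumes "x \<in> carrier G"
  shows "ord x = 2 \<longleftrightarrow> x \<noteq> \<one> \<and> x \<otimes> x = \<one>"
proof
  assume "ord x = 2"
  then show "x \<noteq> \<one> \<and> x \<otimes> x = \<one>"
    using assms pow_ord_eq_1[of x] ord_eq_1[of x] by (auto simp: numeral_2_eq_2)
next
  assume x: "x \<noteq> \<one> \<and> x \<otimes> x = \<one>"
  then have "ord x dvd 2"
    using assms pow_eq_id[of x 2] by (simp add: numeral_2_eq_2)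
  moreover from this have "ord x \<le> 2"
    by (rule dvd_imp_le) simp
  moreover from \<open>ord x dvd 2\<close> have "ord x \<noteq> 0"
    by (metis dvd_0_left zero_neq_numeral)
  moreover have "ord x \<noteq> 1"
    using x assms ord_eq_1 by blast
  ultimately show "ord x = 2"
    by linarith
qed

text \<open>An involution is its own inverse, so \<open>x \<otimes> y\<close> has inverse
  \<open>y \<otimes> x\<close>; to square to one is to be one's own inverse.\<close>

lemma (in group) involutions_commute_iff:
  assumes "x \<in> carrier G" "y \<in> carrier G" "x \<otimes> x = \<one>" "y \<otimes> y = \<one>"
  shows "(x \<otimes> y) [^] (2::nat) = \<one> \<longleftrightarrow> x \<otimes> y = y \<otimes> x"
proof -
  have "inv x = x" "inv y = y"
    using assms by (auto intro: inv_equality)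
  then have "inv (x \<otimes> y) = y \<otimes> x"
    using assms by (simp add: inv_mult_group)
  moreover have "x \<otimes> y \<in> carrier G"
    using assms by simp
  ultimately show ?thesis
    using inv_equality[of "x \<otimes> y" "x \<otimes> y"] l_inv[of "x \<otimes> y"]
    by (metis nat_pow_Suc nat_pow_eone numeral_2_eq_2 One_nat_def)
qed

text \<open>In contrast to \<open>sggi\<close>, the \<open>g j\<close> may span a proper subgroup:
  the locale is also instantiated with a full power of a group and with the group of all
  permutations of the flags.\<close>

locale string_involutions = group G for G (structure) +
  fixes n :: nat and g :: "nat \<Rightarrow> 'a"
  assumes g_closed: "\<And>j. j < n \<Longrightarrow> g j \<in> carrier G"
    and g_nontrivial: "\<And>j. j < n \<Longrightarrow> g j \<noteq> \<one>"
    and g_square: "\<And>j. j < n \<Longrightarrow> g j \<otimes> g j = \<one>"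
    and g_commute: "\<And>i j. i < n \<Longrightarrow> j < n \<Longrightarrow> i + 1 < j \<Longrightarrow> g i \<otimes> g j = g j \<otimes> g i"
begin

definition gen :: "nat set \<Rightarrow> 'a set"
  where "gen I = generate G (g ` I)"

lemma g_inv: "j < n \<Longrightarrow> inv (g j) = g j"
  by (simp add: g_closed g_square inv_equality)

lemma image_closed: "I \<subseteq> {..<n} \<Longrightarrow> g ` I \<subseteq> carrier G"
  using g_closed by auto

lemma subgroup_gen: "I \<subseteq> {..<n} \<Longrightarrow> subgroup (gen I) G"
  unfolding gen_def by (intro generate_is_subgroup image_closed)

lemma gen_carrier: "I \<subseteq> {..<n} \<Longrightarrow> x \<in> gen I \<Longrightarrow> x \<in> carrier G"
  by (rule subgroup.mem_carrier[OF subgroup_gen])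

lemma gen_one [simp]: "\<one> \<in> gen I"
  by (simp add: gen_def generate.one)

lemma gen_g: "j \<in> I \<Longrightarrow> g j \<in> gen I"
  by (simp add: gen_def generate.incl)

lemma gen_mult: "x \<in> gen I \<Longrightarrow> y \<in> gen I \<Longrightarrow> x \<otimes> y \<in> gen I"
  unfolding gen_def by (rule generate.eng)

lemma gen_inv: "I \<subseteq> {..<n} \<Longrightarrow> x \<in> gen I \<Longrightarrow> inv x \<in> gen I"
  by (rule subgroup.m_inv_closed[OF subgroup_gen])

lemma gen_mono: "I \<subseteq> J \<Longrightarrow> gen I \<subseteq> gen J"
  unfolding gen_def by (intro mono_generate image_mono)

lemma gen_monoD: "x \<in> gen I \<Longrightarrow> I \<subseteq> J \<Longrightarrow> x \<in> gen J"
  using gen_mono by blast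

text \<open>Generators equal their inverses, so the inverse case of \<open>generate.induct\<close>
  merges with the generator case.\<close>

lemma gen_induct [consumes 2, case_names one gen mult]:
  assumes "I \<subseteq> {..<n}" "x \<in> gen I"
    and "P \<one>" "\<And>j. j \<in> I \<Longrightarrow> P (g j)"
    and "\<And>x y. x \<in> gen I \<Longrightarrow> y \<in> gen I \<Longrightarrow> P x \<Longrightarrow> P y \<Longrightarrow> P (x \<otimes> y)"
  shows "P x"
  using assms(2) unfolding gen_def
proof (induction rule: generate.induct)
  case (inv h)
  then show ?case using assms(1,4) g_inv by auto
qed (use assms in \<open>auto simp: gen_def\<close>)

lemma gen_singleton: "j < n \<Longrightarrow> gen {j} = {\<one>, g j}"
proof
  assume j: "j < n"
  show "gen {j} \<subseteq> {\<one>, g j}"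
  proof
    fix x assume "x \<in> gen {j}"
    with j have "{j} \<subseteq> {..<n}" "x \<in> gen {j}" by auto
    then show "x \<in> {\<one>, g j}"
      by (induction rule: gen_induct) (use j g_closed g_square in auto)
  qed
qed (auto intro: gen_g)

lemma gen_empty: "gen {} = {\<one>}"
  by (simp add: gen_def generate_empty)

lemma gen_commute:
  assumes IJ: "I \<subseteq> {..<n}" "J \<subseteq> {..<n}" and far: "\<And>i j. i \<in> I \<Longrightarrow> j \<in> J \<Longrightarrow> \<bar>int i - int j\<bar> > 1"
    and x: "x \<in> gen I" and y: "y \<in> gen J"
  shows "x \<otimes> y = y \<otimes> x"
proof -
  have gj: "x \<otimes> g j = g j \<otimes> x" if j: "j \<in> J" for j
    using IJ(1) x
  proof (induction rule: gen_induct)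
    case one
    then show ?case using IJ j g_closed by auto
  next
    case (gen i)
    with IJ j far[of i j] show ?case
      using g_commute[of i j] g_commute[of j i] by (cases "i < j") auto
  next
    case (mult a b)
    have c: "a \<in> carrier G" "b \<in> carrier G" "g j \<in> carrier G"
      using mult IJ j g_closed gen_carrier by auto
    show ?case
      using mult c by (metis m_assoc)
  qed
  have xc: "x \<in> carrier G"
    using x IJ gen_carrier by auto
  show ?thesis
    using IJ(2) y
  proof (induction rule: gen_induct)
    case (mult a b)
    then have "a \<in> carrier G" "b \<in> carrier G" using IJ gen_carrier by auto
    with mult xc show ?case by (metis m_assoc)
  qed (use xc gj in auto)
qed

text \<open>Letters with indices in \<open>I\<close> commute with those in \<open>J\<close>, so a
  word can be sorted into two blocks. Both orders are offered because some coset arguments want the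
  \<open>J\<close>-part on the left.\<close>

lemma gen_union_split:
  assumes IJ: "I \<subseteq> {..<n}" "J \<subseteq> {..<n}" and far: "\<And>i j. i \<in> I \<Longrightarrow> j \<in> J \<Longrightarrow> \<bar>int i - int j\<bar> > 1"
    and x: "x \<in> gen (I \<union> J)"
  obtains u v where "u \<in> gen I" "v \<in> gen J" "x = u \<otimes> v" "x = v \<otimes> u"
proof -
  have "I \<union> J \<subseteq> {..<n}" using IJ by auto
  then have "\<exists>u\<in>gen I. \<exists>v\<in>gen J. x = u \<otimes> v"
    using x
  proof (induction rule: gen_induct)
    case one
    then show ?case by (metis gen_one l_one one_closed)
  next
    case (gen j)
    then have "g j \<in> carrier G" using IJ g_closed by auto
    with gen show ?case
      by (metis Un_iff gen_g gen_one l_one r_one)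
  next
    case (mult x y)
    then obtain u v u' v' where
      uv: "u \<in> gen I" "v \<in> gen J" "x = u \<otimes> v" "u' \<in> gen I" "v' \<in> gen J" "y = u' \<otimes> v'"
      by blast
    then have c: "u \<in> carrier G" "v \<in> carrier G" "u' \<in> carrier G" "v' \<in> carrier G"
      using gen_carrier IJ by auto
    have "u' \<otimes> v = v \<otimes> u'"
      using gen_commute[OF IJ far] uv by blast
    then have "x \<otimes> y = (u \<otimes> u') \<otimes> (v \<otimes> v')"
      using uv c by (metis m_assoc m_closed)
    then show ?case using uv gen_mult by blast
  qed
  then obtain u v where uv: "u \<in> gen I" "v \<in> gen J" "x = u \<otimes> v" by blast
  then have "x = v \<otimes> u" using gen_commute[OF IJ far] by blast
  with uv show thesis using that by blast
qed

lemma hom_gen_image: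
  assumes "group H" "f \<in> hom G H" "I \<subseteq> {..<n}"
  shows "f ` gen I = generate H ((f \<circ> g) ` I)"
proof -
  interpret f: group_hom G H f
    using assms by (simp add: group_hom_def group_hom_axioms_def group_axioms)
  show ?thesis
    using f.generate_img[OF image_closed[OF assms(3)]] by (simp add: gen_def image_comp)
qed

subsection \<open>The intersection condition\<close>

text \<open>Stated for the first \<open>m\<close> generators so that it can be proved by induction
  on \<open>m\<close>.\<close>

definition intersecting :: "nat \<Rightarrow> bool"
  where "intersecting m \<longleftrightarrow> (\<forall>I\<subseteq>{..<m}. \<forall>J\<subseteq>{..<m}. gen I \<inter> gen J = gen (I \<inter> J))"

lemma intersectingD:
  "intersecting m \<Longrightarrow> I \<subseteq> {..<m} \<Longrightarrow> J \<subseteq> {..<m} \<Longrightarrow> x \<in> gen I \<Longrightarrow> x \<in> gen J \<Longrightarrow> x \<in> gen (I \<inter> J)"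
  unfolding intersecting_def by blast

text \<open>For \<open>I\<close> and \<open>J\<close> both containing \<open>m\<close>, the final intervals \<open>{i..m}\<close> and \<open>{j..m}\<close> of \<open>I\<close> and
  \<open>J\<close> are nested, and the remaining generators commute with them.\<close>

lemma intersecting_top:
  assumes m: "m < n" and IP: "intersecting m"
    and facet: "\<And>i. gen {..<m} \<inter> gen {i..m} \<subseteq> gen {i..<m}"
    and i: "{i..m} \<subseteq> I" "i = 0 \<or> i - 1 \<notin> I" "i \<le> m" "I \<subseteq> {..m}"
    and j: "{j..m} \<subseteq> J" "j = 0 \<or> j - 1 \<notin> J" "j \<le> m" "J \<subseteq> {..m}"
    and ij: "i \<le> j" and x: "x \<in> gen I" "x \<in> gen J"
  shows "x \<in> gen (I \<inter> J)"
proof -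
  have split: "\<exists>u\<in>gen (K \<inter> {..<l}). \<exists>v\<in>gen {l..m}. x = u \<otimes> v"
    if l: "{l..m} \<subseteq> K" "l = 0 \<or> l - 1 \<notin> K" "l \<le> m" "K \<subseteq> {..m}" "x \<in> gen K" for l K
  proof -
    have K: "K = (K \<inter> {..<l}) \<union> {l..m}" using l by auto
    \<comment> \<open>The index \<open>l - 1\<close> is missing from \<open>K\<close>, and this gap
      puts distance at least 2 between the two blocks.\<close>
    have far: "\<bar>int s - int t\<bar> > 1" if "s \<in> K \<inter> {..<l}" "t \<in> {l..m}" for s t
    proof -
      have "s \<noteq> l - 1" using that l by auto
      then show ?thesis using that by auto
    qed
    have sub: "K \<inter> {..<l} \<subseteq> {..<n}" "{l..m} \<subseteq> {..<n}"
      using l m by auto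
    have "x \<in> gen ((K \<inter> {..<l}) \<union> {l..m})" using l(5) K by simp
    then obtain u v where "u \<in> gen (K \<inter> {..<l})" "v \<in> gen {l..m}" "x = u \<otimes> v"
      using far by (rule_tac gen_union_split[OF sub])
    then show ?thesis by blast
  qed
  obtain u v where uv: "u \<in> gen (I \<inter> {..<i})" "v \<in> gen {i..m}" "x = u \<otimes> v"
    using split[OF i x(1)] by blast
  obtain s t where st: "s \<in> gen (J \<inter> {..<j})" "t \<in> gen {j..m}" "x = s \<otimes> t"
    using split[OF j x(2)] by blast
  have sub: "I \<inter> {..<i} \<subseteq> {..<n}" "{i..m} \<subseteq> {..<n}" "J \<inter> {..<j} \<subseteq> {..<n}" "{j..m} \<subseteq> {..<n}"
    "{..<m} \<subseteq> {..<n}"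
    using m i(3) j(3) by auto
  have c: "u \<in> carrier G" "v \<in> carrier G" "s \<in> carrier G" "t \<in> carrier G"
    using uv st sub gen_carrier by blast+
  have u: "u \<in> gen {..<m}"
    using uv(1) by (rule gen_monoD) (use i(3) in auto)
  have s: "s \<in> gen {..<m}"
    using st(1) by (rule gen_monoD) (use j(3) in auto)
  \<comment> \<open>Comparing \<open>u \<otimes> v = s \<otimes> t\<close> gives
    \<open>v \<otimes> inv t = inv u \<otimes> s\<close>. The left side uses only indices in
    \<open>{i..m}\<close>, the right side only indices below \<open>m\<close>, so
    \<open>facet\<close> places this element in \<open>gen {i..<m}\<close>.\<close>
  define w where "w = v \<otimes> inv t"
  have w: "w = inv u \<otimes> s" "s = u \<otimes> w"
    using uv(3) st(3) c unfolding w_def by (metis inv_closed inv_solve_left inv_solve_right m_assoc m_closed)+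
  have "w \<in> gen {..<m}"
    using w(1) u s sub gen_inv gen_mult by presburger
  moreover have "w \<in> gen {i..m}"
    unfolding w_def using uv(2) gen_monoD[OF st(2), of "{i..m}"] ij sub gen_inv gen_mult by simp
  ultimately have w': "w \<in> gen {i..<m}"
    using facet by blast
  \<comment> \<open>Both descriptions of \<open>s\<close>, by indices in \<open>I\<close> and by
    indices in \<open>J\<close>, now avoid \<open>m\<close>, so the condition at level
    \<open>m\<close> applies.\<close>
  have "s \<in> gen (I \<inter> {..<m})"
    unfolding w(2) by (intro gen_mult gen_monoD[OF uv(1)] gen_monoD[OF w']) (use i in auto)
  with st(1) have "s \<in> gen ((I \<inter> {..<m}) \<inter> (J \<inter> {..<j}))"
    using j(3) by (intro intersectingD[OF IP, of "I \<inter> {..<m}" "J \<inter> {..<j}" s]) auto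
  then have "s \<in> gen (I \<inter> J)"
    by (rule gen_monoD) auto
  moreover have "{j..m} \<subseteq> I \<inter> J"
    using i(1) j(1) ij by auto
  then have "t \<in> gen (I \<inter> J)"
    using gen_monoD[OF st(2)] by blast
  ultimately show ?thesis
    using st(3) gen_mult by simp
qed

text \<open>Elements spanned by the first \<open>m\<close> generators are fixed by
  \<open>\<rho>\<close>, while \<open>\<rho>\<close> sends \<open>gen J\<close> into
  \<open>gen (J - {m})\<close>. So when one of the two index sets lacks \<open>m\<close>, the other
  may drop it and level \<open>m\<close> applies. When both contain \<open>m\<close>, the same
  argument supplies the \<open>facet\<close> hypothesis of \<open>intersecting_top\<close>.\<close>

lemma intersecting_Suc:
  assumes m: "m < n" and IP: "intersecting m"
    and \<rho>: "\<rho> \<in> hom G G" "\<And>j. j < m \<Longrightarrow> \<rho> (g j) = g j" "\<rho> (g m) = \<one>"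
  shows "intersecting (Suc m)"
proof -
  interpret \<rho>: group_hom G G \<rho>
    using \<rho>(1) by (simp add: group_hom_def group_hom_axioms_def group_axioms)
  have \<rho>_gen: "\<rho> x \<in> gen (I - {m})" if "I \<subseteq> {..m}" "x \<in> gen I" for x I
  proof -
    have sub: "I \<subseteq> {..<n}" using that m by auto
    then show ?thesis using that(2)
    proof (induction rule: gen_induct)
      case (gen j)
      then show ?case using \<rho> that gen_g[of j "I - {m}"] by (cases "j = m") force+
    next
      case (mult a b)
      then show ?case using gen_carrier[OF sub] gen_mult by simp
    qed auto
  qed
  have \<rho>_id: "\<rho> x = x" if "x \<in> gen {..<m}" for x
  proof -
    have sub: "{..<m} \<subseteq> {..<n}" using m by auto
    then show ?thesis using that
    proof (induction rule: gen_induct)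
      case (mult x y)
      then show ?case using gen_carrier[OF sub] by auto
    qed (use \<rho> in auto)
  qed
  have facet: "gen {..<m} \<inter> gen {i..m} \<subseteq> gen {i..<m}" for i
  proof
    fix x assume x: "x \<in> gen {..<m} \<inter> gen {i..m}"
    then have "\<rho> x \<in> gen ({i..m} - {m})" using \<rho>_gen by auto
    moreover have "{i..m} - {m} = {i..<m}" by auto
    ultimately show "x \<in> gen {i..<m}" using x \<rho>_id by auto
  qed
  have start: "\<exists>i. {i..m} \<subseteq> I \<and> (i = 0 \<or> i - 1 \<notin> I) \<and> i \<le> m" if "m \<in> I" for I
  proof -
    \<comment> \<open>Start of the longest interval inside \<open>I\<close> that ends at
      \<open>m\<close>; by minimality \<open>i - 1\<close> lies outside \<open>I\<close> if
      \<open>i > 0\<close>.\<close>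
    define i where "i = (LEAST i. {i..m} \<subseteq> I)"
    have i: "{i..m} \<subseteq> I"
      unfolding i_def by (rule LeastI[of _ m]) (use that in auto)
    have "i \<le> m"
      unfolding i_def by (rule Least_le) (use that in auto)
    moreover have "i - 1 \<notin> I" if "i > 0"
    proof
      assume "i - 1 \<in> I"
      moreover have "{i - 1..m} = insert (i - 1) {i..m}"
        using \<open>i \<le> m\<close> that by auto
      ultimately have "{i - 1..m} \<subseteq> I" using i by simp
      then have "i \<le> i - 1" unfolding i_def by (rule Least_le)
      then show False using that by simp
    qed
    ultimately show ?thesis using i by blast
  qed
  have low: "gen I \<inter> gen J \<subseteq> gen (I \<inter> J)" if "I \<subseteq> {..<m}" "J \<subseteq> {..m}" for I J
  proof
    fix x assume x: "x \<in> gen I \<inter> gen J"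
    then have "\<rho> x = x" using \<rho>_id gen_monoD[OF _ that(1)] by blast
    then have "x \<in> gen (J - {m})" using \<rho>_gen[of J x] x that by auto
    then have "x \<in> gen (I \<inter> (J - {m}))"
      using intersectingD[OF IP that(1), of "J - {m}"] that x by force
    then show "x \<in> gen (I \<inter> J)"
      by (rule gen_monoD) auto
  qed
  have "gen I \<inter> gen J \<subseteq> gen (I \<inter> J)" if IJ: "I \<subseteq> {..m}" "J \<subseteq> {..m}" for I J
  proof (cases "m \<in> I \<and> m \<in> J")
    case True
    obtain i where i: "{i..m} \<subseteq> I" "i = 0 \<or> i - 1 \<notin> I" "i \<le> m" using start True by blast
    obtain j where j: "{j..m} \<subseteq> J" "j = 0 \<or> j - 1 \<notin> J" "j \<le> m" using start True by blast
    show ?thesis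
    proof (cases "i \<le> j")
      case True
      then show ?thesis
        using intersecting_top[OF m IP facet i IJ(1) j IJ(2)] by blast
    next
      case False
      then show ?thesis
        using intersecting_top[OF m IP facet j IJ(2) i IJ(1)] by (auto simp: Int_commute)
    qed
  next
    case False
    then have "I \<subseteq> {..<m} \<or> J \<subseteq> {..<m}" using IJ by (metis lessThan_Suc_atMost lessThan_Suc subset_insert)
    then show ?thesis using low[of I J] low[of J I] IJ by (auto simp: Int_commute)
  qed
  then show ?thesis
    unfolding intersecting_def lessThan_Suc_atMost using gen_mono by (meson Int_lower1 Int_lower2 equalityI le_infI)
qed

section \<open>Subgroups and transported copies as string C-groups\<close>

lemma string_C_group_gen:
  assumes "intersecting n"
  shows "string_C_group (G\<lparr>carrier := gen {..<n}\<rparr>) n g"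
proof -
  let ?H = "G\<lparr>carrier := gen {..<n}\<rparr>"
  have sg: "subgroup (gen {..<n}) G" by (simp add: subgroup_gen)
  have gr: "group ?H"
    by (rule subgroup_imp_group[OF sg])
  then interpret H: group ?H .
  have gen: "generate ?H (g ` I) = gen I" if "I \<subseteq> {..<n}" for I
  proof -
    have "g ` I \<subseteq> gen {..<n}" using that gen_g by blast
    then show ?thesis using generate_consistent[OF _ sg] by (simp add: gen_def)
  qed
  show ?thesis
  proof unfold_locales
    show "g ` {..<n} \<subseteq> carrier ?H" using gen_g by auto
    show "generate ?H (g ` {..<n}) = carrier ?H" using gen by simp
    show "H.ord (g j) = 2" if "j < n" for j
      using that H.ord_eq_2_iff[of "g j"] gen_g[of j "{..<n}"] g_nontrivial g_square by simp
    show "(g j \<otimes>\<^bsub>?H\<^esub> g k) [^]\<^bsub>?H\<^esub> (2::nat) = \<one>\<^bsub>?H\<^esub>"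
      if "j < n" "k < n" "\<bar>int j - int k\<bar> > 1" for j k
      using that H.involutions_commute_iff[of "g j" "g k"] gen_g[of _ "{..<n}"] g_square
        g_commute[of j k] g_commute[of k j] by (cases "j < k") auto
    show "generate ?H (g ` I) \<inter> generate ?H (g ` J) = generate ?H (g ` (I \<inter> J))"
      if "I \<subseteq> {..<n}" "J \<subseteq> {..<n}" for I J
    proof -
      have "I \<inter> J \<subseteq> {..<n}" using that by auto
      then show ?thesis
        using assms that by (simp add: gen intersecting_def)
    qed
  qed
qed

end

sublocale sggi \<subseteq> string_involutions G n g
proof
  show g: "g j \<in> carrier G" if "j < n" for j
    using gens_closed that by auto
  show "g j \<noteq> \<one>" "g j \<otimes> g j = \<one>" if "j < n" for j
    using that g gens_involution ord_eq_2_iff by auto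
  then show "g i \<otimes> g j = g j \<otimes> g i" if "i < n" "j < n" "i + 1 < j" for i j
    using that gens_commute[of i j] involutions_commute_iff[of "g i" "g j"] g by auto
qed

lemma (in string_C_group) intersecting: "intersecting n"
  using intersection_condition by (simp add: intersecting_def gen_def)

text \<open>Images under an injection commute with intersections, so the condition survives. This
  moves a finite group of tuples onto \<open>nat\<close>.\<close>

lemma string_C_group_image:
  assumes "string_C_group G n g" and e: "inj_on e (carrier G)"
  shows "string_C_group (image_group e G) n (e \<circ> g)"
proof -
  interpret string_C_group G n g by fact
  let ?H = "image_group e G"
  have iso: "e \<in> iso G ?H"
    using e by (rule inj_imp_image_group_iso)
  interpret H: group ?H
    using e by (rule inj_imp_image_group_is_group)
  have mult: "e x \<otimes>\<^bsub>?H\<^esub> e y = e (x \<otimes>\<^bsub>G\<^esub> y)" if "x \<in> carrier G" "y \<in> carrier G" for x y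
    using e that by (simp add: image_group_def)
  have one: "\<one>\<^bsub>?H\<^esub> = e \<one>\<^bsub>G\<^esub>" by (simp add: image_group_one)
  have gen: "generate ?H ((e \<circ> g) ` I) = e ` gen I" if "I \<subseteq> {..<n}" for I
    using hom_gen_image[of ?H e I] iso that H.group_axioms by (simp add: iso_def)
  show "string_C_group ?H n (e \<circ> g)"
  proof unfold_locales
    show "(e \<circ> g) ` {..<n} \<subseteq> carrier ?H" using g_closed by (auto simp: image_group_carrier)
    show "generate ?H ((e \<circ> g) ` {..<n}) = carrier ?H"
      using gen[of "{..<n}"] gens_generate by (simp add: gen_def image_group_carrier)
    have g_in: "e (g j) \<in> carrier ?H" if "j < n" for j
      using g_closed that by (simp add: image_group_carrier)
    have square: "e (g j) \<otimes>\<^bsub>?H\<^esub> e (g j) = \<one>\<^bsub>?H\<^esub>" if "j < n" for j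
      using that g_closed g_square by (simp add: mult one)
    show "H.ord ((e \<circ> g) j) = 2" if "j < n" for j
      using that g_closed g_nontrivial g_in square H.ord_eq_2_iff[of "e (g j)"] inj_onD[OF e]
      by (fastforce simp: one)
    show "((e \<circ> g) j \<otimes>\<^bsub>?H\<^esub> (e \<circ> g) k) [^]\<^bsub>?H\<^esub> (2::nat) = \<one>\<^bsub>?H\<^esub>"
      if "j < n" "k < n" "\<bar>int j - int k\<bar> > 1" for j k
      using that H.involutions_commute_iff[of "e (g j)" "e (g k)"] g_in square mult g_closed
        g_commute[of j k] g_commute[of k j] by (cases "j < k") auto
    show "generate ?H ((e \<circ> g) ` I) \<inter> generate ?H ((e \<circ> g) ` J) = generate ?H ((e \<circ> g) ` (I \<inter> J))"
      if IJ: "I \<subseteq> {..<n}" "J \<subseteq> {..<n}" for I J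
    proof -
      have "I \<inter> J \<subseteq> {..<n}" using IJ by auto
      moreover have "gen I \<subseteq> carrier G" "gen J \<subseteq> carrier G" using IJ gen_carrier by auto
      then have "e ` gen I \<inter> e ` gen J = e ` (gen I \<inter> gen J)"
        using inj_on_image_Int[OF e] by simp
      moreover have "gen I \<inter> gen J = gen (I \<inter> J)"
        using intersection_condition[OF IJ] by (simp add: gen_def)
      ultimately show ?thesis
        using gen[of I] gen[of J] gen[of "I \<inter> J"] IJ by metis
    qed
  qed
qed

text \<open>Capping the coordinate indices at \<open>m\<close> is an endomorphism of the power of \<open>M\<close> that fixes the
  generators with index below \<open>m\<close> and kills the others.\<close>

lemma string_C_cover:
  fixes M :: "('a, 'm) monoid_scheme"
  assumes M: "string_involutions M n g" and fin: "finite (carrier M)" and k: "k \<le> n"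
    and IP: "string_involutions.intersecting M g k"
  obtains G' :: "nat monoid" and g' \<phi>
  where "string_C_group G' n g'" "finite (carrier G')" "\<phi> \<in> hom G' M"
    "\<And>j. j < n \<Longrightarrow> \<phi> (g' j) = g j" "inj_on \<phi> (generate G' (g' ` {..<k}))"
proof -
  interpret M: string_involutions M n g by fact
  define P where "P = product_group {k..n} (\<lambda>_. M)"
  define a where "a j = (\<lambda>m\<in>{k..n}. if j < m then g j else \<one>\<^bsub>M\<^esub>)" for j
  have P_carrier: "carrier P = (\<Pi>\<^sub>E m\<in>{k..n}. carrier M)"
    and P_mult: "x \<otimes>\<^bsub>P\<^esub> y = (\<lambda>m\<in>{k..n}. x m \<otimes>\<^bsub>M\<^esub> y m)"
    and P_one: "\<one>\<^bsub>P\<^esub> = (\<lambda>m\<in>{k..n}. \<one>\<^bsub>M\<^esub>)" for x y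
    by (simp_all add: P_def)
  have P: "group P"
    unfolding P_def by (rule product_group) (rule M.is_group)
  interpret P: string_involutions P n a
  proof (rule string_involutions.intro[OF P], unfold_locales)
    show "a j \<in> carrier P" if "j < n" for j
      using that M.g_closed by (auto simp: P_carrier a_def)
    show "a j \<noteq> \<one>\<^bsub>P\<^esub>" if "j < n" for j
    proof
      assume "a j = \<one>\<^bsub>P\<^esub>"
      \<comment> \<open>Coordinate \<open>n\<close> is the one at which no generator has been
        killed.\<close>
      then have "a j n = \<one>\<^bsub>P\<^esub> n" by simp
      then show False using that k M.g_nontrivial by (simp add: a_def P_one)
    qed
    show "a j \<otimes>\<^bsub>P\<^esub> a j = \<one>\<^bsub>P\<^esub>" if "j < n" for j
      using that M.g_square by (auto simp: P_mult P_one a_def fun_eq_iff)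
    show "a i \<otimes>\<^bsub>P\<^esub> a j = a j \<otimes>\<^bsub>P\<^esub> a i" if "i < n" "j < n" "i + 1 < j" for i j
      using that M.g_commute M.g_closed by (auto simp: P_mult P_one a_def fun_eq_iff)
  qed
  define \<rho> where "\<rho> m x = (\<lambda>i\<in>{k..n}. x (min i m) :: 'a)" for m x
  \<comment> \<open>The bound \<open>k \<le> m\<close> keeps the capped index \<open>min i m\<close>
    inside \<open>{k..n}\<close>.\<close>
  have \<rho>_hom: "\<rho> m \<in> hom P P" if "k \<le> m" for m
    using that by (fastforce simp: hom_def P_carrier P_mult \<rho>_def fun_eq_iff PiE_iff)
  have \<rho>_a: "\<rho> m (a j) = (if j < m then a j else \<one>\<^bsub>P\<^esub>)" if "k \<le> m" for m j
    using that by (auto simp: a_def \<rho>_def P_one fun_eq_iff)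
  have proj: "(\<lambda>x. x m) \<in> hom P M" if "m \<in> {k..n}" for m
    using that by (auto simp: hom_def P_carrier P_mult PiE_iff)
  have proj_gen: "(\<lambda>x. x m) ` P.gen I = M.gen I" if "m \<in> {k..n}" "I \<subseteq> {..<m}" for m I
  proof -
    have "I \<subseteq> {..<n}" using that by auto
    then have "(\<lambda>x. x m) ` P.gen I = generate M ((\<lambda>j. a j m) ` I)"
      using P.hom_gen_image[OF M.is_group proj[OF that(1)], of I] by (simp add: comp_def)
    also have "(\<lambda>j. a j m) ` I = g ` I"
      using that by (intro image_cong) (auto simp: a_def)
    finally show ?thesis by (simp add: M.gen_def)
  qed
  \<comment> \<open>Every generator below \<open>k\<close> has the same entry in all coordinates,
    hence so has everything they generate; being fixed by \<open>\<rho> k\<close> expresses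
    this.\<close>
  have const: "x i = x k" if "x \<in> P.gen {..<k}" "i \<in> {k..n}" for x i
  proof -
    have sub: "{..<k} \<subseteq> {..<n}" using k by auto
    then have "\<rho> k x = x" using that(1)
    proof (induction rule: P.gen_induct)
      case one
      then show ?case by (auto simp: \<rho>_def P_one fun_eq_iff)
    next
      case (gen j)
      then show ?case by (simp add: \<rho>_a)
    next
      case (mult x y)
      then show ?case
        using P.gen_carrier[OF sub] hom_mult[OF \<rho>_hom[of k]] by simp
    qed
    then have "x i = \<rho> k x i" by simp
    then show ?thesis using that(2) by (simp add: \<rho>_def)
  qed
  have inj: "inj_on (\<lambda>x. x m) (P.gen {..<k})" if m: "m \<in> {k..n}" for m
  proof (rule inj_onI)
    fix x y assume xy: "x \<in> P.gen {..<k}" "y \<in> P.gen {..<k}" "x m = y m"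
    have "{..<k} \<subseteq> {..<n}" using k by auto
    then have "x \<in> extensional {k..n}" "y \<in> extensional {k..n}"
      using P.gen_carrier xy unfolding P_carrier PiE_iff by blast+
    moreover have "x i = y i" if "i \<in> {k..n}" for i
      using const[OF xy(1)] const[OF xy(2)] that m xy(3) by metis
    ultimately show "x = y" by (rule extensionalityI)
  qed
  \<comment> \<open>A single coordinate is faithful on this diagonal subgroup, so the condition is
    read off in \<open>M\<close>.\<close>
  have Pk: "P.intersecting k"
    unfolding P.intersecting_def
  proof (intro allI impI)
    fix I J assume IJ: "I \<subseteq> {..<k}" "J \<subseteq> {..<k}"
    have kk: "k \<in> {k..n}" using k by simp
    have sub: "P.gen I \<subseteq> P.gen {..<k}" "P.gen J \<subseteq> P.gen {..<k}" "P.gen (I \<inter> J) \<subseteq> P.gen {..<k}"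
      using IJ by (auto intro!: P.gen_mono)
    have "(\<lambda>x. x k) ` (P.gen I \<inter> P.gen J) = M.gen I \<inter> M.gen J"
      using inj_on_image_Int[OF inj[OF kk] sub(1,2)] proj_gen[OF kk] IJ by simp
    also have "\<dots> = M.gen (I \<inter> J)"
      using IP IJ by (simp add: M.intersecting_def)
    also have "\<dots> = (\<lambda>x. x k) ` P.gen (I \<inter> J)"
      using proj_gen[OF kk, of "I \<inter> J"] IJ by auto
    finally show "P.gen I \<inter> P.gen J = P.gen (I \<inter> J)"
      using inj_on_image_eq_iff[OF inj[OF kk]] sub by (metis le_infI1)
  qed
  have "P.intersecting m" if "k \<le> m" "m \<le> n" for m
    using that
  proof (induction m rule: dec_induct)
    case base
    show ?case by (rule Pk)
  next
    \<comment> \<open>The retraction \<open>\<rho> m\<close> fixes \<open>a j\<close> for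
      \<open>j < m\<close> and kills \<open>a m\<close>, as \<open>intersecting_Suc\<close>
      requires.\<close>
    case (step m)
    show ?case
      using step \<rho>_a[of m] by (intro P.intersecting_Suc[OF _ _ \<rho>_hom[of m]]) auto
  qed
  then have IPn: "P.intersecting n" using k by simp
  define B where "B = P\<lparr>carrier := P.gen {..<n}\<rparr>"
  have B: "string_C_group B n a"
    unfolding B_def by (rule P.string_C_group_gen[OF IPn])
  interpret B: string_C_group B n a by fact
  have B_carrier: "carrier B \<subseteq> carrier P"
    using P.gen_carrier by (auto simp: B_def)
  moreover have "finite (carrier P)"
    unfolding P_carrier using fin by (simp add: finite_PiE)
  ultimately have finB: "finite (carrier B)"
    by (rule finite_subset)
  then obtain e :: "(nat \<Rightarrow> 'a) \<Rightarrow> nat" where e: "inj_on e (carrier B)"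
    using finite_imp_inj_to_nat_seg by metis
  let ?G = "image_group e B"
  let ?e' = "inv_into (carrier B) e"
  \<comment> \<open>Decode the number into a tuple, then read the coordinate that carries the
    generators of \<open>M\<close> unchanged.\<close>
  define \<phi> where "\<phi> = (\<lambda>x. x n) \<circ> ?e'"
  have iso: "e \<in> iso B ?G" by (rule inj_imp_image_group_iso[OF e])
  have "?e' \<in> hom ?G B"
    using B.iso_set_sym[OF iso] by (simp add: iso_def)
  moreover have "(\<lambda>x. x n) \<in> hom B M"
    using proj[of n] k B_carrier by (auto simp: hom_def B_def)
  ultimately have \<phi>: "\<phi> \<in> hom ?G M"
    unfolding \<phi>_def by (rule hom_compose)
  have \<phi>_e: "\<phi> (e x) = x n" if "x \<in> carrier B" for x
    using that e by (simp add: \<phi>_def)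
  have genk: "generate ?G ((e \<circ> a) ` {..<k}) = e ` P.gen {..<k}"
  proof -
    have kn: "{..<k} \<subseteq> {..<n}" using k by auto
    have sg: "subgroup (P.gen {..<n}) P" by (simp add: P.subgroup_gen)
    have "e ` B.gen {..<k} = generate ?G ((e \<circ> a) ` {..<k})"
      by (rule B.hom_gen_image[OF B.inj_imp_image_group_is_group[OF e] Group.iso_imp_homomorphism[OF iso] kn])
    moreover have "a ` {..<k} \<subseteq> P.gen {..<n}" using kn by (auto intro: P.gen_g)
    then have "B.gen {..<k} = P.gen {..<k}"
      unfolding B.gen_def P.gen_def[of "{..<k}"] unfolding B_def by (rule P.generate_consistent[OF _ sg])
    ultimately show ?thesis by simp
  qed
  show thesis
  proof (rule that[of ?G "e \<circ> a" \<phi>])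
    show "string_C_group ?G n (e \<circ> a)" by (rule string_C_group_image[OF B e])
    show "finite (carrier ?G)" using finB by (simp add: image_group_carrier)
    show "\<phi> \<in> hom ?G M" by (rule \<phi>)
    show "\<phi> ((e \<circ> a) j) = g j" if "j < n" for j
      using that k \<phi>_e[of "a j"] B.g_closed by (simp add: a_def)
    have "P.gen {..<k} \<subseteq> carrier B"
      unfolding B_def using P.gen_mono[of "{..<k}" "{..<n}"] k by simp
    then have \<phi>_e': "\<phi> (e x) = x n" if "x \<in> P.gen {..<k}" for x
      using that \<phi>_e by blast
    show "inj_on \<phi> (generate ?G ((e \<circ> a) ` {..<k}))"
      unfolding genk
    proof (rule inj_onI)
      fix x y assume xy: "x \<in> e ` P.gen {..<k}" "y \<in> e ` P.gen {..<k}" "\<phi> x = \<phi> y"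
      then obtain u v where uv: "x = e u" "y = e v" "u \<in> P.gen {..<k}" "v \<in> P.gen {..<k}"
        by blast
      with xy(3) have "u n = v n" using \<phi>_e' by simp
      with uv show "x = y" using inj_onD[OF inj, of n u v] k by simp
    qed
  qed
qed

text \<open>With \<open>k = 0\<close> the intersection condition assumed by
  \<open>string_C_cover\<close> concerns only the trivial subgroup. The homomorphism is onto because
  its image contains the generators of \<open>G\<close>.\<close>

theorem sggi_covered_by_string_C_group:
  assumes "sggi G n g" and fin: "finite (carrier G)"
  shows "\<exists>(G' :: nat monoid) g'. string_C_group G' n g' \<and> finite (carrier G') \<and> sggi_covers n G' g' G g"
proof -
  interpret G: sggi G n g by fact
  have IP: "G.intersecting 0"
    by (simp add: G.intersecting_def)
  obtain G' :: "nat monoid" and g' \<phi> where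
    G': "string_C_group G' n g'" "finite (carrier G')" and \<phi>: "\<phi> \<in> hom G' G" "\<And>j. j < n \<Longrightarrow> \<phi> (g' j) = g j" using string_C_cover[OF G.string_involutions_axioms fin le0 IP] by metis
  interpret G': string_C_group G' n g' by fact
  have "\<phi> ` G'.gen {..<n} = generate G ((\<phi> \<circ> g') ` {..<n})"
    using G'.hom_gen_image[OF G.is_group \<phi>(1)] by simp
  also have "(\<phi> \<circ> g') ` {..<n} = g ` {..<n}"
    using \<phi>(2) by (intro image_cong) auto
  finally have "\<phi> ` carrier G' = carrier G"
    using G.gens_generate G'.gens_generate by (simp add: G'.gen_def)
  then have "\<phi> \<in> epi G' G"
    using \<phi>(1) by (simp add: epi_def)
  then show ?thesis
    using G' \<phi>(2) by (auto simp: sggi_covers_def)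
qed

section \<open>The regular polytope of a string C-group\<close>

text \<open>\<open>face j x\<close> stands for the right coset of \<open>x\<close> modulo the subgroup \<open>H j\<close>
  generated by all generators but \<open>g j\<close>. For the two improper ranks \<open>-1\<close> and \<open>d\<close>, that
  subgroup is the whole group, which leaves a single face.
  Right cosets are used because monodromy acts on flags from the left.\<close>

locale coset_geometry = string_C_group G "nat d" g for G (structure) and d :: int and g +
  fixes face :: "int \<Rightarrow> 'a \<Rightarrow> 'f" and rk :: "'f \<Rightarrow> int"
  assumes d_ge: "-1 \<le> d"
    and rk_face [simp]: "\<And>j x. rk (face j x) = j"
    and face_eq_iff: "\<And>j x y. x \<in> carrier G \<Longrightarrow> y \<in> carrier G \<Longrightarrow>
      face j x = face j y \<longleftrightarrow> x \<otimes> inv y \<in> generate G (g ` {t. t < nat d \<and> int t \<noteq> j})"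
begin

definition H :: "int \<Rightarrow> 'a set"
  where "H j = gen {t. t < nat d \<and> int t \<noteq> j}"

text \<open>Two cosets are incident when they have an element in common; \<open>x\<close> is that
  element.\<close>

definition R :: "'f rel"
  where "R = {(face i x, face j x) | i j x. -1 \<le> i \<and> i \<le> j \<and> j \<le> d \<and> x \<in> carrier G}"

lemma face_eq: "x \<in> carrier G \<Longrightarrow> y \<in> carrier G \<Longrightarrow> face j x = face j y \<longleftrightarrow> x \<otimes> inv y \<in> H j"
  by (simp add: face_eq_iff H_def gen_def)

lemma face_eq_rank: "face i x = face j y \<Longrightarrow> i = j"
  by (metis rk_face)

lemma gen_all: "gen {..<nat d} = carrier G"
  using gens_generate by (simp add: gen_def)

lemma H_improper: "j < 0 \<or> d \<le> j \<Longrightarrow> H j = carrier G"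
proof -
  assume "j < 0 \<or> d \<le> j"
  then have "{t. t < nat d \<and> int t \<noteq> j} = {..<nat d}" by auto
  then show ?thesis by (simp add: H_def gen_all)
qed

lemma H_carrier: "x \<in> H j \<Longrightarrow> x \<in> carrier G"
  unfolding H_def by (rule gen_carrier) auto

lemma face_mult:
  assumes "h \<in> H j" "x \<in> carrier G" shows "face j (h \<otimes> x) = face j x"
proof -
  have "h \<in> carrier G" using assms H_carrier by simp
  then have "(h \<otimes> x) \<otimes> inv x = h" using assms by (simp add: m_assoc)
  then show ?thesis using assms \<open>h \<in> carrier G\<close> by (simp add: face_eq)
qed

lemma gen_sub_H: "h \<in> gen I \<Longrightarrow> I \<subseteq> {t. t < nat d \<and> int t \<noteq> j} \<Longrightarrow> h \<in> H j"
  unfolding H_def by (rule gen_monoD)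

text \<open>Dropping generator \<open>j\<close> separates the generators below \<open>j\<close> from
  those above, so \<open>x \<otimes> inv y\<close> is a product \<open>v \<otimes> u\<close> of an
  upper and a lower part. Then \<open>u \<otimes> y\<close> has the faces of \<open>x\<close> up to
  rank \<open>j\<close> and those of \<open>y\<close> from rank \<open>j\<close> on. This gluing of
  two flags at a shared face underlies transitivity of \<open>R\<close> and
  \<open>chain_common\<close>.\<close>

lemma common_representative:
  assumes xy: "x \<in> carrier G" "y \<in> carrier G" and eq: "face j x = face j y"
  obtains u where "u \<in> gen {t. t < nat d \<and> int t < j}"
    "\<And>i. i \<le> j \<Longrightarrow> face i (u \<otimes> y) = face i x" "\<And>l. j \<le> l \<Longrightarrow> face l (u \<otimes> y) = face l y"
proof -
  let ?L = "{t. t < nat d \<and> int t < j}" and ?U = "{t. t < nat d \<and> int t > j}"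
  have "{t. t < nat d \<and> int t \<noteq> j} = ?L \<union> ?U" by auto
  then have w: "x \<otimes> inv y \<in> gen (?L \<union> ?U)"
    using eq xy by (simp add: face_eq H_def)
  have sub: "?L \<subseteq> {..<nat d}" "?U \<subseteq> {..<nat d}" by auto
  have far: "\<bar>int s - int t\<bar> > 1" if "s \<in> ?L" "t \<in> ?U" for s t using that by auto
  obtain u v where uv: "u \<in> gen ?L" "v \<in> gen ?U" "x \<otimes> inv y = v \<otimes> u"
    by (rule gen_union_split[OF sub far w]) auto
  have c: "u \<in> carrier G" "v \<in> carrier G"
    using gen_carrier[OF sub(1)] gen_carrier[OF sub(2)] uv by simp_all
  have x: "x = v \<otimes> (u \<otimes> y)"
    using uv(3) xy c by (metis inv_closed inv_solve_right' m_assoc m_closed)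
  show thesis
  proof (rule that[OF uv(1)])
    show "face i (u \<otimes> y) = face i x" if "i \<le> j" for i
      unfolding x by (rule face_mult[symmetric]) (use uv(2) xy c that in \<open>auto intro: gen_sub_H\<close>)
    show "face l (u \<otimes> y) = face l y" if "j \<le> l" for l
      by (rule face_mult) (use uv(1) xy that in \<open>auto intro: gen_sub_H\<close>)
  qed
qed

lemma R_I: "-1 \<le> i \<Longrightarrow> i \<le> j \<Longrightarrow> j \<le> d \<Longrightarrow> x \<in> carrier G \<Longrightarrow> (face i x, face j x) \<in> R"
  unfolding R_def by blast

lemma R_E:
  assumes "(A, B) \<in> R"
  obtains i j x where "A = face i x" "B = face j x" "-1 \<le> i" "i \<le> j" "j \<le> d" "x \<in> carrier G"
  using assms unfolding R_def by blast

lemma R_rk: "(A, B) \<in> R \<Longrightarrow> rk A \<le> rk B"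
  by (auto elim: R_E)

lemma R_rk_eq: "(A, B) \<in> R \<Longrightarrow> rk A = rk B \<Longrightarrow> A = B"
  by (auto elim: R_E)

lemma Field_R: "Field R = {face j x | j x. -1 \<le> j \<and> j \<le> d \<and> x \<in> carrier G}"
proof -
  have "(face j x, face j x) \<in> R" if "-1 \<le> j" "j \<le> d" "x \<in> carrier G" for j x
    using that by (intro R_I) auto
  then show ?thesis
    by (fastforce simp: Field_def Domain_iff Range_iff elim: R_E)
qed

lemma Field_E:
  assumes "A \<in> Field R"
  obtains j x where "A = face j x" "-1 \<le> j" "j \<le> d" "x \<in> carrier G"
  using assms unfolding Field_R by blast

lemma R_trans: "(A, B) \<in> R \<Longrightarrow> (B, C) \<in> R \<Longrightarrow> (A, C) \<in> R"
proof -
  assume AB: "(A, B) \<in> R" and BC: "(B, C) \<in> R"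
  obtain i j x where 1: "A = face i x" "B = face j x" "-1 \<le> i" "i \<le> j" "j \<le> d" "x \<in> carrier G"
    using AB by (rule R_E)
  obtain j' l y where 2: "B = face j' y" "C = face l y" "-1 \<le> j'" "j' \<le> l" "l \<le> d" "y \<in> carrier G"
    using BC by (rule R_E)
  note * = 1 2
  then have eq: "face j x = face j' y" by simp
  then have j': "j' = j" using face_eq_rank by metis
  with eq have "face j x = face j y" by simp
  then obtain u where u: "u \<in> gen {t. t < nat d \<and> int t < j}"
    "\<And>i. i \<le> j \<Longrightarrow> face i (u \<otimes> y) = face i x" "\<And>l. j \<le> l \<Longrightarrow> face l (u \<otimes> y) = face l y"
    using common_representative[OF 1(6) 2(6)] by metis
  have "u \<in> carrier G" by (rule gen_carrier[OF _ u(1)]) auto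
  then have "(face i (u \<otimes> y), face l (u \<otimes> y)) \<in> R"
    using * j' by (intro R_I) auto
  then show ?thesis
    using * j' u by simp
qed

lemma R_partial_order: "Partial_order R"
proof -
  have "refl_on (Field R) R"
    by (auto simp: refl_on_def intro: R_I elim!: Field_E)
  moreover have "antisym R"
    by (rule antisymI) (metis R_rk R_rk_eq order_antisym)
  moreover have "trans R"
    by (rule transI) (rule R_trans)
  moreover have "R \<subseteq> Field R \<times> Field R"
    by (auto simp: Field_def)
  ultimately show ?thesis
    by (simp add: partial_order_on_def preorder_on_def)
qed

text \<open>Faces are added in order of rank. The new face and the previous top share a
  representative \<open>y\<close>, and gluing at that top keeps the faces below it while adding the
  new one. The chain is finite because it has at most one face of each rank.\<close>

lemma chain_common:
  assumes "C \<in> Chains R"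
  obtains x where "x \<in> carrier G" "\<And>A. A \<in> C \<Longrightarrow> A = face (rk A) x"
proof -
  have range: "rk A \<in> {-1..d}" if "(A, A) \<in> R" for A
    using that by (auto elim: R_E)
  have "inj_on rk C"
    using assms by (intro inj_onI) (auto simp: Chains_def dest: R_rk_eq, metis R_rk_eq)
  moreover have "rk ` C \<subseteq> {-1..d}"
  proof (rule image_subsetI)
    fix A assume "A \<in> C"
    then have "(A, A) \<in> R" using assms by (auto simp: Chains_def)
    then show "rk A \<in> {-1..d}" by (rule range)
  qed
  then have "finite (rk ` C)"
    by (rule finite_subset) simp
  ultimately have "finite C" by (rule finite_imageD[rotated])
  then have "C \<in> Chains R \<longrightarrow> (\<exists>x\<in>carrier G. \<forall>A\<in>C. A = face (rk A) x)"
  proof (induction C rule: finite_ranking_induct[where f = rk])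
    case empty
    show ?case by (auto intro: one_closed)
  next
    case (insert B S)
    show ?case
    proof
      assume ch: "insert B S \<in> Chains R"
      then obtain x where x: "x \<in> carrier G" "\<And>A. A \<in> S \<Longrightarrow> A = face (rk A) x"
        using insert.IH by (auto simp: Chains_def)
      show "\<exists>x\<in>carrier G. \<forall>A\<in>insert B S. A = face (rk A) x"
      proof (cases "S = {}")
        case True
        have "(B, B) \<in> R" using ch by (auto simp: Chains_def)
        then show ?thesis using True by (auto elim!: R_E)
      next
        case False
        obtain A where A: "A \<in> S" "\<And>A'. A' \<in> S \<Longrightarrow> rk A' \<le> rk A"
          using obtains_MAX[OF insert.hyps(1) False, of rk] insert.hyps(1)
          by (metis Max_ge finite_imageI imageI)
        have "rk A \<le> rk B" using insert.hyps(2) A by simp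
        moreover have "(A, B) \<in> R \<or> (B, A) \<in> R" using ch A by (auto simp: Chains_def)
        ultimately have "(A, B) \<in> R"
          by (metis R_rk R_rk_eq order_antisym)
        then obtain i j y where y: "A = face i y" "B = face j y" "i \<le> j" "y \<in> carrier G"
          by (auto elim: R_E)
        then have "face i x = face i y" using x(2)[OF A(1)] by simp
        then obtain u where u: "u \<in> gen {t. t < nat d \<and> int t < i}"
          "\<And>l. l \<le> i \<Longrightarrow> face l (u \<otimes> y) = face l x" "\<And>l. i \<le> l \<Longrightarrow> face l (u \<otimes> y) = face l y"
          using common_representative[OF x(1) y(4)] by metis
        have "u \<in> carrier G" by (rule gen_carrier[OF _ u(1)]) auto
        moreover have "A' = face (rk A') (u \<otimes> y)" if "A' \<in> S" for A'
          using x(2)[OF that] A(2)[OF that] u(2) y(1) by simp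
        moreover have "B = face (rk B) (u \<otimes> y)"
          using u(3) y by simp
        ultimately show ?thesis
          using y(4) by (intro bexI[of _ "u \<otimes> y"]) auto
      qed
    qed
  qed
  then show thesis using assms that by blast
qed

lemma faces_chain: "a \<ge> -1 \<Longrightarrow> b \<le> d \<Longrightarrow> x \<in> carrier G \<Longrightarrow> (\<lambda>j. face j x) ` {a..b} \<in> Chains R"
proof -
  assume *: "a \<ge> -1" "b \<le> d" "x \<in> carrier G"
  have "(face i x, face j x) \<in> R \<or> (face j x, face i x) \<in> R" if "i \<in> {a..b}" "j \<in> {a..b}" for i j
    using that * by (cases "i \<le> j") (auto intro!: R_I)
  then show ?thesis by (auto simp: Chains_def)
qed

section \<open>Flags of the coset geometry and of its sections\<close>

definition Fl :: "int \<Rightarrow> int \<Rightarrow> 'a \<Rightarrow> 'f set"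
  where "Fl a b x = (\<lambda>j. face j x) ` {a..b}"

lemma Fl_subset: "Fl a b x \<subseteq> Fl a b y \<Longrightarrow> Fl a b x = Fl a b y"
proof -
  assume s: "Fl a b x \<subseteq> Fl a b y"
  have "face j x = face j y" if "j \<in> {a..b}" for j
  proof -
    have "face j x \<in> Fl a b y" using s that by (auto simp: Fl_def)
    then obtain i where "face j x = face i y" by (auto simp: Fl_def)
    then show ?thesis using face_eq_rank by metis
  qed
  then show ?thesis by (auto simp: Fl_def)
qed

text \<open>A chain of the section together with the two end faces is a chain of \<open>R\<close>,
  whose common representative agrees with \<open>x\<close> at both ends. Thus every chain lies in
  some \<open>Fl a b y\<close>, and by \<open>Fl_subset\<close> none of these sets contains
  another.\<close>

lemma flags_section:
  assumes ab: "-1 \<le> a" "a \<le> b" "b \<le> d" and x: "x \<in> carrier G"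
  shows "flags (section_poset R (face a x) (face b x)) =
    Fl a b ` {y \<in> carrier G. face a y = face a x \<and> face b y = face b x}"
proof -
  let ?S = "section_poset R (face a x) (face b x)"
  let ?Y = "{y \<in> carrier G. face a y = face a x \<and> face b y = face b x}"
  have chain: "Fl a b y \<in> Chains ?S" if "y \<in> ?Y" for y
  proof -
    have "(face a x, face j y) \<in> R \<and> (face j y, face b x) \<in> R" if "j \<in> {a..b}" for j
      using that \<open>y \<in> ?Y\<close> ab R_I[of a j y] R_I[of j b y] by auto
    then show ?thesis
      using faces_chain[of a b y] that ab by (auto simp: Chains_def section_poset_def Fl_def)
  qed
  have sub: "\<exists>y\<in>?Y. C \<subseteq> Fl a b y" if C: "C \<in> Chains ?S" for C
  proof -
    have 1: "(face a x, A) \<in> R" "(A, face b x) \<in> R" if "A \<in> C" for A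
      using C that by (auto simp: Chains_def section_poset_def)
    have 2: "(A, B) \<in> R \<or> (B, A) \<in> R" if "A \<in> C" "B \<in> C" for A B
      using C that by (auto simp: Chains_def section_poset_def)
    have 3: "(face a x, face b x) \<in> R" "(face a x, face a x) \<in> R" "(face b x, face b x) \<in> R"
      using ab x by (auto intro: R_I)
    have "insert (face a x) (insert (face b x) C) \<in> Chains R"
      using 1 2 3 by (auto simp: Chains_def)
    then obtain y where y: "y \<in> carrier G"
      "\<And>A. A \<in> insert (face a x) (insert (face b x) C) \<Longrightarrow> A = face (rk A) y"
      by (rule chain_common) auto
    have "face a y = face a x" "face b y = face b x"
      using y(2)[of "face a x"] y(2)[of "face b x"] by simp_all
    moreover have "A \<in> Fl a b y" if "A \<in> C" for A
      using y(2)[of A] 1[OF that, THEN R_rk] that by (auto simp: Fl_def)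
    ultimately show ?thesis using y(1) by blast
  qed
  show ?thesis
  proof (intro equalityI subsetI)
    fix \<Phi> assume \<Phi>: "\<Phi> \<in> flags ?S"
    then obtain y where "y \<in> ?Y" "\<Phi> \<subseteq> Fl a b y"
      using sub[of \<Phi>] by (auto simp: flags_def)
    then show "\<Phi> \<in> Fl a b ` ?Y"
      using \<Phi> chain[of y] by (auto simp: flags_def)
  next
    fix \<Phi> assume "\<Phi> \<in> Fl a b ` ?Y"
    then obtain y where y: "y \<in> ?Y" "\<Phi> = Fl a b y" by blast
    have "\<Psi> = \<Phi>" if \<Psi>: "\<Psi> \<in> Chains ?S" "\<Phi> \<subseteq> \<Psi>" for \<Psi>
    proof -
      obtain z where z: "\<Psi> \<subseteq> Fl a b z" using sub[OF \<Psi>(1)] by blast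
      then have "Fl a b y = Fl a b z" using \<Psi>(2) y(2) by (intro Fl_subset) blast
      then show ?thesis using \<Psi>(2) y(2) z by blast
    qed
    then show "\<Phi> \<in> flags ?S"
      using chain[OF y(1)] y(2) by (simp add: flags_def)
  qed
qed

lemma face_improper: "x \<in> carrier G \<Longrightarrow> y \<in> carrier G \<Longrightarrow> j < 0 \<or> d \<le> j \<Longrightarrow> face j x = face j y"
  by (simp add: face_eq H_improper)

lemma face_bounds: "A \<in> Field R \<Longrightarrow> x \<in> carrier G \<Longrightarrow> (face (-1) x, A) \<in> R \<and> (A, face d x) \<in> R"
proof (erule Field_E)
  fix j y assume *: "x \<in> carrier G" "A = face j y" "-1 \<le> j" "j \<le> d" "y \<in> carrier G"
  then have "face (-1) x = face (-1) y" "face d x = face d y" by (auto intro: face_improper)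
  then show "(face (-1) x, A) \<in> R \<and> (A, face d x) \<in> R"
    using * by (auto intro: R_I)
qed

lemma flags_R: "flags R = Fl (-1) d ` carrier G"
proof -
  have "section_poset R (face (-1) \<one>) (face d \<one>) = R"
    using face_bounds[OF _ one_closed] by (auto simp: section_poset_def Field_def)
  moreover have "face (-1) y = face (-1) \<one> \<and> face d y = face d \<one>" if "y \<in> carrier G" for y
    using face_improper[OF that one_closed, of "-1"] face_improper[OF that one_closed, of d] by simp
  then have "{y \<in> carrier G. face (-1) y = face (-1) \<one> \<and> face d y = face d \<one>} = carrier G"
    by blast
  ultimately show ?thesis
    using flags_section[of "-1" d \<one>] d_ge by simp
qed

section \<open>Connected sections and the diamond condition\<close>

lemma H_Int: "H i \<inter> H j = gen {t. t < nat d \<and> int t \<noteq> i \<and> int t \<noteq> j}"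
proof -
  have "gen {t. t < nat d \<and> int t \<noteq> i} \<inter> gen {t. t < nat d \<and> int t \<noteq> j} =
      gen ({t. t < nat d \<and> int t \<noteq> i} \<inter> {t. t < nat d \<and> int t \<noteq> j})"
    using intersection_condition[of "{t. t < nat d \<and> int t \<noteq> i}" "{t. t < nat d \<and> int t \<noteq> j}"]
    by (simp add: gen_def subset_eq)
  also have "{t. t < nat d \<and> int t \<noteq> i} \<inter> {t. t < nat d \<and> int t \<noteq> j} = {t. t < nat d \<and> int t \<noteq> i \<and> int t \<noteq> j}"
    by auto
  finally show ?thesis by (simp add: H_def)
qed

lemma same_faces:
  assumes "x \<in> carrier G" "y \<in> carrier G" "face i y = face i x" "face j y = face j x"
  obtains h where "h \<in> gen {t. t < nat d \<and> int t \<noteq> i \<and> int t \<noteq> j}" "y = h \<otimes> x"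
proof (rule that)
  show "y \<otimes> inv x \<in> gen {t. t < nat d \<and> int t \<noteq> i \<and> int t \<noteq> j}"
    using assms H_Int[of i j] by (auto simp: face_eq)
  show "y = (y \<otimes> inv x) \<otimes> x"
    using assms by (simp add: m_assoc)
qed

lemma g_in_H: "t < nat d \<Longrightarrow> j \<noteq> int t \<Longrightarrow> g t \<in> H j"
  unfolding H_def by (rule gen_g) auto

text \<open>Flags of a section differ by an element of \<open>H a \<inter> H b\<close>, which by the
  intersection condition is a word in generators of ranks other than \<open>a\<close> and
  \<open>b\<close>. Each letter changes at most one face and keeps both ends, so the word spells a
  path.\<close>

lemma section_connected:
  assumes "(A, B) \<in> R"
  shows "flag_connected (section_poset R A B)"
proof -
  obtain a b x where ab: "A = face a x" "B = face b x" "-1 \<le> a" "a \<le> b" "b \<le> d" "x \<in> carrier G"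
    using assms by (rule R_E)
  let ?S = "section_poset R A B" and ?K = "{t. t < nat d \<and> int t \<noteq> a \<and> int t \<noteq> b}"
  have fl: "flags ?S = Fl a b ` {y \<in> carrier G. face a y = A \<and> face b y = B}"
    unfolding ab(1,2) by (rule flags_section[OF ab(3-6)])
  have K: "?K \<subseteq> {..<nat d}" by auto
  have stay: "face a (h \<otimes> y) = face a y" "face b (h \<otimes> y) = face b y"
    if "h \<in> gen ?K" "y \<in> carrier G" for h y
    using that by (auto intro!: face_mult gen_sub_H)
  \<comment> \<open>Quantifying over the start \<open>y\<close> lets the product case apply
    \<open>h'\<close> first and continue from \<open>h' \<otimes> y\<close>.\<close>
  have path: "\<forall>y\<in>carrier G. face a y = A \<and> face b y = B \<longrightarrow> (Fl a b y, Fl a b (h \<otimes> y)) \<in> (flag_graph ?S)\<^sup>*"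
    if "h \<in> gen ?K" for h
    using K that
  proof (induction rule: gen_induct)
    case one
    then show ?case by simp
  next
    case (gen t)
    show ?case
    proof (intro ballI impI)
      fix y assume y: "y \<in> carrier G" "face a y = A \<and> face b y = B"
      have t: "t < nat d" "int t \<noteq> a" "int t \<noteq> b" "g t \<in> carrier G"
        using gen g_closed by auto
      have other: "face j (g t \<otimes> y) = face j y" if "j \<noteq> int t" for j
        using face_mult[OF g_in_H] that t y by blast
      show "(Fl a b y, Fl a b (g t \<otimes> y)) \<in> (flag_graph ?S)\<^sup>*"
      proof (cases "int t \<in> {a..b} \<and> face (int t) (g t \<otimes> y) \<noteq> face (int t) y")
        \<comment> \<open>A letter of rank outside \<open>{a..b}\<close>, or one that fixes the face
          of its rank, leaves the flag of the section as it is.\<close>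
        case False
        then have "face j (g t \<otimes> y) = face j y" if "j \<in> {a..b}" for j
          using other that by (cases "j = int t") auto
        then have "Fl a b y = Fl a b (g t \<otimes> y)" by (simp add: Fl_def)
        then show ?thesis by simp
      next
        case True
        have diff: "Fl a b z - Fl a b z' = {face (int t) z}"
          if "\<And>j. j \<noteq> int t \<Longrightarrow> face j z = face j z'" "face (int t) z \<noteq> face (int t) z'" for z z'
        proof (intro equalityI subsetI)
          fix E assume E: "E \<in> Fl a b z - Fl a b z'"
          then obtain j where j: "j \<in> {a..b}" "E = face j z" by (auto simp: Fl_def)
          have "j = int t"
          proof (rule ccontr)
            assume "j \<noteq> int t"
            then have "E \<in> Fl a b z'" using that(1) j by (auto simp: Fl_def)
            then show False using E by simp
          qed
          then show "E \<in> {face (int t) z}" using j by simp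
        next
          fix E assume E: "E \<in> {face (int t) z}"
          have "E \<notin> Fl a b z'"
          proof
            assume "E \<in> Fl a b z'"
            then obtain j where "face (int t) z = face j z'" using E by (auto simp: Fl_def)
            then show False using face_eq_rank that(2) by metis
          qed
          then show "E \<in> Fl a b z - Fl a b z'" using E True by (auto simp: Fl_def)
        qed
        have "flags_adjacent (Fl a b y) (Fl a b (g t \<otimes> y))"
          unfolding flags_adjacent_def
          using diff[of y "g t \<otimes> y"] diff[of "g t \<otimes> y" y] other True by (metis (no_types, lifting))
        moreover have "Fl a b y \<in> flags ?S" using fl y by blast
        moreover have "Fl a b (g t \<otimes> y) \<in> flags ?S"
          unfolding fl using y t other by (intro imageI) auto
        ultimately show ?thesis by (auto simp: flag_graph_def)
      qed
    qed
  next
    case (mult h h')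
    show ?case
    proof (intro ballI impI)
      fix y assume y: "y \<in> carrier G" "face a y = A \<and> face b y = B"
      have c: "h \<in> carrier G" "h' \<in> carrier G" using gen_carrier[OF K] mult by auto
      have "(Fl a b y, Fl a b (h' \<otimes> y)) \<in> (flag_graph ?S)\<^sup>*"
        using mult.IH(2) y by simp
      also have "(Fl a b (h' \<otimes> y), Fl a b (h \<otimes> (h' \<otimes> y))) \<in> (flag_graph ?S)\<^sup>*"
        using mult.IH(1) y c stay[OF mult.hyps(2)] by simp
      finally show "(Fl a b y, Fl a b (h \<otimes> h' \<otimes> y)) \<in> (flag_graph ?S)\<^sup>*"
        using y c by (simp add: m_assoc)
    qed
  qed
  show ?thesis
    unfolding flag_connected_def
  proof (intro ballI)
    fix \<Phi> \<Psi> assume "\<Phi> \<in> flags ?S" "\<Psi> \<in> flags ?S"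
    then obtain y z where y: "\<Phi> = Fl a b y" "y \<in> carrier G" "face a y = A" "face b y = B"
      and z: "\<Psi> = Fl a b z" "z \<in> carrier G" "face a z = A" "face b z = B"
      unfolding fl by blast
    then obtain h where "h \<in> gen ?K" "z = h \<otimes> y"
      using same_faces[of y z a b] by auto
    then show "(\<Phi>, \<Psi>) \<in> (flag_graph ?S)\<^sup>*"
      using path y z by simp
  qed
qed

text \<open>The faces in between are the \<open>face j (h \<otimes> x)\<close> with \<open>h\<close>
  in \<open>H (j - 1) \<inter> H (j + 1)\<close>. This subgroup is spanned by \<open>g t\<close> for
  \<open>t = nat j\<close> and by generators that commute with \<open>g t\<close> and lie in
  \<open>H j\<close>, so \<open>h\<close> matters only through a factor \<open>\<one>\<close> or
  \<open>g t\<close>.\<close>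

lemma diamond_R:
  assumes AB: "(A, B) \<in> R" "rk A = j - 1" "rk B = j + 1"
  shows "card {E \<in> Field R. rk E = j \<and> (A, E) \<in> R \<and> A \<noteq> E \<and> (E, B) \<in> R \<and> E \<noteq> B} = 2"
proof -
  obtain x where x: "A = face (j - 1) x" "B = face (j + 1) x" "-1 \<le> j - 1" "j + 1 \<le> d" "x \<in> carrier G"
    using AB by (auto elim!: R_E)
  define t where "t = nat j"
  have t: "int t = j" "t < nat d" using x by (auto simp: t_def)
  have gt: "g t \<in> carrier G" using t g_closed by simp
  let ?E = "{E \<in> Field R. rk E = j \<and> (A, E) \<in> R \<and> A \<noteq> E \<and> (E, B) \<in> R \<and> E \<noteq> B}"
  \<comment> \<open>Otherwise \<open>g t\<close> would be spanned by the other generators and, by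
    the intersection condition, be trivial.\<close>
  have neq: "face j (g t \<otimes> x) \<noteq> face j x"
  proof
    assume "face j (g t \<otimes> x) = face j x"
    then have "g t \<in> H j" using gt x by (simp add: face_eq m_assoc)
    moreover have "g t \<in> gen {t}" by (rule gen_g) simp
    ultimately have "g t \<in> gen ({s. s < nat d \<and> int s \<noteq> j} \<inter> {t})"
      using t unfolding H_def by (intro intersectingD[OF intersecting]) auto
    moreover have "{s. s < nat d \<and> int s \<noteq> j} \<inter> {t} = {}" using t by auto
    ultimately show False using gen_empty g_nontrivial t by simp
  qed
  have "?E = {face j x, face j (g t \<otimes> x)}"
  proof (intro equalityI subsetI)
    fix E assume E: "E \<in> {face j x, face j (g t \<otimes> x)}"
    have mem: "face j y \<in> ?E" if "y \<in> carrier G" "face (j - 1) y = A" "face (j + 1) y = B" for y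
    proof -
      have "A \<noteq> face j y" "face j y \<noteq> B" using AB(2,3) by auto
      moreover have "(A, face j y) \<in> R" "(face j y, B) \<in> R"
        using that x R_I[of "j - 1" j y] R_I[of j "j + 1" y] by auto
      ultimately show ?thesis using AB(2,3) by (auto intro: FieldI2)
    qed
    have other: "face i (g t \<otimes> x) = face i x" if "i \<noteq> j" for i
      using face_mult[OF g_in_H] that t x by blast
    have "face j x \<in> ?E"
      by (rule mem) (use x in simp_all)
    moreover have "face j (g t \<otimes> x) \<in> ?E"
      by (rule mem) (use x gt other in simp_all)
    ultimately show "E \<in> ?E" using E by blast
  next
    fix E assume E: "E \<in> ?E"
    \<comment> \<open>The three faces get one representative \<open>y\<close>, which shares
      \<open>A\<close> and \<open>B\<close> with \<open>x\<close>.\<close>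
    then have "{A, E, B} \<in> Chains R"
      using AB R_partial_order R_I x by (auto simp: Chains_def elim!: Field_E)
    then obtain y where y: "y \<in> carrier G" "\<And>A'. A' \<in> {A, E, B} \<Longrightarrow> A' = face (rk A') y"
      by (rule chain_common) auto
    have eq: "face (j - 1) y = face (j - 1) x" "face (j + 1) y = face (j + 1) x" and E': "E = face j y"
      using y(2)[of A] y(2)[of B] y(2)[of E] E x by auto
    obtain h where h: "h \<in> gen {s. s < nat d \<and> int s \<noteq> j - 1 \<and> int s \<noteq> j + 1}" "y = h \<otimes> x"
      by (rule same_faces[OF x(5) y(1) eq])
    let ?J = "{s. s < nat d \<and> \<bar>int s - j\<bar> > 1}"
    have "{s. s < nat d \<and> int s \<noteq> j - 1 \<and> int s \<noteq> j + 1} = ?J \<union> {t}"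
      using t by auto
    then have h': "h \<in> gen (?J \<union> {t})" using h by simp
    have sub: "?J \<subseteq> {..<nat d}" "{t} \<subseteq> {..<nat d}" using t by auto
    have far: "\<bar>int s - int s'\<bar> > 1" if "s \<in> ?J" "s' \<in> {t}" for s s' using that t by auto
    obtain u v where uv: "u \<in> gen ?J" "v \<in> gen {t}" "h = u \<otimes> v"
      by (rule gen_union_split[OF sub far h']) auto
    have "v = \<one> \<or> v = g t" using uv(2) gen_singleton[OF t(2)] by auto
    moreover have "u \<in> H j" using uv(1) by (rule gen_sub_H) auto
    then have "face j y = face j (v \<otimes> x)"
      using uv h(2) x(5) face_mult[of u j "v \<otimes> x"] gen_carrier[OF sub(2) uv(2)] H_carrier
      by (simp add: m_assoc)
    ultimately show "E \<in> {face j x, face j (g t \<otimes> x)}" using E' x(5) by auto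
  qed
  then show ?thesis using neq by simp
qed

section \<open>Right translations and flag transitivity\<close>

definition translation :: "'a \<Rightarrow> 'f \<Rightarrow> 'f"
  where "translation c A = face (rk A) ((SOME x. x \<in> carrier G \<and> face (rk A) x = A) \<otimes> c)"

text \<open>Right multiplication permutes the right cosets of each \<open>H j\<close>, since
  \<open>c\<close> cancels in \<open>(y \<otimes> c) \<otimes> inv (x \<otimes> c)\<close>. The
  representative picked by \<open>SOME\<close> is therefore immaterial.\<close>

lemma translation_face:
  assumes "c \<in> carrier G" "x \<in> carrier G"
  shows "translation c (face j x) = face j (x \<otimes> c)"
proof -
  define y where "y = (SOME y. y \<in> carrier G \<and> face j y = face j x)"
  have y: "y \<in> carrier G \<and> face j y = face j x"
    unfolding y_def by (rule someI[of _ x]) (use assms in simp)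
  have "(y \<otimes> c) \<otimes> inv (x \<otimes> c) = y \<otimes> inv x"
    using assms y by (simp add: inv_mult_group m_assoc) (simp add: m_assoc[symmetric] assms)
  also have "\<dots> \<in> H j"
    using y assms face_eq by blast
  finally have "face j (y \<otimes> c) = face j (x \<otimes> c)"
    using y assms by (simp add: face_eq)
  then show ?thesis
    by (simp add: translation_def y_def)
qed

lemma translation_automorphism:
  assumes c: "c \<in> carrier G"
  shows "translation c \<in> automorphisms R"
proof -
  have R: "(translation a A, translation a B) \<in> R" if "a \<in> carrier G" "(A, B) \<in> R" for a A B
    using that(2) by (rule R_E) (use that(1) in \<open>auto simp: translation_face intro!: R_I\<close>)
  have Fd: "translation a A \<in> Field R" if "a \<in> carrier G" "A \<in> Field R" for a A
    using that(2) by (rule Field_E) (use that(1) in \<open>auto simp: translation_face Field_R\<close>)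
  have inv: "translation (inv a) (translation a A) = A" if "a \<in> carrier G" "A \<in> Field R" for a A
    using that(2) by (rule Field_E) (use that(1) in \<open>auto simp: translation_face m_assoc\<close>)
  have "bij_betw (translation c) (Field R) (Field R)"
    using inv[of c] inv[of "inv c"] Fd c
    by (intro bij_betw_byWitness[where f' = "translation (inv c)"]) auto
  moreover have "(A, B) \<in> R" if "(translation c A, translation c B) \<in> R" "A \<in> Field R" "B \<in> Field R" for A B
    using R[OF _ that(1), of "inv c"] inv that(2,3) c by simp
  ultimately show ?thesis
    using R[OF c] unfolding automorphisms_def poset_iso_def by blast
qed

theorem regular_polytope_R: "regular_polytope d R rk"
proof unfold_locales
  show "Partial_order R" by (rule R_partial_order)
  show "rk A < rk B" if "(A, B) \<in> R" "A \<noteq> B" for A B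
    using that R_rk R_rk_eq by fastforce
  show "rk ` Field R = {-1..d}"
  proof (intro equalityI subsetI)
    fix j assume "j \<in> {-1..d}"
    then have "face j \<one> \<in> Field R" using one_closed unfolding Field_R by auto
    then show "j \<in> rk ` Field R" by (metis image_eqI rk_face)
  qed (auto elim!: Field_E)
  show "\<exists>A\<in>Field R. rk A = -1 \<and> (\<forall>B\<in>Field R. (A, B) \<in> R)"
    using face_bounds[OF _ one_closed] d_ge
    by (intro bexI[of _ "face (-1) \<one>"]) (auto simp: Field_R)
  show "\<exists>A\<in>Field R. rk A = d \<and> (\<forall>B\<in>Field R. (B, A) \<in> R)"
    using face_bounds[OF _ one_closed] d_ge
    by (intro bexI[of _ "face d \<one>"]) (auto simp: Field_R)
  show "bij_betw rk \<Phi> {-1..d}" if "\<Phi> \<in> flags R" for \<Phi>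
  proof -
    obtain x where "\<Phi> = Fl (-1) d x" using \<open>\<Phi> \<in> flags R\<close> flags_R by auto
    then show ?thesis
      by (auto simp: bij_betw_def inj_on_def Fl_def image_image)
  qed
  show "card {E \<in> Field R. rk E = j \<and> (A, E) \<in> R \<and> A \<noteq> E \<and> (E, B) \<in> R \<and> E \<noteq> B} = 2"
    if "(A, B) \<in> R" "A \<noteq> B" "rk A = j - 1" "rk B = j + 1" for A B j
    by (rule diamond_R[OF that(1,3,4)])
  show "flag_connected (section_poset R A B)" if "(A, B) \<in> R" for A B
    by (rule section_connected[OF that])
  show "\<exists>\<gamma>\<in>automorphisms R. \<gamma> ` \<Phi> = \<Psi>" if fl: "\<Phi> \<in> flags R" "\<Psi> \<in> flags R" for \<Phi> \<Psi>
  proof -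
    obtain x y where xy: "\<Phi> = Fl (-1) d x" "\<Psi> = Fl (-1) d y" "x \<in> carrier G" "y \<in> carrier G"
      using fl unfolding flags_R by blast
    have "translation (inv x \<otimes> y) ` \<Phi> = \<Psi>"
      using xy by (simp add: Fl_def image_image translation_face m_assoc[symmetric])
    then show ?thesis
      using translation_automorphism[of "inv x \<otimes> y"] xy by blast
  qed
qed

lemma finite_Field_R: "finite (carrier G) \<Longrightarrow> finite (Field R)"
proof -
  assume "finite (carrier G)"
  moreover have "Field R \<subseteq> (\<lambda>(j, x). face j x) ` ({-1..d} \<times> carrier G)"
    by (force elim!: Field_E)
  ultimately show ?thesis by (meson finite_SigmaI finite_atLeastAtMost_int finite_imageI finite_subset)
qed

lemma least_face_R: "x \<in> carrier G \<Longrightarrow> least_face R = face (-1) x"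
proof -
  assume x: "x \<in> carrier G"
  have F: "face (-1) x \<in> Field R" using x d_ge unfolding Field_R by auto
  show ?thesis
    unfolding least_face_def
  proof (rule the_equality)
    show "face (-1) x \<in> Field R \<and> (\<forall>B\<in>Field R. (face (-1) x, B) \<in> R)"
      using F face_bounds[OF _ x] by blast
    fix A assume A: "A \<in> Field R \<and> (\<forall>B\<in>Field R. (A, B) \<in> R)"
    then have "(A, face (-1) x) \<in> R" "(face (-1) x, A) \<in> R" using F face_bounds[OF _ x] by blast+
    then show "A = face (-1) x" using R_rk R_rk_eq by (metis order_antisym)
  qed
qed

end

text \<open>A coset is coded by a chosen element of it, paired with the rank; the rank separates
  faces whose cosets coincide as sets.\<close>

lemma coset_geometry_exists:
  fixes G :: "nat monoid"
  assumes G: "string_C_group G (nat d) g" and d: "-1 \<le> d"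
  obtains face :: "int \<Rightarrow> nat \<Rightarrow> nat" and rk where "coset_geometry G d g face rk"
proof -
  interpret string_C_group G "nat d" g by (rule G)
  define H where "H j = generate G (g ` {t. t < nat d \<and> int t \<noteq> j})" for j
  have H: "subgroup (H j) G" for j
    unfolding H_def using g_closed by (intro generate_is_subgroup) auto
  define rep where "rep j x = (SOME y. y \<in> H j #>\<^bsub>G\<^esub> x)" for j x
  have rep: "rep j x \<in> H j #>\<^bsub>G\<^esub> x" if "x \<in> carrier G" for j x
    unfolding rep_def by (rule someI) (rule rcos_self[OF that H])
  have rep_eq: "rep j x = rep j y \<longleftrightarrow> x \<otimes>\<^bsub>G\<^esub> inv\<^bsub>G\<^esub> y \<in> H j" if xy: "x \<in> carrier G" "y \<in> carrier G" for j x y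
  proof
    assume "rep j x = rep j y"
    then have "H j #>\<^bsub>G\<^esub> x = H j #>\<^bsub>G\<^esub> y"
      using repr_independence[OF rep[OF xy(1)] xy(1) H] repr_independence[OF rep[OF xy(2)] xy(2) H] by metis
    then have "x \<in> H j #>\<^bsub>G\<^esub> y" using rcos_self[OF xy(1) H] by metis
    then show "x \<otimes>\<^bsub>G\<^esub> inv\<^bsub>G\<^esub> y \<in> H j"
      using subgroup.rcos_module[OF H is_group xy(2,1)] by simp
  next
    assume "x \<otimes>\<^bsub>G\<^esub> inv\<^bsub>G\<^esub> y \<in> H j"
    then have "x \<in> H j #>\<^bsub>G\<^esub> y"
      using subgroup.rcos_module[OF H is_group xy(2,1)] by simp
    then have "H j #>\<^bsub>G\<^esub> y = H j #>\<^bsub>G\<^esub> x" by (rule repr_independence[OF _ xy(2) H])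
    then show "rep j x = rep j y" by (simp add: rep_def)
  qed
  define face where "face j x = prod_encode (int_encode j, rep j x)" for j x
  define rk where "rk F = int_decode (fst (prod_decode F))" for F
  have "coset_geometry G d g face rk"
  proof (rule coset_geometry.intro[OF G], unfold_locales)
    show "-1 \<le> d" by (rule d)
    show "rk (face j x) = j" for j x by (simp add: rk_def face_def)
    show "face j x = face j y \<longleftrightarrow> x \<otimes>\<^bsub>G\<^esub> inv\<^bsub>G\<^esub> y \<in> generate G (g ` {t. t < nat d \<and> int t \<noteq> j})"
      if "x \<in> carrier G" "y \<in> carrier G" for j x y
      using rep_eq[OF that] by (simp add: face_def prod_encode_eq H_def)
  qed
  then show thesis by (rule that)
qed

section \<open>Flags of a finite polytope\<close>

locale finite_polytope = abstract_polytope n P rk for n :: int and P :: "'b rel" and rk +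
  assumes finite_faces: "finite (Field P)"
begin

lemma P_refl: "F \<in> Field P \<Longrightarrow> (F, F) \<in> P"
  using partial_order by (auto simp: order_on_defs refl_on_def)

lemma P_trans: "(F, G) \<in> P \<Longrightarrow> (G, H) \<in> P \<Longrightarrow> (F, H) \<in> P"
  using partial_order by (auto simp: order_on_defs dest: transD)

lemma P_rk: "(F, G) \<in> P \<Longrightarrow> rk F \<le> rk G"
  using rank_strict_mono[of F G] by (cases "F = G") auto

lemma P_rk_eq: "(F, G) \<in> P \<Longrightarrow> rk F = rk G \<Longrightarrow> F = G"
  using rank_strict_mono[of F G] by (cases "F = G") auto

lemma rk_range: "F \<in> Field P \<Longrightarrow> rk F \<in> {-1..n}"
  using rank_range by blast

lemma chain_Field: "C \<in> Chains P \<Longrightarrow> F \<in> C \<Longrightarrow> F \<in> Field P"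
  by (auto simp: Chains_def Field_def)

lemma chainD: "C \<in> Chains P \<Longrightarrow> F \<in> C \<Longrightarrow> G \<in> C \<Longrightarrow> (F, G) \<in> P \<or> (G, F) \<in> P"
  by (auto simp: Chains_def)

lemma chain_extends:
  assumes "C \<in> Chains P"
  obtains \<Phi> where "\<Phi> \<in> flags P" "C \<subseteq> \<Phi>"
proof -
  have "finite (Chains P)"
    by (rule finite_subset[of _ "Pow (Field P)"]) (use finite_faces chain_Field in auto)
  then obtain \<Phi> where \<Phi>: "\<Phi> \<in> Chains P" "C \<subseteq> \<Phi>" "\<forall>\<Psi>\<in>Chains P. \<Phi> \<subseteq> \<Psi> \<longrightarrow> \<Phi> = \<Psi>"
    using finite_has_maximal2[OF _ assms] by metis
  then have "\<Phi> \<in> flags P" by (auto simp: flags_def)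
  then show thesis using that \<Phi>(2) by blast
qed

section \<open>Flags as families of faces indexed by rank\<close>

definition fc :: "'b set \<Rightarrow> int \<Rightarrow> 'b"
  where "fc \<Phi> j = (THE F. F \<in> \<Phi> \<and> rk F = j)"

lemma flag_chain: "\<Phi> \<in> flags P \<Longrightarrow> \<Phi> \<in> Chains P"
  by (simp add: flags_def)

lemma fc_eqI: "\<Phi> \<in> flags P \<Longrightarrow> F \<in> \<Phi> \<Longrightarrow> fc \<Phi> (rk F) = F"
  unfolding fc_def using flag_ranks[of \<Phi>] by (intro the_equality) (auto simp: bij_betw_def inj_on_def)

lemma fc_in: "\<Phi> \<in> flags P \<Longrightarrow> j \<in> {-1..n} \<Longrightarrow> fc \<Phi> j \<in> \<Phi>"
  and rk_fc: "\<Phi> \<in> flags P \<Longrightarrow> j \<in> {-1..n} \<Longrightarrow> rk (fc \<Phi> j) = j"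
proof -
  assume \<Phi>: "\<Phi> \<in> flags P" and "j \<in> {-1..n}"
  then have "j \<in> rk ` \<Phi>" using flag_ranks[OF \<Phi>] by (simp add: bij_betw_def)
  then obtain F where F: "F \<in> \<Phi>" "j = rk F" by blast
  then show "fc \<Phi> j \<in> \<Phi>" "rk (fc \<Phi> j) = j"
    using fc_eqI[OF \<Phi>] by auto
qed

lemma fc_Field: "\<Phi> \<in> flags P \<Longrightarrow> j \<in> {-1..n} \<Longrightarrow> fc \<Phi> j \<in> Field P"
  using fc_in flag_chain chain_Field by metis

lemma flag_image: "\<Phi> \<in> flags P \<Longrightarrow> \<Phi> = fc \<Phi> ` {-1..n}"
proof (intro equalityI subsetI)
  fix F assume *: "\<Phi> \<in> flags P" "F \<in> \<Phi>"
  then have "rk F \<in> {-1..n}" using flag_chain chain_Field rk_range by metis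
  then show "F \<in> fc \<Phi> ` {-1..n}" using fc_eqI[OF *] by (metis imageI)
qed (auto intro: fc_in)

lemma flag_eqI:
  assumes "\<Phi> \<in> flags P" "\<Psi> \<in> flags P" "\<And>j. j \<in> {-1..n} \<Longrightarrow> fc \<Phi> j = fc \<Psi> j"
  shows "\<Phi> = \<Psi>"
proof -
  have "\<Phi> = fc \<Phi> ` {-1..n}" by (rule flag_image[OF assms(1)])
  also have "\<dots> = fc \<Psi> ` {-1..n}" by (rule image_cong[OF refl assms(3)])
  also have "\<dots> = \<Psi>" by (rule flag_image[OF assms(2), symmetric])
  finally show ?thesis .
qed

lemma fc_le:
  assumes "\<Phi> \<in> flags P" "-1 \<le> i" "i \<le> j" "j \<le> n"
  shows "(fc \<Phi> i, fc \<Phi> j) \<in> P"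
proof -
  have ij: "i \<in> {-1..n}" "j \<in> {-1..n}" using assms by auto
  have "(fc \<Phi> i, fc \<Phi> j) \<in> P \<or> (fc \<Phi> j, fc \<Phi> i) \<in> P"
    using assms(1) ij by (intro chainD[OF flag_chain]) (auto intro: fc_in)
  then show ?thesis
    using P_rk[of "fc \<Phi> j" "fc \<Phi> i"] P_rk_eq[of "fc \<Phi> j" "fc \<Phi> i"] rk_fc[OF assms(1)] ij assms(3)
    by (metis order_antisym)
qed

lemma fc_extremal:
  assumes "\<Phi> \<in> flags P" "\<Psi> \<in> flags P"
  shows "fc \<Phi> (-1) = fc \<Psi> (-1)" "fc \<Phi> n = fc \<Psi> n"
proof -
  obtain F where F: "F \<in> Field P" "rk F = -1" "\<forall>G\<in>Field P. (F, G) \<in> P" using least by blast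
  obtain G where G: "G \<in> Field P" "rk G = n" "\<forall>F\<in>Field P. (F, G) \<in> P" using greatest by blast
  have "-1 \<in> {-1..n}" "n \<in> {-1..n}" using rk_range[OF F(1)] F(2) by auto
  then have "F = fc \<Theta> (-1) \<and> fc \<Theta> n = G" if "\<Theta> \<in> flags P" for \<Theta>
    using that F G fc_Field rk_fc P_rk_eq by metis
  then show "fc \<Phi> (-1) = fc \<Psi> (-1)" "fc \<Phi> n = fc \<Psi> n" using assms by metis+
qed

lemma n_ge: "-1 \<le> n"
  using least rk_range by fastforce

lemma flag_exists: obtains \<Phi> where "\<Phi> \<in> flags P"
  using chain_extends[of "{}"] by (auto simp: Chains_def)

text \<open>Between given faces of ranks \<open>j - 1\<close> and \<open>j + 1\<close> there are
  only two choices, so changing the face of rank \<open>j\<close> twice restores it.\<close>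

lemma fc_diamond:
  assumes fl: "\<Phi> \<in> flags P" "\<Psi> \<in> flags P" "\<Theta> \<in> flags P" and j: "0 \<le> j" "j < n"
    and lo: "fc \<Phi> (j - 1) = fc \<Psi> (j - 1)" "fc \<Psi> (j - 1) = fc \<Theta> (j - 1)"
    and hi: "fc \<Phi> (j + 1) = fc \<Psi> (j + 1)" "fc \<Psi> (j + 1) = fc \<Theta> (j + 1)"
    and ne: "fc \<Phi> j \<noteq> fc \<Psi> j" "fc \<Psi> j \<noteq> fc \<Theta> j"
  shows "fc \<Phi> j = fc \<Theta> j"
proof -
  let ?F = "fc \<Psi> (j - 1)" and ?G = "fc \<Psi> (j + 1)"
  let ?H = "{H \<in> Field P. rk H = j \<and> (?F, H) \<in> P \<and> ?F \<noteq> H \<and> (H, ?G) \<in> P \<and> H \<noteq> ?G}"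
  have r: "rk ?F = j - 1" "rk ?G = j + 1" using rk_fc[OF fl(2)] j by auto
  have "(?F, ?G) \<in> P" using fl(2) j by (intro fc_le) auto
  then have "card ?H = 2" using r by (intro diamond) auto
  then obtain A B where AB: "?H = {A, B}" by (auto simp: card_2_iff)
  have in_H: "fc \<Lambda> j \<in> ?H" if "\<Lambda> \<in> flags P" "fc \<Lambda> (j - 1) = ?F" "fc \<Lambda> (j + 1) = ?G" for \<Lambda>
    using that j r rk_fc[of \<Lambda> j] fc_Field[of \<Lambda> j] fc_le[of \<Lambda> "j - 1" j] fc_le[of \<Lambda> j "j + 1"] by auto
  have "fc \<Phi> j \<in> {A, B}" "fc \<Psi> j \<in> {A, B}" "fc \<Theta> j \<in> {A, B}"
    unfolding AB[symmetric] by (rule in_H[OF fl(1) lo(1) hi(1)], rule in_H[OF fl(2) refl refl],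
      rule in_H[OF fl(3) lo(2)[symmetric] hi(2)[symmetric]])
  then show ?thesis using ne by auto
qed

section \<open>Adjacent flags and flag changes\<close>

definition adj :: "int \<Rightarrow> 'b set \<Rightarrow> 'b set \<Rightarrow> bool"
  where "adj j \<Phi> \<Psi> \<longleftrightarrow> \<Psi> \<in> flags P \<and> fc \<Psi> j \<noteq> fc \<Phi> j \<and> (\<forall>i\<in>{-1..n}. i \<noteq> j \<longrightarrow> fc \<Psi> i = fc \<Phi> i)"

lemma flag_of_faces:
  assumes "\<And>j. j \<in> {-1..n} \<Longrightarrow> rk (f j) = j"
    and "\<And>i j. -1 \<le> i \<Longrightarrow> i \<le> j \<Longrightarrow> j \<le> n \<Longrightarrow> (f i, f j) \<in> P"
  shows "\<exists>\<Phi>\<in>flags P. \<forall>j\<in>{-1..n}. fc \<Phi> j = f j"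
proof -
  have "(f i, f j) \<in> P \<or> (f j, f i) \<in> P" if "i \<in> {-1..n}" "j \<in> {-1..n}" for i j
    using assms(2)[of i j] assms(2)[of j i] that by (cases "i \<le> j") auto
  then have "f ` {-1..n} \<in> Chains P" by (auto simp: Chains_def)
  then obtain \<Phi> where \<Phi>: "\<Phi> \<in> flags P" "f ` {-1..n} \<subseteq> \<Phi>" by (rule chain_extends)
  have "fc \<Phi> j = f j" if "j \<in> {-1..n}" for j
  proof -
    have "f j \<in> \<Phi>" using \<Phi>(2) that by blast
    then show ?thesis using fc_eqI[OF \<Phi>(1)] assms(1)[OF that] by metis
  qed
  then show ?thesis using \<Phi>(1) by blast
qed

text \<open>Putting the other face of the diamond at rank \<open>j\<close> leaves a chain, because
  comparability with the remaining faces passes through the faces of ranks \<open>j - 1\<close> and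
  \<open>j + 1\<close>. Uniqueness is \<open>fc_diamond\<close>.\<close>

lemma adj_ex1:
  assumes \<Phi>: "\<Phi> \<in> flags P" and j: "0 \<le> j" "j < n"
  shows "\<exists>!\<Psi>. adj j \<Phi> \<Psi>"
proof -
  let ?F = "fc \<Phi> (j - 1)" and ?G = "fc \<Phi> (j + 1)"
  let ?H = "{H \<in> Field P. rk H = j \<and> (?F, H) \<in> P \<and> ?F \<noteq> H \<and> (H, ?G) \<in> P \<and> H \<noteq> ?G}"
  have r: "rk ?F = j - 1" "rk ?G = j + 1" using rk_fc[OF \<Phi>] j by auto
  have "(?F, ?G) \<in> P" using \<Phi> j by (intro fc_le) auto
  then have card: "card ?H = 2" using r by (intro diamond) auto
  have "?H - {fc \<Phi> j} \<noteq> {}"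
  proof
    assume "?H - {fc \<Phi> j} = {}"
    then have "card ?H \<le> card {fc \<Phi> j}" by (intro card_mono) auto
    then show False using card by simp
  qed
  then obtain H where H: "H \<in> ?H" "H \<noteq> fc \<Phi> j" by blast
  define f where "f i = (if i = j then H else fc \<Phi> i)" for i
  have rk_f: "rk (f i) = i" if "i \<in> {-1..n}" for i
    using that H rk_fc[OF \<Phi>] by (auto simp: f_def)
  have f_le: "(f i, f l) \<in> P" if "-1 \<le> i" "i \<le> l" "l \<le> n" for i l
  proof -
    have 1: "(fc \<Phi> i, H) \<in> P" if "i < j"
      using that \<open>-1 \<le> i\<close> j H fc_le[OF \<Phi>, of i "j - 1"] P_trans by auto
    have 2: "(H, fc \<Phi> l) \<in> P" if "j < l"
      using that \<open>l \<le> n\<close> j H fc_le[OF \<Phi>, of "j + 1" l] P_trans by auto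
    show ?thesis
      using 1 2 H that P_refl[of H] fc_le[OF \<Phi>, of i l] by (auto simp: f_def)
  qed
  have "\<exists>\<Psi>\<in>flags P. \<forall>i\<in>{-1..n}. fc \<Psi> i = f i"
    by (rule flag_of_faces[of f, OF rk_f f_le])
  then obtain \<Psi> where \<Psi>: "\<Psi> \<in> flags P" "\<And>i. i \<in> {-1..n} \<Longrightarrow> fc \<Psi> i = f i" by blast
  have "adj j \<Phi> \<Psi>"
    using \<Psi> H j by (auto simp: adj_def f_def)
  moreover have "\<Theta> = \<Psi>" if "adj j \<Phi> \<Theta>" for \<Theta>
  proof (rule flag_eqI)
    show \<Theta>: "\<Theta> \<in> flags P" using that by (simp add: adj_def)
    show "\<Psi> \<in> flags P" by fact
    fix i assume i: "i \<in> {-1..n}"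
    show "fc \<Theta> i = fc \<Psi> i"
    proof (cases "i = j")
      case False
      then show ?thesis using that \<open>adj j \<Phi> \<Psi>\<close> i by (simp add: adj_def)
    next
      case True
      have "fc \<Theta> j = fc \<Psi> j"
        using that \<open>adj j \<Phi> \<Psi>\<close> j by (intro fc_diamond[OF \<Theta> \<Phi> \<Psi>(1)]) (auto simp: adj_def)
      then show ?thesis using True by simp
    qed
  qed
  ultimately show ?thesis by blast
qed

definition swap :: "int \<Rightarrow> 'b set \<Rightarrow> 'b set"
  where "swap j \<Phi> = (THE \<Psi>. adj j \<Phi> \<Psi>)"

context
  fixes j :: int assumes j: "0 \<le> j" "j < n"
begin

lemma adj_swap: "\<Phi> \<in> flags P \<Longrightarrow> adj j \<Phi> (swap j \<Phi>)"
  unfolding swap_def by (rule theI') (rule adj_ex1[OF _ j])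

lemma swap_eqI: "\<Phi> \<in> flags P \<Longrightarrow> adj j \<Phi> \<Psi> \<Longrightarrow> swap j \<Phi> = \<Psi>"
  using adj_ex1[OF _ j] adj_swap by blast

lemma swap_flag: "\<Phi> \<in> flags P \<Longrightarrow> swap j \<Phi> \<in> flags P"
  using adj_swap by (simp add: adj_def)

lemma fc_swap: "\<Phi> \<in> flags P \<Longrightarrow> i \<in> {-1..n} \<Longrightarrow> i \<noteq> j \<Longrightarrow> fc (swap j \<Phi>) i = fc \<Phi> i"
  using adj_swap by (simp add: adj_def)

lemma fc_swap_neq: "\<Phi> \<in> flags P \<Longrightarrow> fc (swap j \<Phi>) j \<noteq> fc \<Phi> j"
  using adj_swap by (simp add: adj_def)

lemma swap_swap: "\<Phi> \<in> flags P \<Longrightarrow> swap j (swap j \<Phi>) = \<Phi>"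
proof (rule swap_eqI)
  assume \<Phi>: "\<Phi> \<in> flags P"
  then show "swap j \<Phi> \<in> flags P" by (rule swap_flag)
  show "adj j (swap j \<Phi>) \<Phi>"
    using \<Phi> adj_swap[OF \<Phi>] by (auto simp: adj_def)
qed

end

text \<open>Changing \<open>\<Phi>\<close> at ranks \<open>i\<close>, \<open>j\<close>,
  \<open>i\<close> in turn alters the face of rank \<open>i\<close> twice between unchanged
  neighbours, since \<open>j\<close> is not next to \<open>i\<close>. That face is restored, and the
  result differs from \<open>\<Phi>\<close> exactly at rank \<open>j\<close>.\<close>

lemma swap_commute:
  assumes i: "0 \<le> i" "i < n" and j: "0 \<le> j" "j < n" and far: "\<bar>i - j\<bar> > 1" and \<Phi>: "\<Phi> \<in> flags P"
  shows "swap i (swap j \<Phi>) = swap j (swap i \<Phi>)"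
proof -
  define \<Theta> where "\<Theta> = swap j (swap i \<Phi>)"
  define \<Psi> where "\<Psi> = swap i \<Theta>"
  have fl: "swap i \<Phi> \<in> flags P" "\<Theta> \<in> flags P" "\<Psi> \<in> flags P"
    unfolding \<Psi>_def \<Theta>_def using \<Phi> i j by (simp_all add: swap_flag)
  note faces = fc_swap[OF i \<Phi>] fc_swap[OF j fl(1), folded \<Theta>_def] fc_swap[OF i fl(2), folded \<Psi>_def]
  have "fc \<Psi> i = fc \<Phi> i"
  proof (rule fc_diamond[OF fl(3) fl(2) \<Phi> i])
    show "fc \<Psi> (i - 1) = fc \<Theta> (i - 1)" "fc \<Theta> (i - 1) = fc \<Phi> (i - 1)"
      "fc \<Psi> (i + 1) = fc \<Theta> (i + 1)" "fc \<Theta> (i + 1) = fc \<Phi> (i + 1)"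
      using i far by (auto simp: faces)
    show "fc \<Psi> i \<noteq> fc \<Theta> i" unfolding \<Psi>_def by (rule fc_swap_neq[OF i fl(2)])
    show "fc \<Theta> i \<noteq> fc \<Phi> i"
      using faces(2)[of i] i far fc_swap_neq[OF i \<Phi>] by auto
  qed
  then have "fc \<Psi> l = fc \<Phi> l" if "l \<in> {-1..n}" "l \<noteq> j" for l
    using that by (cases "l = i") (simp_all add: faces)
  moreover have "fc \<Psi> j \<noteq> fc \<Phi> j"
    using faces(3)[of j] faces(1)[of j] fc_swap_neq[OF j fl(1), folded \<Theta>_def] i j far by auto
  ultimately have "adj j \<Phi> \<Psi>"
    using fl(3) by (auto simp: adj_def)
  then have "swap j \<Phi> = \<Psi>" by (rule swap_eqI[OF j \<Phi>])
  then have "swap i (swap j \<Phi>) = \<Theta>"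
    unfolding \<Psi>_def using swap_swap[OF i fl(2)] by simp
  then show ?thesis by (simp add: \<Theta>_def)
qed

subsection \<open>The monodromy group\<close>

abbreviation M :: "('b set \<Rightarrow> 'b set) monoid"
  where "M \<equiv> BijGroup (flags P)"

text \<open>Elements of \<open>BijGroup\<close> are extensional on the flags, hence the restriction.
  The monodromy group is the subgroup of \<open>M\<close> that these maps generate.\<close>

definition r :: "nat \<Rightarrow> 'b set \<Rightarrow> 'b set"
  where "r t = restrict (swap (int t)) (flags P)"

lemma M_one: "\<Phi> \<in> flags P \<Longrightarrow> \<one>\<^bsub>M\<^esub> \<Phi> = \<Phi>"
  by (simp add: BijGroup_def)

lemma M_mult: "x \<in> carrier M \<Longrightarrow> y \<in> carrier M \<Longrightarrow> \<Phi> \<in> flags P \<Longrightarrow> (x \<otimes>\<^bsub>M\<^esub> y) \<Phi> = x (y \<Phi>)"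
  by (simp add: BijGroup_def compose_def)

lemma M_flag: "x \<in> carrier M \<Longrightarrow> \<Phi> \<in> flags P \<Longrightarrow> x \<Phi> \<in> flags P"
  by (auto simp: BijGroup_def dest!: Bij_imp_funcset)

lemma M_eqI:
  assumes "x \<in> carrier M" "y \<in> carrier M" "\<And>\<Phi>. \<Phi> \<in> flags P \<Longrightarrow> x \<Phi> = y \<Phi>"
  shows "x = y"
  using assms by (auto simp: BijGroup_def dest!: Bij_imp_extensional intro: extensionalityI)

lemma r_carrier: "t < nat n \<Longrightarrow> r t \<in> carrier M"
proof -
  assume t: "t < nat n"
  then have "bij_betw (r t) (flags P) (flags P)"
    by (intro bij_betw_byWitness[where f' = "r t"]) (auto simp: r_def swap_swap swap_flag)
  then show "r t \<in> carrier M"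
    by (simp add: BijGroup_def Bij_def r_def)
qed

lemma finite_flags: "finite (flags P)"
  by (rule finite_subset[of _ "Pow (Field P)"]) (use finite_faces flag_chain chain_Field in blast)+

lemma finite_M: "finite (carrier M)"
proof (rule finite_subset)
  show "carrier M \<subseteq> flags P \<rightarrow>\<^sub>E flags P"
    by (auto simp: BijGroup_def PiE_def dest: Bij_imp_funcset Bij_imp_extensional)
  show "finite (flags P \<rightarrow>\<^sub>E flags P)"
    using finite_flags by (simp add: finite_PiE)
qed

sublocale M: string_involutions M "nat n" r
proof (rule string_involutions.intro[OF group_BijGroup], unfold_locales)
  interpret group M by (rule group_BijGroup)
  show "r j \<in> carrier M" if "j < nat n" for j by (rule r_carrier[OF that])
  show "r j \<noteq> \<one>\<^bsub>M\<^esub>" if j: "j < nat n" for j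
  proof
    assume eq: "r j = \<one>\<^bsub>M\<^esub>"
    obtain \<Phi> where \<Phi>: "\<Phi> \<in> flags P" by (rule flag_exists)
    have "swap (int j) \<Phi> = \<Phi>"
      using M_one[OF \<Phi>] \<Phi> by (simp add: eq[symmetric] r_def)
    moreover have "fc (swap (int j) \<Phi>) (int j) \<noteq> fc \<Phi> (int j)"
      using \<Phi> j by (intro fc_swap_neq) auto
    ultimately show False by simp
  qed
  show "r j \<otimes>\<^bsub>M\<^esub> r j = \<one>\<^bsub>M\<^esub>" if "j < nat n" for j
    using that r_carrier by (intro M_eqI) (auto simp: M_mult M_one r_def swap_swap swap_flag)
  show "r i \<otimes>\<^bsub>M\<^esub> r j = r j \<otimes>\<^bsub>M\<^esub> r i" if "i < nat n" "j < nat n" "i + 1 < j" for i j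
    using that r_carrier swap_commute[of "int i" "int j"]
    by (intro M_eqI) (auto simp: M_mult r_def swap_flag)
qed

lemma r_flag: "t < nat n \<Longrightarrow> \<Phi> \<in> flags P \<Longrightarrow> r t \<Phi> = swap (int t) \<Phi>"
  by (simp add: r_def)

text \<open>Each letter of a word changes only the face of its own rank.\<close>

lemma fc_gen:
  assumes I: "I \<subseteq> {..<nat n}" and x: "x \<in> M.gen I" and \<Phi>: "\<Phi> \<in> flags P" and j: "j \<in> {-1..n}" "j \<notin> int ` I"
  shows "fc (x \<Phi>) j = fc \<Phi> j"
proof -
  from I x have "\<forall>\<Phi>\<in>flags P. fc (x \<Phi>) j = fc \<Phi> j"
  proof (induction rule: M.gen_induct)
    case one
    then show ?case by (simp add: M_one)
  next
    case (gen t)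
    then have "t < nat n" "j \<noteq> int t" using I j by auto
    then show ?case using j by (auto simp: r_flag fc_swap)
  next
    case (mult x y)
    have "x \<in> carrier M" "y \<in> carrier M" using M.gen_carrier[OF I] mult by simp_all
    then show ?case using mult M_flag by (simp add: M_mult)
  qed
  then show ?thesis using \<Phi> by blast
qed

subsection \<open>Strong flag connectivity\<close>

text \<open>The faces of \<open>\<Phi>\<close> up to rank \<open>a\<close> and from rank
  \<open>b\<close> on are comparable to the whole section, so they can join the chain before it is
  extended. This lifts chains and flags of a section to flags of the polytope.\<close>

lemma section_chain_extends:
  assumes \<Phi>: "\<Phi> \<in> flags P" and ab: "-1 \<le> a" "a \<le> b" "b \<le> n"
    and C: "C \<in> Chains (section_poset P (fc \<Phi> a) (fc \<Phi> b))"
  obtains \<Psi> where "\<Psi> \<in> flags P" "\<And>j. j \<in> {-1..n} \<Longrightarrow> j \<le> a \<or> b \<le> j \<Longrightarrow> fc \<Psi> j = fc \<Phi> j"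
    "C \<subseteq> fc \<Psi> ` {a..b}"
proof -
  let ?D = "fc \<Phi> ` {j \<in> {-1..n}. j \<le> a \<or> b \<le> j}"
  have between: "(fc \<Phi> a, F) \<in> P" "(F, fc \<Phi> b) \<in> P" if "F \<in> C" for F
    using C that by (auto simp: Chains_def section_poset_def)
  have CC: "(F, G) \<in> P \<or> (G, F) \<in> P" if "F \<in> C" "G \<in> C" for F G
    using C that by (auto simp: Chains_def section_poset_def)
  have CD: "(F, G) \<in> P \<or> (G, F) \<in> P" if FG: "F \<in> C" "G \<in> ?D" for F G
  proof -
    obtain j where j: "G = fc \<Phi> j" "j \<in> {-1..n}" "j \<le> a \<or> b \<le> j" using FG by auto
    then show ?thesis
      using between[OF FG(1)] fc_le[OF \<Phi>, of j a] fc_le[OF \<Phi>, of b j] ab P_trans by auto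
  qed
  have DD: "(F, G) \<in> P \<or> (G, F) \<in> P" if FG: "F \<in> ?D" "G \<in> ?D" for F G
  proof -
    have "F \<in> \<Phi>" "G \<in> \<Phi>" using FG fc_in[OF \<Phi>] by auto
    then show ?thesis by (rule chainD[OF flag_chain[OF \<Phi>]])
  qed
  have "C \<union> ?D \<in> Chains P"
    unfolding Chains_def using CC CD DD by blast
  then obtain \<Psi> where \<Psi>: "\<Psi> \<in> flags P" "C \<union> ?D \<subseteq> \<Psi>" by (rule chain_extends)
  show thesis
  proof (rule that[OF \<Psi>(1)])
    show "fc \<Psi> j = fc \<Phi> j" if "j \<in> {-1..n}" "j \<le> a \<or> b \<le> j" for j
    proof -
      have "fc \<Phi> j \<in> \<Psi>" using \<Psi>(2) that by blast
      then show ?thesis using fc_eqI[OF \<Psi>(1)] rk_fc[OF \<Phi> that(1)] by metis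
    qed
    show "C \<subseteq> fc \<Psi> ` {a..b}"
    proof
      fix F assume F: "F \<in> C"
      then have "fc \<Psi> (rk F) = F" using fc_eqI[OF \<Psi>(1)] \<Psi>(2) by blast
      moreover have "rk F \<in> {a..b}"
        using between[OF F, THEN P_rk] rk_fc[OF \<Phi>] ab by auto
      ultimately show "F \<in> fc \<Psi> ` {a..b}" by (metis imageI)
    qed
  qed
qed

lemma fc_subset:
  assumes fl: "\<Phi> \<in> flags P" "\<Psi> \<in> flags P" and ab: "-1 \<le> a" "b \<le> n"
    and sub: "fc \<Phi> ` {a..b} \<subseteq> fc \<Psi> ` {a..b}" and j: "j \<in> {a..b}"
  shows "fc \<Phi> j = fc \<Psi> j"
proof -
  have "fc \<Phi> j \<in> fc \<Psi> ` {a..b}" using sub j by blast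
  then obtain i where i: "i \<in> {a..b}" "fc \<Phi> j = fc \<Psi> i" by blast
  then have "j = i" using rk_fc[OF fl(1), of j] rk_fc[OF fl(2), of i] j ab by auto
  then show ?thesis using i by simp
qed

lemma section_flag:
  assumes \<Phi>: "\<Phi> \<in> flags P" and ab: "-1 \<le> a" "a \<le> b" "b \<le> n"
  shows "fc \<Phi> ` {a..b} \<in> flags (section_poset P (fc \<Phi> a) (fc \<Phi> b))"
proof -
  let ?S = "section_poset P (fc \<Phi> a) (fc \<Phi> b)"
  have "fc \<Phi> ` {a..b} \<in> Chains ?S"
  proof -
    have "(fc \<Phi> i, fc \<Phi> j) \<in> P \<or> (fc \<Phi> j, fc \<Phi> i) \<in> P" if "i \<in> {a..b}" "j \<in> {a..b}" for i j
      using that ab fc_le[OF \<Phi>, of i j] fc_le[OF \<Phi>, of j i] by (cases "i \<le> j") auto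
    moreover have "(fc \<Phi> a, fc \<Phi> j) \<in> P" "(fc \<Phi> j, fc \<Phi> b) \<in> P" if "j \<in> {a..b}" for j
      using that ab by (auto intro!: fc_le[OF \<Phi>])
    ultimately show ?thesis by (auto simp: Chains_def section_poset_def)
  qed
  moreover have "C = fc \<Phi> ` {a..b}" if C: "C \<in> Chains ?S" "fc \<Phi> ` {a..b} \<subseteq> C" for C
  proof -
    obtain \<Psi> where \<Psi>: "\<Psi> \<in> flags P" "C \<subseteq> fc \<Psi> ` {a..b}"
      using section_chain_extends[OF \<Phi> ab C(1)] by metis
    have "fc \<Phi> j = fc \<Psi> j" if "j \<in> {a..b}" for j
      using fc_subset[OF \<Phi> \<Psi>(1) ab(1,3) _ that] C(2) \<Psi>(2) by blast
    then have "fc \<Phi> ` {a..b} = fc \<Psi> ` {a..b}" by (rule image_cong[OF refl])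
    then have "C \<subseteq> fc \<Phi> ` {a..b}" using \<Psi>(2) by simp
    then show ?thesis using C(2) by (rule subset_antisym)
  qed
  ultimately show ?thesis by (simp add: flags_def)
qed

text \<open>Turns a path in the flag graph of a section into a group element: each flag on the path
  lifts to a flag with the outer faces of \<open>\<Phi>\<close>, and consecutive lifts differ by one
  change at a rank strictly between \<open>a\<close> and \<open>b\<close>.\<close>

lemma section_path:
  assumes \<Phi>: "\<Phi> \<in> flags P" and ab: "-1 \<le> a" "a \<le> b" "b \<le> n"
    and path: "(fc \<Phi> ` {a..b}, \<chi>) \<in> (flag_graph (section_poset P (fc \<Phi> a) (fc \<Phi> b)))\<^sup>*"
    and \<Psi>: "\<Psi> \<in> flags P" "\<And>j. j \<in> {-1..n} \<Longrightarrow> j \<le> a \<or> b \<le> j \<Longrightarrow> fc \<Psi> j = fc \<Phi> j"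
      "\<chi> = fc \<Psi> ` {a..b}"
  shows "\<exists>x\<in>M.gen {t. a < int t \<and> int t < b}. \<Psi> = x \<Phi>"
  using path \<Psi>
proof (induction arbitrary: \<Psi> rule: rtrancl_induct)
  case base
  have "\<Psi> = \<Phi>"
  proof (rule flag_eqI[OF base(1) \<Phi>])
    fix j assume j: "j \<in> {-1..n}"
    show "fc \<Psi> j = fc \<Phi> j"
    proof (cases "j \<in> {a..b}")
      case True
      show ?thesis
        by (rule fc_subset[OF base(1) \<Phi> ab(1,3) _ True]) (simp add: base(3))
    next
      case False
      then show ?thesis using base(2)[OF j] by auto
    qed
  qed
  then show ?case using M_one[OF \<Phi>] M.gen_one by metis
next
  case (step \<chi>1 \<chi>2)
  let ?S = "section_poset P (fc \<Phi> a) (fc \<Phi> b)"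
  let ?I = "{t. a < int t \<and> int t < b}"
  have I: "?I \<subseteq> {..<nat n}" using ab by auto
  have "\<chi>1 \<in> flags ?S" and nadj: "flags_adjacent \<chi>1 \<chi>2"
    using step.hyps(2) by (auto simp: flag_graph_def)
  then obtain \<Psi>1 where \<Psi>1: "\<Psi>1 \<in> flags P"
    "\<And>j. j \<in> {-1..n} \<Longrightarrow> j \<le> a \<or> b \<le> j \<Longrightarrow> fc \<Psi>1 j = fc \<Phi> j" "\<chi>1 \<subseteq> fc \<Psi>1 ` {a..b}"
    using section_chain_extends[OF \<Phi> ab, of \<chi>1] by (metis (no_types, lifting) flags_def mem_Collect_eq)
  have \<chi>1: "\<chi>1 = fc \<Psi>1 ` {a..b}"
  proof -
    have "fc \<Psi>1 ` {a..b} \<in> Chains ?S"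
      using section_flag[OF \<Psi>1(1) ab] \<Psi>1(2)[of a] \<Psi>1(2)[of b] ab by (simp add: flags_def)
    then show ?thesis
      using \<open>\<chi>1 \<in> flags ?S\<close> \<Psi>1(3) by (auto simp: flags_def)
  qed
  obtain x where x: "x \<in> M.gen ?I" "\<Psi>1 = x \<Phi>"
    using step.IH[OF \<Psi>1(1,2) \<chi>1] by blast
  obtain F where F: "\<chi>1 - \<chi>2 = {F}"
    using nadj by (auto simp: flags_adjacent_def)
  then have "F \<in> fc \<Psi>1 ` {a..b}" using \<chi>1 by blast
  then obtain j where j: "j \<in> {a..b}" "F = fc \<Psi>1 j" by blast
  \<comment> \<open>Only \<open>F\<close> is lost in passing from \<open>\<chi>1\<close> to
    \<open>\<chi>2\<close>; the other faces persist, and rank tells which face of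
    \<open>\<Psi>\<close> each one is.\<close>
  have other: "fc \<Psi> i = fc \<Psi>1 i" if i: "i \<in> {-1..n}" "i \<noteq> j" for i
  proof (cases "i \<in> {a..b}")
    case False
    then show ?thesis using step.prems(2)[of i] \<Psi>1(2)[of i] i by auto
  next
    case True
    have "fc \<Psi>1 i \<noteq> F"
      using rk_fc[OF \<Psi>1(1), of i] rk_fc[OF \<Psi>1(1), of j] i j ab by auto
    then have "fc \<Psi>1 i \<in> \<chi>2" using F \<chi>1 True by blast
    then obtain l where l: "l \<in> {a..b}" "fc \<Psi>1 i = fc \<Psi> l" using step.prems(3) by blast
    then have "l = i"
      using rk_fc[OF \<Psi>1(1), of i] rk_fc[OF step.prems(1), of l] i ab by auto
    then show ?thesis using l by simp
  qed
  have neq: "fc \<Psi> j \<noteq> fc \<Psi>1 j"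
  proof
    assume "fc \<Psi> j = fc \<Psi>1 j"
    moreover have "fc \<Psi> j \<in> \<chi>2" unfolding step.prems(3) using j(1) by (rule imageI)
    ultimately have "F \<in> \<chi>2" using j(2) by simp
    then show False using F by blast
  qed
  \<comment> \<open>At both ends the two lifts agree with \<open>\<Phi>\<close>, so the changed rank
    is an inner one.\<close>
  have ajb: "a < j" "j < b"
    using neq j step.prems(2)[of j] \<Psi>1(2)[of j] ab by force+
  have "adj j \<Psi>1 \<Psi>"
    using other neq step.prems(1) by (simp add: adj_def)
  then have "swap j \<Psi>1 = \<Psi>"
    using ajb ab \<Psi>1(1) by (intro swap_eqI) auto
  then have "\<Psi> = r (nat j) (x \<Phi>)"
    using ajb ab \<Psi>1(1) x(2) by (subst r_flag) auto
  moreover have t: "nat j \<in> ?I" using ajb ab by auto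
  ultimately have "\<Psi> = (r (nat j) \<otimes>\<^bsub>M\<^esub> x) \<Phi>"
    using M_mult[OF r_carrier M.gen_carrier[OF I x(1)] \<Phi>, of "nat j"] ajb ab by simp
  moreover have "r (nat j) \<otimes>\<^bsub>M\<^esub> x \<in> M.gen ?I"
    by (rule M.gen_mult[OF M.gen_g[OF t] x(1)])
  ultimately show ?case by blast
qed

text \<open>Flags are corrected one maximal interval \<open>{a<..<b}\<close> of disagreement at a time.\<close>

lemma strong_flag_connectivity:
  assumes "\<Phi> \<in> flags P" "\<Psi> \<in> flags P"
  shows "\<exists>x\<in>M.gen {t. t < nat n \<and> fc \<Phi> (int t) \<noteq> fc \<Psi> (int t)}. \<Psi> = x \<Phi>"
  using assms
proof (induction "card {j \<in> {-1..n}. fc \<Phi> j \<noteq> fc \<Psi> j}" arbitrary: \<Phi> rule: less_induct)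
  case less
  let ?D = "\<lambda>\<Phi>. {j \<in> {-1..n}. fc \<Phi> j \<noteq> fc \<Psi> j}"
  let ?I = "\<lambda>\<Phi>. {t. t < nat n \<and> fc \<Phi> (int t) \<noteq> fc \<Psi> (int t)}"
  note \<Phi> = less.prems(1) and \<Psi> = less.prems(2)
  show ?case
  proof (cases "?D \<Phi> = {}")
    case True
    then have "\<Phi> = \<Psi>" by (intro flag_eqI[OF \<Phi> \<Psi>]) auto
    then show ?thesis using M_one[OF \<Phi>] M.gen_one by metis
  next
    case False
    define c where "c = Min (?D \<Phi>)"
    have fin: "finite (?D \<Phi>)" by (rule finite_subset[of _ "{-1..n}"]) auto
    have c: "c \<in> ?D \<Phi>" unfolding c_def by (rule Min_in[OF fin False])
    have c_min: "c \<le> j" if "j \<in> ?D \<Phi>" for j unfolding c_def by (rule Min_le[OF fin that])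
    \<comment> \<open>\<open>c\<close> is the lowest rank of disagreement and \<open>b\<close> the
      next rank of agreement; both bounds exist because the improper faces of two flags always
      agree.\<close>
    define a where "a = c - 1"
    define b where "b = Min {j \<in> {c..n}. fc \<Phi> j = fc \<Psi> j}"
    have "n \<in> {j \<in> {c..n}. fc \<Phi> j = fc \<Psi> j}" using fc_extremal[OF \<Phi> \<Psi>] c by auto
    moreover have finb: "finite {j \<in> {c..n}. fc \<Phi> j = fc \<Psi> j}"
      by (rule finite_subset[of _ "{c..n}"]) auto
    ultimately have b: "b \<in> {j \<in> {c..n}. fc \<Phi> j = fc \<Psi> j}"
      unfolding b_def by (intro Min_in) auto
    have b_min: "b \<le> j" if "j \<in> {c..n}" "fc \<Phi> j = fc \<Psi> j" for j
      unfolding b_def using that by (intro Min_le[OF finb]) auto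
    have "c \<noteq> -1" using c fc_extremal[OF \<Phi> \<Psi>] by auto
    then have ab: "-1 \<le> a" "a \<le> b" "b \<le> n" using b c by (auto simp: a_def)
    have "c \<noteq> b" using b c by auto
    then have cab: "a < c" "c < b" using b by (auto simp: a_def)
    have fa: "fc \<Phi> a = fc \<Psi> a" using c_min[of a] ab by (auto simp: a_def)
    have fb: "fc \<Phi> b = fc \<Psi> b" using b by simp
    let ?S = "section_poset P (fc \<Phi> a) (fc \<Phi> b)"
    have \<chi>: "fc \<Psi> ` {a..b} \<in> flags ?S" using section_flag[OF \<Psi> ab] fa fb by simp
    then have "fc \<Psi> ` {a..b} \<in> Chains ?S" by (simp add: flags_def)
    then obtain \<Theta> where \<Theta>: "\<Theta> \<in> flags P"
      "\<And>j. j \<in> {-1..n} \<Longrightarrow> j \<le> a \<or> b \<le> j \<Longrightarrow> fc \<Theta> j = fc \<Phi> j" "fc \<Psi> ` {a..b} \<subseteq> fc \<Theta> ` {a..b}"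
      using section_chain_extends[OF \<Phi> ab] by metis
    have \<Theta>\<Psi>: "fc \<Theta> j = fc \<Psi> j" if "j \<in> {a..b}" for j
      using fc_subset[OF \<Psi> \<Theta>(1) ab(1,3) \<Theta>(3) that] by simp
    have "(fc \<Phi> a, fc \<Phi> b) \<in> P" by (rule fc_le[OF \<Phi> ab])
    then have "(fc \<Phi> ` {a..b}, fc \<Psi> ` {a..b}) \<in> (flag_graph ?S)\<^sup>*"
      using sections_flag_connected \<chi> section_flag[OF \<Phi> ab] by (auto simp: flag_connected_def)
    moreover have "fc \<Psi> ` {a..b} = fc \<Theta> ` {a..b}" using \<Theta>\<Psi> by (intro image_cong) auto
    ultimately obtain x where x: "x \<in> M.gen {t. a < int t \<and> int t < b}" "\<Theta> = x \<Phi>"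
      using section_path[OF \<Phi> ab _ \<Theta>(1,2) refl] by auto
    \<comment> \<open>Every rank strictly between \<open>a\<close> and \<open>b\<close> is one of
      disagreement, so \<open>x\<close> uses permitted generators only.\<close>
    have "{t. a < int t \<and> int t < b} \<subseteq> ?I \<Phi>"
    proof
      fix t assume "t \<in> {t. a < int t \<and> int t < b}"
      then have t: "int t \<in> {c..n}" "int t < b" using ab by (auto simp: a_def)
      then have "fc \<Phi> (int t) \<noteq> fc \<Psi> (int t)" using b_min by force
      then show "t \<in> ?I \<Phi>" using t ab by auto
    qed
    then have x': "x \<in> M.gen (?I \<Phi>)" by (rule M.gen_monoD[OF x(1)])
    \<comment> \<open>Agreement is gained at rank \<open>c\<close> and lost nowhere, which makes the
      induction go down.\<close>
    have D: "?D \<Theta> \<subseteq> ?D \<Phi> - {c}"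
    proof
      fix j assume j: "j \<in> ?D \<Theta>"
      then have "j \<notin> {a..b}" using \<Theta>\<Psi> by auto
      then show "j \<in> ?D \<Phi> - {c}" using j \<Theta>(2)[of j] cab by auto
    qed
    then have "?D \<Theta> \<subset> ?D \<Phi>" using c by blast
    then have "card (?D \<Theta>) < card (?D \<Phi>)" using fin by (simp add: psubset_card_mono)
    then obtain y where y: "y \<in> M.gen (?I \<Theta>)" "\<Psi> = y \<Theta>"
      using less.hyps[OF _ \<Theta>(1) \<Psi>] by blast
    have "?I \<Theta> \<subseteq> ?I \<Phi>"
    proof
      fix t assume t: "t \<in> ?I \<Theta>"
      then have "int t \<in> ?D \<Theta>" by auto
      then have "int t \<in> ?D \<Phi>" using D by blast
      then show "t \<in> ?I \<Phi>" using t by auto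
    qed
    then have y': "y \<in> M.gen (?I \<Phi>)" by (rule M.gen_monoD[OF y(1)])
    have I: "?I \<Phi> \<subseteq> {..<nat n}" by auto
    have "\<Psi> = (y \<otimes>\<^bsub>M\<^esub> x) \<Phi>"
      using y(2) x(2) M_mult[OF M.gen_carrier[OF I y'] M.gen_carrier[OF I x'] \<Phi>] by simp
    then show ?thesis using M.gen_mult[OF y' x'] by (rule bexI)
  qed
qed

end

section \<open>Poset isomorphisms and flags\<close>

lemma poset_isoD:
  assumes "poset_iso P Q f"
  shows "bij_betw f (Field P) (Field Q)"
    and "F \<in> Field P \<Longrightarrow> G \<in> Field P \<Longrightarrow> (F, G) \<in> P \<longleftrightarrow> (f F, f G) \<in> Q"
  using assms unfolding poset_iso_def by blast+

lemma poset_iso_inv: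
  assumes f: "poset_iso P Q f"
  shows "poset_iso Q P (inv_into (Field P) f)"
proof -
  let ?h = "inv_into (Field P) f"
  have bij: "bij_betw f (Field P) (Field Q)" by (rule poset_isoD(1)[OF f])
  then have h: "?h F \<in> Field P" "f (?h F) = F" if "F \<in> Field Q" for F
    using that by (auto simp: bij_betw_def inv_into_into f_inv_into_f)
  have "(F, G) \<in> Q \<longleftrightarrow> (?h F, ?h G) \<in> P" if "F \<in> Field Q" "G \<in> Field Q" for F G
    using poset_isoD(2)[OF f h(1)[OF that(1)] h(1)[OF that(2)]] h(2) that by simp
  then show ?thesis
    using bij_betw_inv_into[OF bij] unfolding poset_iso_def by blast
qed

lemma poset_iso_comp:
  assumes f: "poset_iso P Q f" and h: "poset_iso Q R h"
  shows "poset_iso P R (h \<circ> f)"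
proof -
  have "f F \<in> Field Q" if "F \<in> Field P" for F
    using poset_isoD(1)[OF f] that by (auto simp: bij_betw_def)
  then have "(F, G) \<in> P \<longleftrightarrow> ((h \<circ> f) F, (h \<circ> f) G) \<in> R" if "F \<in> Field P" "G \<in> Field P" for F G
    using poset_isoD(2)[OF f that] poset_isoD(2)[OF h] that by simp
  then show ?thesis
    using bij_betw_trans[OF poset_isoD(1)[OF f] poset_isoD(1)[OF h]] unfolding poset_iso_def by blast
qed

lemma poset_iso_chain:
  assumes f: "poset_iso P Q f" and C: "C \<in> Chains P"
  shows "f ` C \<in> Chains Q"
proof -
  have "(f F, f G) \<in> Q \<or> (f G, f F) \<in> Q" if "F \<in> C" "G \<in> C" for F G
  proof -
    have "(F, G) \<in> P \<or> (G, F) \<in> P" using C that by (auto simp: Chains_def)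
    moreover from this have "F \<in> Field P" "G \<in> Field P" by (auto simp: Field_def)
    ultimately show ?thesis using poset_isoD(2)[OF f] by metis
  qed
  then show ?thesis by (auto simp: Chains_def)
qed

lemma poset_iso_flag:
  assumes f: "poset_iso P Q f" and \<Phi>: "\<Phi> \<in> flags P"
  shows "f ` \<Phi> \<in> flags Q"
proof -
  let ?h = "inv_into (Field P) f"
  have bij: "bij_betw f (Field P) (Field Q)" by (rule poset_isoD(1)[OF f])
  have "\<Phi> \<in> Chains P" using \<Phi> by (simp add: flags_def)
  then have sub: "\<Phi> \<subseteq> Field P" by (auto simp: Chains_def Field_def)
  have "\<Psi> = f ` \<Phi>" if \<Psi>: "\<Psi> \<in> Chains Q" "f ` \<Phi> \<subseteq> \<Psi>" for \<Psi>
  proof -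
    have subQ: "\<Psi> \<subseteq> Field Q" using \<Psi>(1) by (auto simp: Chains_def Field_def)
    have "?h ` f ` \<Phi> = \<Phi>"
      using bij_betw_inv_into_left[OF bij] sub by (force simp: image_image)
    then have "\<Phi> \<subseteq> ?h ` \<Psi>" using image_mono[OF \<Psi>(2), of ?h] by simp
    then have "?h ` \<Psi> = \<Phi>"
      using \<Phi> poset_iso_chain[OF poset_iso_inv[OF f] \<Psi>(1)] by (auto simp: flags_def)
    moreover have "f ` ?h ` \<Psi> = \<Psi>"
      using bij_betw_inv_into_right[OF bij] subQ by (force simp: image_image)
    ultimately show ?thesis by simp
  qed
  then show ?thesis
    using poset_iso_chain[OF f \<open>\<Phi> \<in> Chains P\<close>] by (auto simp: flags_def)
qed

text \<open>Isomorphisms of posets come with no statement about ranks. On a flag they induce a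
  strictly increasing map of a finite interval into itself, and this lemma then shows that ranks are
  kept.\<close>

lemma strict_mono_int_interval_id:
  fixes h :: "int \<Rightarrow> int"
  assumes range: "\<And>j. j \<in> {a..b} \<Longrightarrow> h j \<in> {a..b}"
    and mono: "\<And>i j. i \<in> {a..b} \<Longrightarrow> j \<in> {a..b} \<Longrightarrow> i < j \<Longrightarrow> h i < h j" and j: "j \<in> {a..b}"
  shows "h j = j"
proof (rule antisym)
  have "a \<le> j" using j by simp
  then have "j \<le> b \<longrightarrow> j \<le> h j"
  proof (induction j rule: int_ge_induct)
    case base
    then show ?case using range[of a] by simp
  next
    case (step i)
    then show ?case using mono[of i "i + 1"] by auto
  qed
  then show "j \<le> h j" using j by simp
  have "j \<le> b" using j by simp
  then have "a \<le> j \<longrightarrow> h j \<le> j"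
  proof (induction j rule: int_le_induct)
    case base
    then show ?case using range[of b] by simp
  next
    case (step i)
    then show ?case using mono[of "i - 1" i] by auto
  qed
  then show "h j \<le> j" using j by simp
qed

section \<open>Polytopes with regular \<open>k\<close>-faces\<close>

context finite_polytope
begin

lemma least_face_eq: "\<Phi> \<in> flags P \<Longrightarrow> least_face P = fc \<Phi> (-1)"
proof -
  assume \<Phi>: "\<Phi> \<in> flags P"
  obtain F where F: "F \<in> Field P" "rk F = -1" "\<forall>G\<in>Field P. (F, G) \<in> P" using least by blast
  have "fc \<Phi> (-1) \<in> Field P" "rk (fc \<Phi> (-1)) = -1"
    using fc_Field[OF \<Phi>] rk_fc[OF \<Phi>] n_ge by auto
  then have "F = fc \<Phi> (-1)" using F P_rk_eq by auto
  moreover have "least_face P = F"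
    unfolding least_face_def
  proof (rule the_equality)
    show "F \<in> Field P \<and> (\<forall>G\<in>Field P. (F, G) \<in> P)" using F by blast
    fix E assume E: "E \<in> Field P \<and> (\<forall>G\<in>Field P. (E, G) \<in> P)"
    then have "(E, F) \<in> P" "(F, E) \<in> P" using F by blast+
    then show "E = F" using P_rk P_rk_eq by (metis order_antisym)
  qed
  ultimately show ?thesis by simp
qed

lemma Field_section:
  assumes "(F, G) \<in> P"
  shows "Field (section_poset P F G) = {H. (F, H) \<in> P \<and> (H, G) \<in> P}"
proof -
  have "(H, H) \<in> P" if "(F, H) \<in> P" for H
    using that P_refl by (auto simp: Field_def)
  then show ?thesis
    by (force simp: section_poset_def Field_def)
qed

lemma section_iff:
  assumes FG: "(F, G) \<in> P" and "A \<in> Field (section_poset P F G)" "B \<in> Field (section_poset P F G)"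
  shows "(A, B) \<in> section_poset P F G \<longleftrightarrow> (A, B) \<in> P"
  using assms(2,3) unfolding Field_section[OF FG] by (simp add: section_poset_def)

text \<open>Recognizes the exchanged face by order alone, the rank of \<open>H\<close> being forced
  by its neighbours. An isomorphism between sections can therefore be shown to respect flag
  changes.\<close>

lemma swap_face:
  assumes \<Phi>: "\<Phi> \<in> flags P" and j: "0 \<le> j" "j < n"
    and H: "(fc \<Phi> (j - 1), H) \<in> P" "(H, fc \<Phi> (j + 1)) \<in> P" "fc \<Phi> (j - 1) \<noteq> H" "H \<noteq> fc \<Phi> (j + 1)"
      "H \<noteq> fc \<Phi> j"
  shows "fc (swap j \<Phi>) j = H"
proof -
  have r: "rk H = j"
    using rank_strict_mono[OF H(1,3)] rank_strict_mono[OF H(2,4)] rk_fc[OF \<Phi>, of "j - 1"]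
      rk_fc[OF \<Phi>, of "j + 1"] j by auto
  have ab: "-1 \<le> j - 1" "j - 1 \<le> j + 1" "j + 1 \<le> n" using j by auto
  have "H \<in> Field P" using H(1) by (auto simp: Field_def)
  then have "{H} \<in> Chains (section_poset P (fc \<Phi> (j - 1)) (fc \<Phi> (j + 1)))"
    using H(1,2) P_refl by (auto simp: Chains_def section_poset_def)
  then obtain \<Psi> where \<Psi>: "\<Psi> \<in> flags P" "\<And>i. i \<in> {-1..n} \<Longrightarrow> i \<le> j - 1 \<or> j + 1 \<le> i \<Longrightarrow> fc \<Psi> i = fc \<Phi> i"
    "{H} \<subseteq> fc \<Psi> ` {j - 1..j + 1}"
    using section_chain_extends[OF \<Phi> ab] by metis
  obtain i where i: "i \<in> {j - 1..j + 1}" "H = fc \<Psi> i" using \<Psi>(3) by auto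
  then have "i = j" using rk_fc[OF \<Psi>(1), of i] j r by auto
  then have \<Psi>j: "fc \<Psi> j = H" using i by simp
  have "fc \<Psi> i = fc \<Phi> i" if "i \<in> {-1..n}" "i \<noteq> j" for i
    using \<Psi>(2)[of i] that by (cases "i < j") auto
  then have "adj j \<Phi> \<Psi>"
    unfolding adj_def using \<Psi>(1) \<Psi>j H(5) by blast
  then show ?thesis using swap_eqI[OF j \<Phi>] \<Psi>j by simp
qed

end

locale regular_faces = finite_polytope n P rk for n and P :: "'b rel" and rk +
  fixes k :: int and K :: "'c rel"
  assumes k_ge: "-1 \<le> k" and k_le: "k \<le> n"
    and K_regular: "\<And>\<Phi> \<Psi>. \<Phi> \<in> flags K \<Longrightarrow> \<Psi> \<in> flags K \<Longrightarrow> \<exists>\<gamma>\<in>automorphisms K. \<gamma> ` \<Phi> = \<Psi>"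
    and K_faces: "k_faces_isomorphic_to P rk k K"
begin

lemma face_iso:
  assumes \<Phi>: "\<Phi> \<in> flags P"
  obtains f where "poset_iso (section_poset P (fc \<Phi> (-1)) (fc \<Phi> k)) K f"
proof -
  have "fc \<Phi> k \<in> k_faces P rk k"
    using fc_Field[OF \<Phi>] rk_fc[OF \<Phi>] k_ge k_le by (simp add: k_faces_def)
  then show thesis
    using K_faces that least_face_eq[OF \<Phi>] by (auto simp: k_faces_isomorphic_to_def poset_isomorphic_def)
qed

text \<open>Identify both \<open>k\<close>-faces with \<open>K\<close> and insert an automorphism of
  \<open>K\<close> that matches the images of the two flags.\<close>

lemma face_transfer:
  assumes \<Phi>: "\<Phi> \<in> flags P" and \<Psi>: "\<Psi> \<in> flags P"
  obtains \<delta> where "poset_iso (section_poset P (fc \<Phi> (-1)) (fc \<Phi> k)) (section_poset P (fc \<Psi> (-1)) (fc \<Psi> k)) \<delta>"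
    "\<And>j. j \<in> {-1..k} \<Longrightarrow> \<delta> (fc \<Phi> j) = fc \<Psi> j"
proof -
  let ?S = "\<lambda>\<Phi>. section_poset P (fc \<Phi> (-1)) (fc \<Phi> k)"
  obtain f where f: "poset_iso (?S \<Phi>) K f" by (rule face_iso[OF \<Phi>])
  obtain h where h: "poset_iso (?S \<Psi>) K h" by (rule face_iso[OF \<Psi>])
  have fl: "fc \<Phi> ` {-1..k} \<in> flags (?S \<Phi>)" "fc \<Psi> ` {-1..k} \<in> flags (?S \<Psi>)"
    using section_flag[OF \<Phi> _ k_ge k_le] section_flag[OF \<Psi> _ k_ge k_le] by simp_all
  obtain \<gamma> where \<gamma>: "poset_iso K K \<gamma>" "\<gamma> ` f ` fc \<Phi> ` {-1..k} = h ` fc \<Psi> ` {-1..k}"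
    using K_regular[OF poset_iso_flag[OF f fl(1)] poset_iso_flag[OF h fl(2)]] by (auto simp: automorphisms_def)
  define \<delta> where "\<delta> = inv_into (Field (?S \<Psi>)) h \<circ> (\<gamma> \<circ> f)"
  have \<delta>: "poset_iso (?S \<Phi>) (?S \<Psi>) \<delta>"
    unfolding \<delta>_def by (intro poset_iso_comp[OF poset_iso_comp[OF f \<gamma>(1)]] poset_iso_inv[OF h])
  have FieldS: "fc \<Theta> j \<in> Field (?S \<Theta>)" if "\<Theta> \<in> flags P" "j \<in> {-1..k}" for \<Theta> j
    using that fc_le[OF that(1)] k_ge k_le by (subst Field_section) auto
  have img: "\<delta> ` fc \<Phi> ` {-1..k} = fc \<Psi> ` {-1..k}"
  proof -
    have "\<delta> ` fc \<Phi> ` {-1..k} = inv_into (Field (?S \<Psi>)) h ` (\<gamma> ` f ` fc \<Phi> ` {-1..k})"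
      by (simp add: \<delta>_def image_comp comp_assoc)
    also have "\<dots> = fc \<Psi> ` {-1..k}"
      unfolding \<gamma>(2) using bij_betw_inv_into_left[OF poset_isoD(1)[OF h] FieldS[OF \<Psi>]]
      by (simp add: image_image)
    finally show ?thesis .
  qed
  \<comment> \<open>So far the flags correspond as sets; they must also correspond rank by
    rank.\<close>
  have "rk (\<delta> (fc \<Phi> j)) = j" if "j \<in> {-1..k}" for j
    using _ _ that
  proof (rule strict_mono_int_interval_id[where h = "\<lambda>j. rk (\<delta> (fc \<Phi> j))"])
    fix j assume j: "j \<in> {-1..k}"
    then have "\<delta> (fc \<Phi> j) \<in> fc \<Psi> ` {-1..k}" using img by blast
    then show "rk (\<delta> (fc \<Phi> j)) \<in> {-1..k}" using rk_fc[OF \<Psi>] k_le by auto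
  next
    fix i j assume ij: "i \<in> {-1..k}" "j \<in> {-1..k}" "i < j"
    have F: "fc \<Phi> i \<in> Field (?S \<Phi>)" "fc \<Phi> j \<in> Field (?S \<Phi>)" using FieldS[OF \<Phi>] ij by blast+
    have "(fc \<Phi> i, fc \<Phi> j) \<in> P" "(fc \<Phi> (-1), fc \<Phi> i) \<in> P" "(fc \<Phi> (-1), fc \<Phi> j) \<in> P"
      "(fc \<Phi> i, fc \<Phi> k) \<in> P" "(fc \<Phi> j, fc \<Phi> k) \<in> P"
      using ij k_le by (auto intro!: fc_le[OF \<Phi>])
    then have "(fc \<Phi> i, fc \<Phi> j) \<in> ?S \<Phi>" by (simp add: section_poset_def)
    then have "(\<delta> (fc \<Phi> i), \<delta> (fc \<Phi> j)) \<in> P"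
      using poset_isoD(2)[OF \<delta> F] by (simp add: section_poset_def)
    moreover have "fc \<Phi> i \<noteq> fc \<Phi> j" using rk_fc[OF \<Phi>, of i] rk_fc[OF \<Phi>, of j] ij k_le by auto
    then have "\<delta> (fc \<Phi> i) \<noteq> \<delta> (fc \<Phi> j)"
      using poset_isoD(1)[OF \<delta>] F by (auto simp: bij_betw_def inj_on_def)
    ultimately show "rk (\<delta> (fc \<Phi> i)) < rk (\<delta> (fc \<Phi> j))" by (rule rank_strict_mono)
  qed
  moreover have "\<delta> (fc \<Phi> j) = fc \<Psi> (rk (\<delta> (fc \<Phi> j)))" if "j \<in> {-1..k}" for j
  proof -
    have "\<delta> (fc \<Phi> j) \<in> fc \<Psi> ` {-1..k}" using img that by blast
    then show ?thesis using rk_fc[OF \<Psi>] k_le by auto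
  qed
  ultimately have "\<delta> (fc \<Phi> j) = fc \<Psi> j" if "j \<in> {-1..k}" for j
    using that by metis
  then show thesis using that \<delta> by blast
qed

lemma low_gens: "{..<nat k} \<subseteq> {..<nat n}"
  using k_le by auto

text \<open>An isomorphism of \<open>k\<close>-faces carrying one flag to another commutes with the flag changes of
  rank below \<open>k\<close>, so an element fixing the first flag also fixes the second.\<close>

lemma low_gen_free:
  assumes x: "x \<in> M.gen {..<nat k}" and \<Phi>: "\<Phi> \<in> flags P" and x_fix: "x \<Phi> = \<Phi>"
  shows "x = \<one>\<^bsub>M\<^esub>"
proof (rule M_eqI)
  show xc: "x \<in> carrier M" by (rule M.gen_carrier[OF low_gens x])
  show "\<one>\<^bsub>M\<^esub> \<in> carrier M" by simp
  fix \<Psi> assume \<Psi>: "\<Psi> \<in> flags P"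
  let ?S = "\<lambda>\<Phi>. section_poset P (fc \<Phi> (-1)) (fc \<Phi> k)"
  obtain \<delta> where \<delta>: "poset_iso (?S \<Phi>) (?S \<Psi>) \<delta>" and \<delta>j: "\<And>j. j \<in> {-1..k} \<Longrightarrow> \<delta> (fc \<Phi> j) = fc \<Psi> j"
    by (rule face_transfer[OF \<Phi> \<Psi>]) blast
  \<comment> \<open>\<open>rel A B\<close> relates flags whose parts up to rank \<open>k\<close>
    correspond under \<open>\<delta>\<close>; the condition at rank \<open>k\<close> keeps the faces
    of \<open>A\<close> in the domain of \<open>\<delta>\<close>.\<close>
  define rel where "rel A B \<longleftrightarrow> A \<in> flags P \<and> B \<in> flags P \<and> (\<forall>j\<in>{-1..k}. \<delta> (fc A j) = fc B j) \<and>
    fc A k = fc \<Phi> k" for A B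
  have top: "(fc \<Phi> (-1), fc \<Phi> k) \<in> P"
    using fc_le[OF \<Phi> _ k_ge k_le] by simp
  have FieldS: "fc A j \<in> Field (?S \<Phi>)" if "A \<in> flags P" "fc A k = fc \<Phi> k" "j \<in> {-1..k}" for A j
  proof -
    have "fc \<Phi> (-1) = fc A (-1)" by (rule fc_extremal(1)[OF \<Phi> that(1)])
    then show ?thesis
      using that fc_le[OF that(1), of "-1" j] fc_le[OF that(1), of j k] k_le
      by (subst Field_section[OF top]) simp
  qed
  from low_gens x have "\<forall>A B. rel A B \<longrightarrow> rel (x A) (x B)"
  proof (induction rule: M.gen_induct)
    case one
    then show ?case by (simp add: rel_def M_one)
  next
    case (gen t)
    then have t: "t < nat n" "int t < k" "0 \<le> int t" "int t < n" using k_le by auto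
    show ?case
    proof (intro allI impI)
      fix A B assume AB: "rel A B"
      then have A: "A \<in> flags P" "fc A k = fc \<Phi> k" and B: "B \<in> flags P"
        and eq: "\<And>j. j \<in> {-1..k} \<Longrightarrow> \<delta> (fc A j) = fc B j"
        by (auto simp: rel_def)
      let ?A = "swap (int t) A" and ?B = "swap (int t) B"
      have A': "?A \<in> flags P" and B': "?B \<in> flags P"
        using A B t by (auto intro!: swap_flag)
      have other: "fc ?A j = fc A j" "fc ?B j = fc B j" if "j \<in> {-1..n}" "j \<noteq> int t" for j
        using that A B t by (auto intro!: fc_swap)
      have topA: "fc ?A k = fc \<Phi> k" using other(1)[of k] A(2) k_ge k_le t by auto
      have F: "fc ?A (int t - 1) \<in> Field (?S \<Phi>)" "fc ?A (int t) \<in> Field (?S \<Phi>)"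
          "fc ?A (int t + 1) \<in> Field (?S \<Phi>)" "fc A (int t) \<in> Field (?S \<Phi>)"
        using FieldS[OF A' topA] FieldS[OF A] t by auto
      have le: "(fc ?A (int t - 1), fc ?A (int t)) \<in> ?S \<Phi>" "(fc ?A (int t), fc ?A (int t + 1)) \<in> ?S \<Phi>"
        unfolding section_iff[OF top F(1,2)] section_iff[OF top F(2,3)]
        using t by (auto intro!: fc_le[OF A'])
      have \<delta>_lo: "\<delta> (fc ?A (int t - 1)) = fc B (int t - 1)"
        using other(1)[of "int t - 1"] eq[of "int t - 1"] t by auto
      have \<delta>_hi: "\<delta> (fc ?A (int t + 1)) = fc B (int t + 1)"
        using other(1)[of "int t + 1"] eq[of "int t + 1"] t by auto
      have inj: "\<delta> H \<noteq> \<delta> H'" if "H \<in> Field (?S \<Phi>)" "H' \<in> Field (?S \<Phi>)" "H \<noteq> H'" for H H'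
        using poset_isoD(1)[OF \<delta>] that by (auto simp: bij_betw_def inj_on_def)
      \<comment> \<open>The image of the new face of \<open>A\<close> fits between the neighbours in
        \<open>B\<close> and differs from the old face of \<open>B\<close>, so it can only be the
        new one.\<close>
      have "fc ?B (int t) = \<delta> (fc ?A (int t))"
      proof (rule swap_face[OF B t(3,4)])
        show "(fc B (int t - 1), \<delta> (fc ?A (int t))) \<in> P"
          using le(1) poset_isoD(2)[OF \<delta> F(1,2)] by (simp add: \<delta>_lo section_poset_def)
        show "(\<delta> (fc ?A (int t)), fc B (int t + 1)) \<in> P"
          using le(2) poset_isoD(2)[OF \<delta> F(2,3)] by (simp add: \<delta>_hi section_poset_def)
        have "rk (fc ?A (int t - 1)) = int t - 1" "rk (fc ?A (int t)) = int t" "rk (fc ?A (int t + 1)) = int t + 1"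
          using t by (auto intro!: rk_fc[OF A'])
        then have "fc ?A (int t - 1) \<noteq> fc ?A (int t)" "fc ?A (int t) \<noteq> fc ?A (int t + 1)"
          by (metis diff_eq_eq less_irrefl zless_add1_eq, metis less_irrefl zless_add1_eq)
        then show "fc B (int t - 1) \<noteq> \<delta> (fc ?A (int t))" "\<delta> (fc ?A (int t)) \<noteq> fc B (int t + 1)"
          using inj[OF F(1,2)] inj[OF F(2,3)] by (simp_all add: \<delta>_lo \<delta>_hi)
        have "fc ?A (int t) \<noteq> fc A (int t)"
          by (rule fc_swap_neq[OF t(3,4) A(1)])
        then show "\<delta> (fc ?A (int t)) \<noteq> fc B (int t)"
          using inj[OF F(2,4)] eq[of "int t"] t by auto
      qed
      then have "\<delta> (fc ?A j) = fc ?B j" if "j \<in> {-1..k}" for j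
        using that other[of j] eq[of j] k_le by (cases "j = int t") auto
      then show "rel (r t A) (r t B)"
        using A(1) B t(1) A' B' topA by (simp add: rel_def r_flag)
    qed
  next
    case (mult x y)
    have c: "x \<in> carrier M" "y \<in> carrier M"
      using M.gen_carrier[OF low_gens] mult.hyps by simp_all
    have "rel ((x \<otimes>\<^bsub>M\<^esub> y) A) ((x \<otimes>\<^bsub>M\<^esub> y) B)" if AB: "rel A B" for A B
    proof -
      have "A \<in> flags P" "B \<in> flags P" using AB by (simp_all add: rel_def)
      moreover have "rel (x (y A)) (x (y B))" using AB mult.IH by blast
      ultimately show ?thesis using M_mult[OF c] by simp
    qed
    then show ?case by blast
  qed
  \<comment> \<open>As \<open>x\<close> fixes \<open>\<Phi>\<close>, both \<open>\<Psi>\<close> and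
    \<open>x \<Psi>\<close> correspond to \<open>\<Phi>\<close> and so agree up to rank
    \<open>k\<close>; at higher ranks \<open>x\<close> changes nothing.\<close>
  moreover have "rel \<Phi> \<Psi>"
    using \<Phi> \<Psi> \<delta>j by (simp add: rel_def)
  ultimately have "rel \<Phi> (x \<Psi>)" using x_fix by metis
  then have low: "fc (x \<Psi>) j = fc \<Psi> j" if "j \<in> {-1..k}" for j
    using that \<delta>j by (simp add: rel_def)
  have "x \<Psi> = \<Psi>"
  proof (rule flag_eqI[OF M_flag[OF xc \<Psi>] \<Psi>])
    fix j assume j: "j \<in> {-1..n}"
    show "fc (x \<Psi>) j = fc \<Psi> j"
    proof (cases "j \<le> k")
      case True
      then show ?thesis using low j by simp
    next
      case False
      then show ?thesis by (intro fc_gen[OF low_gens x \<Psi> j]) auto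
    qed
  qed
  then show "x \<Psi> = \<one>\<^bsub>M\<^esub> \<Psi>" using M_one[OF \<Psi>] by simp
qed

text \<open>An element of both subgroups moves a flag only at ranks in \<open>I \<inter> J\<close>.
  Strong connectivity yields an element of \<open>M.gen (I \<inter> J)\<close> with the same effect
  on that flag, and freeness makes the two equal.\<close>

lemma low_gen_intersecting: "M.intersecting (nat k)"
proof -
  have "M.gen I \<inter> M.gen J \<subseteq> M.gen (I \<inter> J)" if IJ: "I \<subseteq> {..<nat k}" "J \<subseteq> {..<nat k}" for I J
  proof
    fix x assume x: "x \<in> M.gen I \<inter> M.gen J"
    obtain \<Phi> where \<Phi>: "\<Phi> \<in> flags P" by (rule flag_exists)
    have sub: "I \<subseteq> {..<nat n}" "J \<subseteq> {..<nat n}" using subset_trans[OF IJ(1) low_gens] subset_trans[OF IJ(2) low_gens] by simp_all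
    have xc: "x \<in> carrier M" using M.gen_carrier[OF sub(1)] x by blast
    let ?D = "{t. t < nat n \<and> fc \<Phi> (int t) \<noteq> fc (x \<Phi>) (int t)}"
    obtain y where y: "y \<in> M.gen ?D" "x \<Phi> = y \<Phi>"
      using strong_flag_connectivity[OF \<Phi> M_flag[OF xc \<Phi>]] by blast
    have D: "?D \<subseteq> I \<inter> J"
    proof
      fix t assume t: "t \<in> ?D"
      then have tn: "int t \<in> {-1..n}" by auto
      have "t \<in> I" using fc_gen[OF sub(1) _ \<Phi> tn] x t by force
      moreover have "t \<in> J" using fc_gen[OF sub(2) _ \<Phi> tn] x t by force
      ultimately show "t \<in> I \<inter> J" by simp
    qed
    then have yIJ: "y \<in> M.gen (I \<inter> J)" by (rule M.gen_monoD[OF y(1)])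
    have yk: "y \<in> M.gen {..<nat k}" by (rule M.gen_monoD[OF yIJ]) (use IJ in blast)
    have xk: "x \<in> M.gen {..<nat k}" using M.gen_monoD[OF _ IJ(1)] x by blast
    have yc: "y \<in> carrier M" by (rule M.gen_carrier[OF low_gens yk])
    have z: "inv\<^bsub>M\<^esub> y \<otimes>\<^bsub>M\<^esub> x \<in> M.gen {..<nat k}"
      by (rule M.gen_mult[OF M.gen_inv[OF low_gens yk] xk])
    have "(inv\<^bsub>M\<^esub> y \<otimes>\<^bsub>M\<^esub> x) \<Phi> = (inv\<^bsub>M\<^esub> y) (y \<Phi>)"
      using M_mult[OF M.inv_closed[OF yc] xc \<Phi>] y(2) by simp
    also have "\<dots> = (inv\<^bsub>M\<^esub> y \<otimes>\<^bsub>M\<^esub> y) \<Phi>"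
      using M_mult[OF M.inv_closed[OF yc] yc \<Phi>] by simp
    also have "\<dots> = \<Phi>" using yc M_one[OF \<Phi>] by simp
    finally have "inv\<^bsub>M\<^esub> y \<otimes>\<^bsub>M\<^esub> x = \<one>\<^bsub>M\<^esub>"
      by (rule low_gen_free[OF z \<Phi>])
    then have "x = y" using xc yc by (metis M.inv_closed M.inv_equality M.inv_inv M.inv_comm)
    then show "x \<in> M.gen (I \<inter> J)" using yIJ by simp
  qed
  then show ?thesis
    unfolding M.intersecting_def using M.gen_mono by (meson Int_lower1 Int_lower2 equalityI le_infI)
qed

end

section \<open>The covering\<close>

locale polytope_cover = Q: finite_polytope n P rkP + C: coset_geometry G n g face rk
  for n :: int and P :: "'b rel" and rkP and G :: "('a, 'm) monoid_scheme" (structure) and g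
    and face :: "int \<Rightarrow> 'a \<Rightarrow> 'f" and rk +
  fixes \<phi> :: "'a \<Rightarrow> 'b set \<Rightarrow> 'b set" and \<Phi>0 :: "'b set"
  assumes \<phi>_hom: "\<phi> \<in> hom G Q.M" and \<phi>_g: "\<And>j. j < nat n \<Longrightarrow> \<phi> (g j) = Q.r j"
    and \<Phi>0: "\<Phi>0 \<in> flags P"
begin

definition act :: "'a \<Rightarrow> 'b set"
  where "act x = \<phi> x \<Phi>0"

text \<open>Elements of \<open>C.H j\<close> act without changing faces of rank \<open>j\<close>, so
  the face of rank \<open>j\<close> of \<open>act x\<close> depends only on the coset of
  \<open>x\<close> and any representative will do.\<close>

definition \<eta> :: "'f \<Rightarrow> 'b"
  where "\<eta> A = Q.fc (act (SOME x. x \<in> carrier G \<and> face (rk A) x = A)) (rk A)"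

lemma \<phi>_carrier: "x \<in> carrier G \<Longrightarrow> \<phi> x \<in> carrier Q.M"
  by (rule hom_in_carrier[OF \<phi>_hom])

lemma act_flag: "x \<in> carrier G \<Longrightarrow> act x \<in> flags P"
  unfolding act_def by (rule Q.M_flag[OF \<phi>_carrier \<Phi>0])

lemma act_mult: "x \<in> carrier G \<Longrightarrow> y \<in> carrier G \<Longrightarrow> act (x \<otimes> y) = \<phi> x (act y)"
  unfolding act_def using hom_mult[OF \<phi>_hom] Q.M_mult[OF \<phi>_carrier \<phi>_carrier \<Phi>0] by simp

lemma \<phi>_image_gen: "I \<subseteq> {..<nat n} \<Longrightarrow> \<phi> ` C.gen I = Q.M.gen I"
proof -
  assume I: "I \<subseteq> {..<nat n}"
  then have "(\<phi> \<circ> g) ` I = Q.r ` I"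
    using \<phi>_g by (intro image_cong) auto
  then show ?thesis
    using C.hom_gen_image[OF Q.M.is_group \<phi>_hom I] by (simp add: Q.M.gen_def)
qed

lemma \<phi>_gen: "I \<subseteq> {..<nat n} \<Longrightarrow> x \<in> C.gen I \<Longrightarrow> \<phi> x \<in> Q.M.gen I"
  using \<phi>_image_gen by blast

lemma \<eta>_face:
  assumes x: "x \<in> carrier G" and j: "j \<in> {-1..n}"
  shows "\<eta> (face j x) = Q.fc (act x) j"
proof -
  define y where "y = (SOME y. y \<in> carrier G \<and> face j y = face j x)"
  have y: "y \<in> carrier G \<and> face j y = face j x"
    unfolding y_def by (rule someI[of _ x]) (use x in simp)
  let ?I = "{t. t < nat n \<and> int t \<noteq> j}"
  have I: "?I \<subseteq> {..<nat n}" "j \<notin> int ` ?I" by auto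
  have h: "y \<otimes> inv x \<in> C.gen ?I" using y x C.face_eq unfolding C.H_def[symmetric] by blast
  have "act y = \<phi> (y \<otimes> inv x) (act x)"
    using act_mult[of "y \<otimes> inv x" x] x y by (simp add: C.m_assoc)
  then have "Q.fc (act y) j = Q.fc (act x) j"
    using Q.fc_gen[OF I(1) \<phi>_gen[OF I(1) h] act_flag[OF x] j I(2)] by simp
  then show ?thesis
    by (simp add: \<eta>_def y_def)
qed

lemma \<eta>_Fl: "x \<in> carrier G \<Longrightarrow> \<eta> ` C.Fl (-1) n x = act x"
proof -
  assume x: "x \<in> carrier G"
  have "\<eta> ` C.Fl (-1) n x = Q.fc (act x) ` {-1..n}"
    unfolding C.Fl_def image_image by (intro image_cong refl \<eta>_face[OF x])
  then show ?thesis using Q.flag_image[OF act_flag[OF x]] by simp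
qed

text \<open>Iterates the intersection condition. Applied to all ranks but one, it confines an
  element that keeps the faces of all those ranks to the group of order two spanned by one
  generator.\<close>

lemma Inter_H:
  assumes "finite A" "x \<in> carrier G" "\<And>t. t \<in> A \<Longrightarrow> x \<in> C.H (int t)"
  shows "x \<in> C.gen ({..<nat n} - A)"
  using assms(1,3)
proof (induction A rule: finite_induct)
  case empty
  then show ?case using C.gen_all assms(2) by simp
next
  case (insert t A)
  have "x \<in> C.gen ({..<nat n} - A)" "x \<in> C.gen {s. s < nat n \<and> int s \<noteq> int t}"
    unfolding C.H_def[symmetric] using insert by simp_all
  then have "x \<in> C.gen (({..<nat n} - A) \<inter> {s. s < nat n \<and> int s \<noteq> int t})"
    by (intro C.intersectingD[OF C.intersecting]) auto
  then show ?case by (rule C.gen_monoD) auto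
qed

lemma adj_j_adjacent:
  assumes \<Phi>: "\<Phi> \<in> flags P" and adj: "Q.adj j \<Phi> \<Psi>" and j: "j \<in> {-1..n}"
  shows "j_adjacent rkP j \<Phi> \<Psi>"
proof -
  have \<Psi>: "\<Psi> \<in> flags P" using adj by (simp add: Q.adj_def)
  have faces: "{F \<in> \<Theta>. rkP F \<noteq> j} = Q.fc \<Theta> ` ({-1..n} - {j})" if \<Theta>: "\<Theta> \<in> flags P" for \<Theta>
  proof -
    have "{F \<in> Q.fc \<Theta> ` {-1..n}. rkP F \<noteq> j} = Q.fc \<Theta> ` ({-1..n} - {j})"
      using Q.rk_fc[OF \<Theta>] by auto
    then show ?thesis using Q.flag_image[OF \<Theta>] by simp
  qed
  have "Q.fc \<Phi> ` ({-1..n} - {j}) = Q.fc \<Psi> ` ({-1..n} - {j})"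
    using adj by (intro image_cong) (auto simp: Q.adj_def)
  moreover have "\<Phi> \<noteq> \<Psi>" using adj by (auto simp: Q.adj_def)
  ultimately show ?thesis
    using faces[OF \<Phi>] faces[OF \<Psi>] by (simp add: j_adjacent_def)
qed

theorem \<eta>_covering: "polytope_covering n C.R rk P rkP \<eta>"
  unfolding polytope_covering_def
proof (intro conjI allI ballI impI)
  show "\<eta> ` Field C.R \<subseteq> Field P"
  proof (rule image_subsetI)
    fix A assume "A \<in> Field C.R"
    then obtain j x where "A = face j x" "-1 \<le> j" "j \<le> n" "x \<in> carrier G" by (rule C.Field_E)
    then show "\<eta> A \<in> Field P"
      using \<eta>_face[of x j] Q.fc_Field[OF act_flag[of x], of j] by simp
  qed
  show "(\<eta> A, \<eta> B) \<in> P" if AB: "(A, B) \<in> C.R" for A B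
  proof -
    obtain i j x where "A = face i x" "B = face j x" "-1 \<le> i" "i \<le> j" "j \<le> n" "x \<in> carrier G"
      using AB by (rule C.R_E)
    then show ?thesis
      using \<eta>_face[of x i] \<eta>_face[of x j] Q.fc_le[OF act_flag[of x], of i j] by simp
  qed
  show "rkP (\<eta> A) = rk A" if A: "A \<in> Field C.R" for A
  proof -
    obtain j x where "A = face j x" "-1 \<le> j" "j \<le> n" "x \<in> carrier G"
      using A by (rule C.Field_E)
    then show ?thesis
      using \<eta>_face[of x j] Q.rk_fc[OF act_flag[of x], of j] by simp
  qed
  show "\<eta> ` \<Phi> \<in> flags P" if "\<Phi> \<in> flags C.R" for \<Phi>
    using that \<eta>_Fl act_flag unfolding C.flags_R by auto
  fix j \<Phi> \<Psi> assume j: "j \<in> {0..n - 1}" and fl: "\<Phi> \<in> flags C.R" "\<Psi> \<in> flags C.R" and adj: "j_adjacent rk j \<Phi> \<Psi>"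
  obtain x y where x: "x \<in> carrier G" "\<Phi> = C.Fl (-1) n x" and y: "y \<in> carrier G" "\<Psi> = C.Fl (-1) n y"
    using fl unfolding C.flags_R by blast
  have same: "face i y = face i x" if i: "i \<in> {-1..n}" "i \<noteq> j" for i
  proof -
    have "face i x \<in> {F \<in> \<Phi>. rk F \<noteq> j}" using i x by (auto simp: C.Fl_def)
    moreover have "{F \<in> \<Phi>. rk F \<noteq> j} = {F \<in> \<Psi>. rk F \<noteq> j}" using adj by (simp add: j_adjacent_def)
    ultimately have "face i x \<in> \<Psi>" by simp
    then obtain l where "face i x = face l y" using y by (auto simp: C.Fl_def)
    then show ?thesis using C.face_eq_rank by metis
  qed
  \<comment> \<open>\<open>h\<close> takes \<open>x\<close> to \<open>y\<close> and keeps every face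
    except that of rank \<open>j\<close>, so it is \<open>\<one>\<close> or
    \<open>g (nat j)\<close>. As the flags differ it is the generator, which acts as the flag change
    of rank \<open>j\<close>.\<close>
  define h where "h = y \<otimes> inv x"
  have h: "h \<in> carrier G" "y = h \<otimes> x" using x y by (simp_all add: h_def C.m_assoc)
  have "h \<in> C.gen ({..<nat n} - ({..<nat n} - {nat j}))"
  proof (rule Inter_H[OF _ h(1)])
    fix t assume "t \<in> {..<nat n} - {nat j}"
    then have "face (int t) y = face (int t) x" using j by (intro same) auto
    then show "h \<in> C.H (int t)" using x y by (simp add: h_def C.face_eq)
  qed simp
  then have "h \<in> C.gen {nat j}" by (rule C.gen_monoD) auto
  moreover have jn: "nat j < nat n" using j by auto
  ultimately have "h = \<one> \<or> h = g (nat j)" using C.gen_singleton by auto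
  moreover have "h \<noteq> \<one>"
  proof
    assume "h = \<one>"
    then have "y = x" using h(2) x by simp
    then have "\<Phi> = \<Psi>" using x y by simp
    moreover have "\<Phi> \<noteq> \<Psi>" using adj by (simp add: j_adjacent_def)
    ultimately show False by simp
  qed
  ultimately have "act y = Q.r (nat j) (act x)"
    using h act_mult[OF h(1) x(1)] \<phi>_g[OF jn] by simp
  then have "act y = Q.swap j (act x)"
    using Q.r_flag[OF jn act_flag[OF x(1)]] j by simp
  then have "Q.adj j (act x) (act y)"
    using Q.adj_swap[OF _ _ act_flag[OF x(1)], of j] j by simp
  then have "j_adjacent rkP j (act x) (act y)"
    using j by (intro adj_j_adjacent[OF act_flag[OF x(1)]]) auto
  then show "j_adjacent rkP j (\<eta> ` \<Phi>) (\<eta> ` \<Psi>)"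
    using x y \<eta>_Fl by simp
qed

text \<open>Faces below \<open>face k x\<close> are represented by \<open>u \<otimes> x\<close> with
  \<open>u\<close> spanned by the first \<open>k\<close> generators. On that span
  \<open>\<phi>\<close> is injective with freely acting image, so no two such faces are merged;
  strong connectivity makes \<open>\<eta>\<close> onto.\<close>

lemma \<eta>_face_iso:
  assumes k: "-1 \<le> k" "k \<le> n"
    and free: "\<And>x \<Phi>. x \<in> Q.M.gen {..<nat k} \<Longrightarrow> \<Phi> \<in> flags P \<Longrightarrow> x \<Phi> = \<Phi> \<Longrightarrow> x = \<one>\<^bsub>Q.M\<^esub>"
    and inj: "inj_on \<phi> (C.gen {..<nat k})" and x: "x \<in> carrier G"
  shows "poset_iso (section_poset C.R (face (-1) x) (face k x))
    (section_poset P (Q.fc (act x) (-1)) (Q.fc (act x) k)) \<eta>"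
proof -
  let ?S = "section_poset C.R (face (-1) x) (face k x)"
  let ?T = "section_poset P (Q.fc (act x) (-1)) (Q.fc (act x) k)"
  let ?B = "C.gen {..<nat k}"
  have sub: "{..<nat k} \<subseteq> {..<nat n}" using k by auto
  note \<Psi> = act_flag[OF x]
  have Bc: "u \<in> carrier G" if "u \<in> ?B" for u
    by (rule C.gen_carrier[OF sub that])
  have topR: "(face (-1) x, face k x) \<in> C.R" using k x by (intro C.R_I) auto
  have topP: "(Q.fc (act x) (-1), Q.fc (act x) k) \<in> P" using Q.fc_le[OF \<Psi> _ k] by simp
  have B_face: "face i (u \<otimes> x) = face i x" if "u \<in> ?B" "k \<le> i \<or> i < 0" for u i
  proof (rule C.face_mult[OF C.gen_sub_H[OF that(1)] x])
    show "{..<nat k} \<subseteq> {t. t < nat n \<and> int t \<noteq> i}" using that(2) k by auto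
  qed
  have high: "Q.fc (act (u \<otimes> x)) j = Q.fc (act x) j" if "u \<in> ?B" "j \<in> {-1..n}" "k \<le> j \<or> j < 0" for u j
    using \<eta>_face[of "u \<otimes> x" j] \<eta>_face[OF x that(2)] B_face[OF that(1,3)] that x Bc by simp
  \<comment> \<open>Such a flag differs from \<open>act x\<close> by monodromy of ranks below
    \<open>k\<close>, which lifts along \<open>\<phi>\<close>.\<close>
  have reach: "\<exists>u\<in>?B. \<Theta> = act (u \<otimes> x)"
    if \<Theta>: "\<Theta> \<in> flags P" "\<And>j. j \<in> {-1..n} \<Longrightarrow> k \<le> j \<Longrightarrow> Q.fc \<Theta> j = Q.fc (act x) j" for \<Theta>
  proof -
    obtain w where w: "w \<in> Q.M.gen {t. t < nat n \<and> Q.fc (act x) (int t) \<noteq> Q.fc \<Theta> (int t)}" "\<Theta> = w (act x)"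
      using Q.strong_flag_connectivity[OF \<Psi> \<Theta>(1)] by blast
    have "{t. t < nat n \<and> Q.fc (act x) (int t) \<noteq> Q.fc \<Theta> (int t)} \<subseteq> {..<nat k}"
    proof
      fix t assume t: "t \<in> {t. t < nat n \<and> Q.fc (act x) (int t) \<noteq> Q.fc \<Theta> (int t)}"
      moreover from t have "int t \<in> {-1..n}" by auto
      ultimately have "\<not> k \<le> int t" using \<Theta>(2)[of "int t"] by auto
      then show "t \<in> {..<nat k}" by auto
    qed
    then have "w \<in> Q.M.gen {..<nat k}" by (rule Q.M.gen_monoD[OF w(1)])
    then obtain u where "u \<in> ?B" "w = \<phi> u" using \<phi>_image_gen[OF sub] by blast
    then show ?thesis using w(2) act_mult[OF Bc x] by auto
  qed
  \<comment> \<open>Flags sharing their face of rank \<open>i\<close> are joined by a word without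
    the letter \<open>i\<close>; its lift \<open>h\<close> lies in \<open>C.H i\<close>, and it
    remains to see that \<open>v = h \<otimes> u\<close>.\<close>
  have key: "face i (u \<otimes> x) = face i (v \<otimes> x)"
    if u: "u \<in> ?B" and v: "v \<in> ?B" and i: "i \<in> {-1..k}"
      and eq: "Q.fc (act (u \<otimes> x)) i = Q.fc (act (v \<otimes> x)) i" for u v i
  proof -
    have fl: "act (u \<otimes> x) \<in> flags P" "act (v \<otimes> x) \<in> flags P"
      using u v x Bc by (auto intro: act_flag)
    let ?D = "{t. t < nat n \<and> Q.fc (act (u \<otimes> x)) (int t) \<noteq> Q.fc (act (v \<otimes> x)) (int t)}"
    obtain w where w: "w \<in> Q.M.gen ?D" "act (v \<otimes> x) = w (act (u \<otimes> x))"
      using Q.strong_flag_connectivity[OF fl] by blast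
    have D: "?D \<subseteq> {..<nat k} - {t. int t = i}"
    proof
      fix t assume t: "t \<in> ?D"
      then have "\<not> k \<le> int t" using high[OF u, of "int t"] high[OF v, of "int t"] by auto
      moreover have "int t \<noteq> i" using t eq by auto
      ultimately show "t \<in> {..<nat k} - {t. int t = i}" by auto
    qed
    have sub': "{..<nat k} - {t. int t = i} \<subseteq> {..<nat n}"
      by (rule subset_trans[OF Diff_subset sub])
    have "w \<in> Q.M.gen ({..<nat k} - {t. int t = i})" by (rule Q.M.gen_monoD[OF w(1) D])
    then obtain h where h: "h \<in> C.gen ({..<nat k} - {t. int t = i})" "w = \<phi> h"
      using \<phi>_image_gen[OF sub'] by blast
    have hB: "h \<in> ?B" by (rule C.gen_monoD[OF h(1)]) auto
    note c = Bc[OF u] Bc[OF v] Bc[OF hB]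
    \<comment> \<open>\<open>z\<close> measures the failure of \<open>v = h \<otimes> u\<close>. It
      fixes \<open>act x\<close>, so freeness and injectivity of \<open>\<phi>\<close> make it
      trivial.\<close>
    define z where "z = inv v \<otimes> (h \<otimes> u)"
    have zB: "z \<in> ?B" unfolding z_def using u v hB sub by (intro C.gen_mult C.gen_inv)
    have "act (z \<otimes> x) = \<phi> (inv v) (\<phi> h (act (u \<otimes> x)))"
      using c x by (simp add: z_def C.m_assoc act_mult)
    also have "\<dots> = \<phi> (inv v) (act (v \<otimes> x))" using w(2) h(2) by simp
    also have "\<dots> = act x"
      using act_mult[of "inv v" "v \<otimes> x"] c x by (simp add: C.m_assoc[symmetric])
    finally have "\<phi> z (act x) = act x" using act_mult[OF Bc[OF zB] x] by simp
    then have "\<phi> z = \<one>\<^bsub>Q.M\<^esub>" by (rule free[OF \<phi>_gen[OF sub zB] \<Psi>])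
    also have "\<dots> = \<phi> \<one>" using hom_one[OF \<phi>_hom C.is_group Q.M.is_group] by simp
    finally have "z = \<one>" using inj_onD[OF inj _ zB C.gen_one] by simp
    then have "v = h \<otimes> u"
      unfolding z_def using c by (metis C.inv_closed C.inv_equality C.inv_inv C.inv_comm C.m_closed)
    moreover have "h \<in> C.H i"
      by (rule C.gen_sub_H[OF h(1)]) (use sub in auto)
    ultimately show ?thesis
      using C.face_mult[of h i "u \<otimes> x"] c x by (simp add: C.m_assoc)
  qed
  have FieldR: "Field ?S = {A. (face (-1) x, A) \<in> C.R \<and> (A, face k x) \<in> C.R}"
  proof -
    have "(A, A) \<in> C.R" if "(face (-1) x, A) \<in> C.R" for A
      using that by (auto elim!: C.R_E intro!: C.R_I)
    then show ?thesis by (force simp: section_poset_def Field_def)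
  qed
  have S_E: "\<exists>i u. A = face i (u \<otimes> x) \<and> i \<in> {-1..k} \<and> u \<in> ?B" if A: "A \<in> Field ?S" for A
  proof -
    have "(A, face k x) \<in> C.R" using A FieldR by blast
    then obtain i j z where z: "A = face i z" "face k x = face j z" "-1 \<le> i" "i \<le> j" "z \<in> carrier G"
      by (rule C.R_E)
    then have j: "j = k" using C.face_eq_rank by metis
    have kz: "face k z = face k x" using z(2) j by simp
    obtain u where u: "u \<in> C.gen {t. t < nat n \<and> int t < k}" "\<And>i. i \<le> k \<Longrightarrow> face i (u \<otimes> x) = face i z"
      using C.common_representative[OF z(5) x kz] by metis
    have "u \<in> ?B" by (rule C.gen_monoD[OF u(1)]) auto
    then show ?thesis using z j u(2) by (intro exI[of _ i] exI[of _ u]) auto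
  qed
  have S_I: "face i (u \<otimes> x) \<in> Field ?S" if "i \<in> {-1..k}" "u \<in> ?B" for i u
    using that k B_face[OF that(2), of "-1"] B_face[OF that(2), of k] x Bc
      C.R_I[of "-1" i "u \<otimes> x"] C.R_I[of i k "u \<otimes> x"] by (simp add: FieldR)
  have \<eta>u: "\<eta> (face i (u \<otimes> x)) = Q.fc (act (u \<otimes> x)) i" if "i \<in> {-1..k}" "u \<in> ?B" for i u
    using that k x Bc by (intro \<eta>_face) auto
  have rk_u: "rkP (Q.fc (act (u \<otimes> x)) i) = i" if "i \<in> {-1..k}" "u \<in> ?B" for i u
    using that k x Bc by (intro Q.rk_fc act_flag) auto
  have lift: "\<exists>u\<in>?B. C \<subseteq> Q.fc (act (u \<otimes> x)) ` {-1..k}" if C: "C \<in> Chains ?T" for C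
  proof -
    obtain \<Theta> where \<Theta>: "\<Theta> \<in> flags P" "\<And>j. j \<in> {-1..n} \<Longrightarrow> j \<le> -1 \<or> k \<le> j \<Longrightarrow> Q.fc \<Theta> j = Q.fc (act x) j"
      "C \<subseteq> Q.fc \<Theta> ` {-1..k}"
      using Q.section_chain_extends[OF \<Psi> _ k C] by auto
    then show ?thesis using reach[OF \<Theta>(1)] by blast
  qed
  have T_I: "Q.fc (act (u \<otimes> x)) i \<in> Field ?T" if "i \<in> {-1..k}" "u \<in> ?B" for i u
  proof -
    have fl: "act (u \<otimes> x) \<in> flags P" using that x Bc by (intro act_flag) auto
    have "Q.fc (act (u \<otimes> x)) (-1) = Q.fc (act x) (-1)" "Q.fc (act (u \<otimes> x)) k = Q.fc (act x) k"
      using high[OF that(2), of "-1"] high[OF that(2), of k] k by auto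
    then show ?thesis
      using that k Q.fc_le[OF fl, of "-1" i] Q.fc_le[OF fl, of i k] by (subst Q.Field_section[OF topP]) simp
  qed
  have "bij_betw \<eta> (Field ?S) (Field ?T)"
    unfolding bij_betw_def
  proof
    show "inj_on \<eta> (Field ?S)"
    proof (rule inj_onI)
      fix A B assume AB: "A \<in> Field ?S" "B \<in> Field ?S" "\<eta> A = \<eta> B"
      obtain i u where A: "A = face i (u \<otimes> x)" "i \<in> {-1..k}" "u \<in> ?B" using S_E[OF AB(1)] by blast
      obtain j v where B: "B = face j (v \<otimes> x)" "j \<in> {-1..k}" "v \<in> ?B" using S_E[OF AB(2)] by blast
      have eq: "Q.fc (act (u \<otimes> x)) i = Q.fc (act (v \<otimes> x)) j"
        using AB(3) \<eta>u A B by simp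
      then have "i = j" using rk_u[OF A(2,3)] rk_u[OF B(2,3)] by simp
      then show "A = B" using key[OF A(3) B(3,2)] eq A(1) B(1) by simp
    qed
    show "\<eta> ` Field ?S = Field ?T"
    proof (intro equalityI subsetI)
      fix F assume "F \<in> \<eta> ` Field ?S"
      then obtain A where A: "A \<in> Field ?S" "F = \<eta> A" by blast
      then show "F \<in> Field ?T" using S_E[OF A(1)] \<eta>u T_I by auto
    next
      fix F assume F: "F \<in> Field ?T"
      then have FF: "(Q.fc (act x) (-1), F) \<in> P" "(F, Q.fc (act x) k) \<in> P"
        using Q.Field_section[OF topP] by blast+
      then have "(F, F) \<in> P" by (intro Q.P_refl) (auto simp: Field_def)
      then have "{F} \<in> Chains ?T" using FF by (auto simp: Chains_def section_poset_def)
      then obtain u where u: "u \<in> ?B" "{F} \<subseteq> Q.fc (act (u \<otimes> x)) ` {-1..k}" using lift by blast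
      then obtain i where i: "i \<in> {-1..k}" "F = Q.fc (act (u \<otimes> x)) i" by blast
      then have "F = \<eta> (face i (u \<otimes> x))" using \<eta>u u(1) by simp
      then show "F \<in> \<eta> ` Field ?S" using S_I[OF i(1) u(1)] by blast
    qed
  qed
  moreover have "(A, B) \<in> ?S \<longleftrightarrow> (\<eta> A, \<eta> B) \<in> ?T" if AB: "A \<in> Field ?S" "B \<in> Field ?S" for A B
  proof -
    obtain i u where A: "A = face i (u \<otimes> x)" "i \<in> {-1..k}" "u \<in> ?B" using S_E[OF AB(1)] by blast
    obtain j v where B: "B = face j (v \<otimes> x)" "j \<in> {-1..k}" "v \<in> ?B" using S_E[OF AB(2)] by blast
    have \<eta>AB: "\<eta> A = Q.fc (act (u \<otimes> x)) i" "\<eta> B = Q.fc (act (v \<otimes> x)) j"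
      using \<eta>u A B by simp_all
    have T: "\<eta> A \<in> Field ?T" "\<eta> B \<in> Field ?T"
      unfolding \<eta>AB using T_I A B by simp_all
    have S_iff: "(A, B) \<in> ?S \<longleftrightarrow> (A, B) \<in> C.R"
      using AB unfolding FieldR by (simp add: section_poset_def)
    show ?thesis
      unfolding S_iff Q.section_iff[OF topP T]
    proof
      assume "(A, B) \<in> C.R"
      then show "(\<eta> A, \<eta> B) \<in> P" using \<eta>_covering by (simp add: polytope_covering_def)
    next
      assume le: "(\<eta> A, \<eta> B) \<in> P"
      have ij: "i \<le> j" using Q.P_rk[OF le] rk_u[OF A(2,3)] rk_u[OF B(2,3)] by (simp add: \<eta>AB)
      have "(\<eta> A, \<eta> A) \<in> P" "(\<eta> B, \<eta> B) \<in> P"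
        using le by (auto intro!: Q.P_refl simp: Field_def)
      then have "(\<eta> A, \<eta> A) \<in> ?T" "(\<eta> B, \<eta> B) \<in> ?T" "(\<eta> A, \<eta> B) \<in> ?T"
        using le Q.section_iff[OF topP] T by simp_all
      \<comment> \<open>Comparable images lie in one flag \<open>act (w \<otimes> x)\<close>; by
        \<open>key\<close>, both \<open>A\<close> and \<open>B\<close> are then represented by
        \<open>w \<otimes> x\<close>, hence incident.\<close>
      then have "{\<eta> A, \<eta> B} \<in> Chains ?T"
        by (auto simp: Chains_def)
      then obtain w where w: "w \<in> ?B" "{\<eta> A, \<eta> B} \<subseteq> Q.fc (act (w \<otimes> x)) ` {-1..k}"
        using lift by blast
      have "F = Q.fc (act (w \<otimes> x)) (rkP F)" if F: "F \<in> Q.fc (act (w \<otimes> x)) ` {-1..k}" for F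
        using F rk_u[OF _ w(1)] by auto
      then have "Q.fc (act (u \<otimes> x)) i = Q.fc (act (w \<otimes> x)) i" "Q.fc (act (v \<otimes> x)) j = Q.fc (act (w \<otimes> x)) j"
        using w(2) rk_u[OF A(2,3)] rk_u[OF B(2,3)] unfolding \<eta>AB by (metis insert_subset)+
      then have "A = face i (w \<otimes> x)" "B = face j (w \<otimes> x)"
        using key[OF A(3) w(1) A(2)] key[OF B(3) w(1) B(2)] A(1) B(1) by simp_all
      then show "(A, B) \<in> C.R"
        using ij A(2) B(2) k x w(1) Bc by (auto intro!: C.R_I)
    qed
  qed
  ultimately show ?thesis
    unfolding poset_iso_def by blast
qed

end

section \<open>Existence of the regular covers\<close>

context finite_polytope
begin

text \<open>Used with \<open>m = 0\<close> for an arbitrary polytope and with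
  \<open>m = nat k\<close> when the \<open>k\<close>-faces are regular.\<close>

lemma cover_exists:
  assumes m: "m \<le> nat n" and IP: "M.intersecting m"
  obtains G :: "nat monoid" and g and face :: "int \<Rightarrow> nat \<Rightarrow> nat" and rk' \<phi> \<Phi>0
  where "polytope_cover n P rk G g face rk' \<phi> \<Phi>0" "finite (carrier G)"
    "inj_on \<phi> (generate G (g ` {..<m}))"
proof -
  obtain G :: "nat monoid" and g \<phi> where G: "string_C_group G (nat n) g" "finite (carrier G)"
    and \<phi>: "\<phi> \<in> hom G M" "\<And>j. j < nat n \<Longrightarrow> \<phi> (g j) = r j" "inj_on \<phi> (generate G (g ` {..<m}))"
    using string_C_cover[OF M.string_involutions_axioms finite_M m IP] by metis
  obtain face :: "int \<Rightarrow> nat \<Rightarrow> nat" and rk' where C: "coset_geometry G n g face rk'"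
    using coset_geometry_exists[OF G(1) n_ge] by metis
  obtain \<Phi>0 where \<Phi>0: "\<Phi>0 \<in> flags P" by (rule flag_exists)
  have "polytope_cover n P rk G g face rk' \<phi> \<Phi>0"
    using \<phi> \<Phi>0 by (intro polytope_cover.intro[OF finite_polytope_axioms C]) (simp add: polytope_cover_axioms_def)
  then show thesis using that G(2) \<phi>(3) by blast
qed

theorem regular_cover_exists:
  "\<exists>(R :: nat rel) rkR. regular_polytope n R rkR \<and> finite (Field R) \<and> polytope_covers n R rkR P rk"
proof -
  have IP: "M.intersecting 0" by (simp add: M.intersecting_def)
  obtain G :: "nat monoid" and g and face :: "int \<Rightarrow> nat \<Rightarrow> nat" and rk' \<phi> \<Phi>0
    where c: "polytope_cover n P rk G g face rk' \<phi> \<Phi>0" and fin: "finite (carrier G)"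
    using cover_exists[OF le0 IP] by metis
  interpret polytope_cover n P rk G g face rk' \<phi> \<Phi>0 by (rule c)
  show ?thesis
    using C.regular_polytope_R C.finite_Field_R[OF fin] \<eta>_covering
    unfolding polytope_covers_def by blast
qed

end

context regular_faces
begin

theorem regular_cover_with_faces_exists:
  "\<exists>(R :: nat rel) rkR. regular_polytope n R rkR \<and> finite (Field R) \<and> polytope_covers n R rkR P rk \<and>
    k_faces_isomorphic_to R rkR k K"
proof -
  have m: "nat k \<le> nat n" using k_le by auto
  obtain G :: "nat monoid" and g and face :: "int \<Rightarrow> nat \<Rightarrow> nat" and rk' \<phi> \<Phi>0
    where c: "polytope_cover n P rk G g face rk' \<phi> \<Phi>0" and fin: "finite (carrier G)"
      and inj: "inj_on \<phi> (generate G (g ` {..<nat k}))"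
    using cover_exists[OF m low_gen_intersecting] by metis
  interpret cov: polytope_cover n P rk G g face rk' \<phi> \<Phi>0 by (rule c)
  have "k_faces_isomorphic_to cov.C.R rk' k K"
    unfolding k_faces_isomorphic_to_def
  proof
    fix A assume "A \<in> k_faces cov.C.R rk' k"
    then have A: "A \<in> Field cov.C.R" "rk' A = k" by (simp_all add: k_faces_def)
    obtain j x where x: "A = face j x" "x \<in> carrier G" using A(1) by (rule cov.C.Field_E)
    then have Ax: "A = face k x" using A(2) by simp
    have 1: "poset_iso (section_poset cov.C.R (face (-1) x) (face k x))
        (section_poset P (fc (cov.act x) (-1)) (fc (cov.act x) k)) cov.\<eta>"
      by (rule cov.\<eta>_face_iso[OF k_ge k_le low_gen_free _ x(2)]) (use inj in \<open>simp_all add: cov.C.gen_def\<close>)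
    obtain f where "poset_iso (section_poset P (fc (cov.act x) (-1)) (fc (cov.act x) k)) K f"
      by (rule face_iso[OF cov.act_flag[OF x(2)]])
    then have "poset_iso (section_poset cov.C.R (face (-1) x) (face k x)) K (f \<circ> cov.\<eta>)"
      by (rule poset_iso_comp[OF 1])
    then show "poset_isomorphic (section_poset cov.C.R (least_face cov.C.R) A) K"
      unfolding Ax cov.C.least_face_R[OF x(2)] poset_isomorphic_def by blast
  qed
  then show ?thesis
    using cov.C.regular_polytope_R cov.C.finite_Field_R[OF fin] cov.\<eta>_covering
    unfolding polytope_covers_def by blast
qed

end

theorem theorem3p4:
  shows
    "(\<forall>n (G :: ('a, 'm) monoid_scheme) g.
        sggi G n g \<and> finite (carrier G) \<longrightarrow>
        (\<exists>(G' :: nat monoid) g'.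
           string_C_group G' n g' \<and> finite (carrier G') \<and> sggi_covers n G' g' G g))
     \<and>
     (\<forall>n (Q :: 'b rel) rkQ.
        abstract_polytope n Q rkQ \<and> finite (Field Q) \<longrightarrow>
        (\<exists>(R :: nat rel) rkR.
           regular_polytope n R rkR \<and> finite (Field R) \<and> polytope_covers n R rkR Q rkQ) \<and>
        (\<forall>k (K :: 'c rel) rkK.
           regular_polytope k K rkK \<and> k_faces_isomorphic_to Q rkQ k K \<longrightarrow>
           (\<exists>(R :: nat rel) rkR.
              regular_polytope n R rkR \<and> finite (Field R) \<and> polytope_covers n R rkR Q rkQ \<and>
              k_faces_isomorphic_to R rkR k K)))"
proof (rule conjI)
  show "\<forall>n (G :: ('a, 'm) monoid_scheme) g.
      sggi G n g \<and> finite (carrier G) \<longrightarrow>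
      (\<exists>(G' :: nat monoid) g'.
         string_C_group G' n g' \<and> finite (carrier G') \<and> sggi_covers n G' g' G g)"
    using sggi_covered_by_string_C_group by blast
  show "\<forall>n (Q :: 'b rel) rkQ.
      abstract_polytope n Q rkQ \<and> finite (Field Q) \<longrightarrow>
      (\<exists>(R :: nat rel) rkR.
         regular_polytope n R rkR \<and> finite (Field R) \<and> polytope_covers n R rkR Q rkQ) \<and>
      (\<forall>k (K :: 'c rel) rkK.
         regular_polytope k K rkK \<and> k_faces_isomorphic_to Q rkQ k K \<longrightarrow>
         (\<exists>(R :: nat rel) rkR.
            regular_polytope n R rkR \<and> finite (Field R) \<and> polytope_covers n R rkR Q rkQ \<and>
            k_faces_isomorphic_to R rkR k K))"
  proof (intro allI impI, rule conjI, goal_cases)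
    case (1 n Q rkQ)
    then interpret finite_polytope n Q rkQ
      by (simp add: finite_polytope_def finite_polytope_axioms_def)
    show ?case by (rule regular_cover_exists)
  next
    case (2 n Q rkQ)
    then interpret finite_polytope n Q rkQ
      by (simp add: finite_polytope_def finite_polytope_axioms_def)
    show ?case
    proof (intro allI impI, elim conjE)
      fix k and K :: "'c rel" and rkK
      assume K: "regular_polytope k K rkK" "k_faces_isomorphic_to Q rkQ k K"
      show "\<exists>(R :: nat rel) rkR. regular_polytope n R rkR \<and> finite (Field R) \<and>
          polytope_covers n R rkR Q rkQ \<and> k_faces_isomorphic_to R rkR k K"
      proof (cases "k \<le> n")
        case True
        interpret K: regular_polytope k K rkK by (rule K(1))
        obtain F where "F \<in> Field K" "rkK F = -1" using K.least by blast
        then have "-1 \<le> k" using K.rank_range by (metis atLeastAtMost_iff imageI)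
        then interpret regular_faces n Q rkQ k K
          using True K(2) K.flag_transitive by unfold_locales
        show ?thesis by (rule regular_cover_with_faces_exists)
      next
        \<comment> \<open>Above rank \<open>n\<close> the cover has no faces, so the requirement on
          \<open>k\<close>-faces holds vacuously.\<close>
        case False
        obtain R :: "nat rel" and rkR where R: "regular_polytope n R rkR" "finite (Field R)"
          "polytope_covers n R rkR Q rkQ" using regular_cover_exists by blast
        interpret R: regular_polytope n R rkR by (rule R(1))
        have "k_faces R rkR k = {}"
          using False R.rank_range by (fastforce simp: k_faces_def)
        then show ?thesis using R by (auto simp: k_faces_isomorphic_to_def)
      qed
    qed
  qed
qed

end
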